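(* Let $P=\mathbb{C}[x]\blacktriangleright\!\!\triangleleft_{\hbar,\mathsf{G}}\mathbb{C}[p]$ be the Planck scale Hopf algebra. (a) Finite dimensional (bicovariant first order) differential calculi $\Omega^1$ on $P$ are in one-to-one correspondence with non-empty finite subsets $I\subset\mathbb N$, and the calculus corresponding to $I$ has dimension $\big(\sum_{n\in I}n\big)-1$. (b) The differential calculus of dimension $n\ge2$ corresponding to $\{n,1\}$ has a right-invariant basis $\eta_0,\dots,\eta_{n-1}$ so that $$\mathrm dg=g\eta_0,\qquad\mathrm dp=g\eta_1,$$ $$[g,\eta_k]=\begin{cases}0&\text{if }k\ne1\\ \imath A\,g\eta_0&\text{if }k=1\end{cases}\qquad [p,\eta_k]=\imath A\,k\,g\eta_k+\begin{cases}0&\text{if }k=0\text{ or }k=n-1\\ g\eta_{k+1}&\text{if }0<k<n-1\end{cases}$$ and left coaction $$\beta_L(\eta_k)=\begin{cases}g^{-k}\otimes\eta_k&\text{if }k\neq1\\ g^{-1}\otimes\eta_1+g^{-1}p\otimes\eta_0&\text{if }k=1.\end{cases}$$ (c) The differential calculus of dimension $n-1\ge1$ corresponding to $\{n\}$ is the same as in (b) except that $\eta_0=0$.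
   Context: $\hbar,\mathsf G$ are constants ($\mathsf G\ne0$), $A=\hbar/\mathsf G$, $\imath$ is the imaginary unit, $\mathbb N=\{1,2,\dots\}$. The Planck scale Hopf algebra $P$ (in algebraic form, with $g=e^{-x/\mathsf G}$ and $g^{-1}$ used instead of $x$) is generated over $\mathbb C$ by $p,g,g^{-1}$ with $[p,g]=\imath A(1-g)g$, $\Delta p=p\otimes g+1\otimes p$, $\Delta g=g\otimes g$, $\epsilon(p)=0$, $\epsilon(g)=1$, $Sp=-pg^{-1}$, $Sg=g^{-1}$. A first order bicovariant differential calculus on a Hopf algebra $H$ is an $H$-bimodule and $H$-bicomodule $\Omega^1$, with commuting coactions $\beta_L,\beta_R$ that are bimodule maps, together with a bicomodule map $\mathrm d:H\to\Omega^1$ obeying $\mathrm d(hg)=(\mathrm dh)g+h\,\mathrm dg$ and $\Omega^1=\mathrm{span}\{h\,\mathrm dg\}$; calculi are considered up to isomorphism compatible with $\mathrm d$. One has $\Omega^1\cong V\otimes H$ with $V=\{\omega:\beta_R(\omega)=\omega\otimes1\}$ the space of right-invariant 1-forms; the dimension of the calculus is $\dim V$, and a right-invariant basis means a basis of $V$. Commutators are $[a,\eta]=a\eta-\eta a$. *)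

theory Defs
  imports Complex_Main "HOL-Library.Poly_Mapping"
begin

section \<open>Complex vector spaces and algebras\<close>

class complex_vector = ab_group_add +
  fixes scaleC :: "complex \<Rightarrow> 'a \<Rightarrow> 'a" (infixr "*\<^sub>C" 75)
  assumes scaleC_add_right: "a *\<^sub>C (x + y) = a *\<^sub>C x + a *\<^sub>C y"
    and scaleC_add_left: "(a + b) *\<^sub>C x = a *\<^sub>C x + b *\<^sub>C x"
    and scaleC_scaleC: "a *\<^sub>C (b *\<^sub>C x) = (a * b) *\<^sub>C x"
    and scaleC_one: "1 *\<^sub>C x = x"

global_interpretation complex_vector:
  vector_space "scaleC :: complex \<Rightarrow> 'a \<Rightarrow> 'a::complex_vector"
  by unfold_locales
    (rule scaleC_add_right scaleC_add_left scaleC_scaleC scaleC_one)+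

class complex_algebra_1 = complex_vector + ring_1 +
  assumes mult_scaleC_left: "(a *\<^sub>C x) * y = a *\<^sub>C (x * y)"
    and mult_scaleC_right: "x * (a *\<^sub>C y) = a *\<^sub>C (x * y)"

instantiation complex :: complex_algebra_1
begin
definition scaleC_complex :: "complex \<Rightarrow> complex \<Rightarrow> complex"
  where "scaleC_complex a x = a * x"
instance
  by standard (simp_all add: scaleC_complex_def algebra_simps)
end

instantiation poly_mapping :: (type, complex_vector) complex_vector
begin
definition scaleC_poly_mapping :: "complex \<Rightarrow> ('a \<Rightarrow>\<^sub>0 'b) \<Rightarrow> ('a \<Rightarrow>\<^sub>0 'b)"
  where "scaleC_poly_mapping c f = Poly_Mapping.map (scaleC c) f"

lemma lookup_scaleC:
  fixes f :: "'a \<Rightarrow>\<^sub>0 'b"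
  shows "Poly_Mapping.lookup (c *\<^sub>C f) k = c *\<^sub>C Poly_Mapping.lookup f k"
  by (simp add: scaleC_poly_mapping_def Poly_Mapping.map.rep_eq when_def)

instance
  by standard
    (rule poly_mapping_eqI,
     simp add: lookup_scaleC lookup_add scaleC_add_right scaleC_add_left scaleC_scaleC scaleC_one)+
end

definition linear_on :: "'a::complex_vector set \<Rightarrow> ('a \<Rightarrow> 'b::complex_vector) \<Rightarrow> bool"
  where "linear_on X f \<longleftrightarrow>
    (\<forall>x\<in>X. \<forall>y\<in>X. f (x + y) = f x + f y) \<and> (\<forall>c. \<forall>x\<in>X. f (c *\<^sub>C x) = c *\<^sub>C f x)"

definition bilinear_on ::
  "'a::complex_vector set \<Rightarrow> 'b::complex_vector set \<Rightarrow> ('a \<Rightarrow> 'b \<Rightarrow> 'c::complex_vector) \<Rightarrow> bool"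
  where "bilinear_on X Y B \<longleftrightarrow>
    (\<forall>x\<in>X. linear_on Y (B x)) \<and> (\<forall>y\<in>Y. linear_on X (\<lambda>x. B x y))"

text \<open>The elements of \<open>'k \<Rightarrow>\<^sub>0 complex\<close> are the finite formal linear combinations of elements
  of \<open>'k\<close>; \<open>free_extend \<phi>\<close> is the linear map on them that sends \<open>k\<close> to \<open>\<phi> k\<close>.\<close>

definition free_extend :: "('k \<Rightarrow> 'c::complex_vector) \<Rightarrow> ('k \<Rightarrow>\<^sub>0 complex) \<Rightarrow> 'c"
  where "free_extend \<phi> f = (\<Sum>k\<in>Poly_Mapping.keys f. Poly_Mapping.lookup f k *\<^sub>C \<phi> k)"

lemma free_extend_superset:
  assumes "finite K" "Poly_Mapping.keys f \<subseteq> K"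
  shows "free_extend \<phi> f = (\<Sum>k\<in>K. Poly_Mapping.lookup f k *\<^sub>C \<phi> k)"
  unfolding free_extend_def using assms
  by (intro sum.mono_neutral_left) (auto simp: in_keys_iff)

lemma free_extend_add: "free_extend \<phi> (f + g) = free_extend \<phi> f + free_extend \<phi> g"
proof -
  let ?K = "Poly_Mapping.keys f \<union> Poly_Mapping.keys g"
  have "free_extend \<phi> (f + g) = (\<Sum>k\<in>?K. Poly_Mapping.lookup (f + g) k *\<^sub>C \<phi> k)"
    by (rule free_extend_superset) (simp_all add: Poly_Mapping.keys_add)
  also have "\<dots> = (\<Sum>k\<in>?K. Poly_Mapping.lookup f k *\<^sub>C \<phi> k)
      + (\<Sum>k\<in>?K. Poly_Mapping.lookup g k *\<^sub>C \<phi> k)"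
    by (simp add: lookup_add scaleC_add_left sum.distrib)
  also have "(\<Sum>k\<in>?K. Poly_Mapping.lookup f k *\<^sub>C \<phi> k) = free_extend \<phi> f"
    by (rule free_extend_superset[symmetric]) simp_all
  also have "(\<Sum>k\<in>?K. Poly_Mapping.lookup g k *\<^sub>C \<phi> k) = free_extend \<phi> g"
    by (rule free_extend_superset[symmetric]) simp_all
  finally show ?thesis .
qed

lemma free_extend_scaleC: "free_extend \<phi> (c *\<^sub>C f) = c *\<^sub>C free_extend \<phi> f"
proof -
  have "free_extend \<phi> (c *\<^sub>C f)
      = (\<Sum>k\<in>Poly_Mapping.keys f. Poly_Mapping.lookup (c *\<^sub>C f) k *\<^sub>C \<phi> k)"
    by (rule free_extend_superset) (auto simp: in_keys_iff lookup_scaleC scaleC_complex_def)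
  then show ?thesis
    by (simp add: free_extend_def complex_vector.scale_sum_right lookup_scaleC
        scaleC_complex_def scaleC_scaleC)
qed

lemma free_extend_single: "free_extend \<phi> (Poly_Mapping.single k c) = c *\<^sub>C \<phi> k"
  by (simp add: free_extend_def)

lemma linear_free_extend: "Vector_Spaces.linear scaleC scaleC (free_extend \<phi>)"
  by unfold_locales (simp_all add: free_extend_add free_extend_scaleC)


section \<open>Tensor products over the complex numbers\<close>

definition tensor_relations :: "('a::complex_vector \<times> 'b::complex_vector \<Rightarrow>\<^sub>0 complex) set"
  where "tensor_relations =
      {Poly_Mapping.single (x + x', y) 1 - Poly_Mapping.single (x, y) 1
        - Poly_Mapping.single (x', y) 1 | x x' y. True}
    \<union> {Poly_Mapping.single (x, y + y') 1 - Poly_Mapping.single (x, y) 1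
        - Poly_Mapping.single (x, y') 1 | x y y'. True}
    \<union> {Poly_Mapping.single (c *\<^sub>C x, y) 1 - Poly_Mapping.single (x, y) c | c x y. True}
    \<union> {Poly_Mapping.single (x, c *\<^sub>C y) 1 - Poly_Mapping.single (x, y) c | c x y. True}"

definition tensor_eq ::
  "('a::complex_vector \<times> 'b::complex_vector \<Rightarrow>\<^sub>0 complex) \<Rightarrow> ('a \<times> 'b \<Rightarrow>\<^sub>0 complex) \<Rightarrow> bool"
  where "tensor_eq f g \<longleftrightarrow> f - g \<in> complex_vector.span tensor_relations"

lemma equivp_tensor_eq: "equivp tensor_eq"
proof (rule equivpI)
  show "reflp tensor_eq"
    by (auto simp: reflp_def tensor_eq_def complex_vector.span_zero)
  show "symp tensor_eq"
    unfolding symp_def tensor_eq_def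
    by (auto dest: complex_vector.span_neg)
  show "transp tensor_eq"
    unfolding transp_def tensor_eq_def
    by (auto dest: complex_vector.span_add)
qed

quotient_type (overloaded) ('a, 'b) tensor =
  "'a::complex_vector \<times> 'b::complex_vector \<Rightarrow>\<^sub>0 complex" / tensor_eq
  by (rule equivp_tensor_eq)

instantiation tensor :: (complex_vector, complex_vector) complex_vector
begin

lift_definition zero_tensor :: "('a, 'b) tensor" is 0 .

lift_definition plus_tensor :: "('a, 'b) tensor \<Rightarrow> ('a, 'b) tensor \<Rightarrow> ('a, 'b) tensor"
  is "(+)"
  unfolding tensor_eq_def
proof -
  fix f f' g g' :: "'a \<times> 'b \<Rightarrow>\<^sub>0 complex"
  assume "f - f' \<in> complex_vector.span tensor_relations" and "g - g' \<in> complex_vector.span tensor_relations"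
  then have "(f - f') + (g - g') \<in> complex_vector.span tensor_relations"
    by (rule complex_vector.span_add)
  then show "f + g - (f' + g') \<in> complex_vector.span tensor_relations"
    by (simp add: algebra_simps)
qed

lift_definition uminus_tensor :: "('a, 'b) tensor \<Rightarrow> ('a, 'b) tensor" is uminus
  unfolding tensor_eq_def
proof -
  fix f f' :: "'a \<times> 'b \<Rightarrow>\<^sub>0 complex"
  assume "f - f' \<in> complex_vector.span tensor_relations"
  then have "- (f - f') \<in> complex_vector.span tensor_relations"
    by (rule complex_vector.span_neg)
  then show "- f - - f' \<in> complex_vector.span tensor_relations"
    by (simp add: algebra_simps)
qed

lift_definition minus_tensor :: "('a, 'b) tensor \<Rightarrow> ('a, 'b) tensor \<Rightarrow> ('a, 'b) tensor"
  is "(-)"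
  unfolding tensor_eq_def
proof -
  fix f f' g g' :: "'a \<times> 'b \<Rightarrow>\<^sub>0 complex"
  assume "f - f' \<in> complex_vector.span tensor_relations"
    and "g - g' \<in> complex_vector.span tensor_relations"
  then have "(f - f') - (g - g') \<in> complex_vector.span tensor_relations"
    by (rule complex_vector.span_diff)
  then show "f - g - (f' - g') \<in> complex_vector.span tensor_relations"
    by (simp add: algebra_simps)
qed

lift_definition scaleC_tensor :: "complex \<Rightarrow> ('a, 'b) tensor \<Rightarrow> ('a, 'b) tensor" is scaleC
  unfolding tensor_eq_def
  by (simp add: complex_vector.scale_right_diff_distrib[symmetric] complex_vector.span_scale)

instance
proof
  fix s t u :: "('a, 'b) tensor" and a b :: complex
  have refl: "tensor_eq f f" for f :: "'a \<times> 'b \<Rightarrow>\<^sub>0 complex"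
    by (simp add: tensor_eq_def complex_vector.span_zero)
  show "s + t + u = s + (t + u)" by transfer (simp add: add.assoc refl)
  show "s + t = t + s" by transfer (simp add: add.commute refl)
  show "0 + s = s" by transfer (simp add: refl)
  show "- s + s = 0" by transfer (simp add: refl)
  show "s - t = s + - t" by transfer (simp add: refl)
  show "a *\<^sub>C (s + t) = a *\<^sub>C s + a *\<^sub>C t" by transfer (simp add: scaleC_add_right refl)
  show "(a + b) *\<^sub>C s = a *\<^sub>C s + b *\<^sub>C s" by transfer (simp add: scaleC_add_left refl)
  show "a *\<^sub>C (b *\<^sub>C s) = (a * b) *\<^sub>C s" by transfer (simp add: scaleC_scaleC refl)
  show "1 *\<^sub>C s = s" by transfer (simp add: scaleC_one refl)
qed

end

lift_definition pure_tensor :: "'a::complex_vector \<Rightarrow> 'b::complex_vector \<Rightarrow> ('a, 'b) tensor"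
  (infixr "\<otimes>" 68) is "\<lambda>x y. Poly_Mapping.single (x, y) 1" .

text \<open>For subspaces \<open>X\<close> and \<open>Y\<close> the tensor product of \<open>X\<close> and \<open>Y\<close> is identified with its
  (injective) image in the tensor product of the surrounding spaces.\<close>

definition tensor_space ::
  "'a::complex_vector set \<Rightarrow> 'b::complex_vector set \<Rightarrow> ('a, 'b) tensor set"
  where "tensor_space X Y = complex_vector.span {x \<otimes> y | x y. x \<in> X \<and> y \<in> Y}"

text \<open>The linear map on \<open>tensor_space X Y\<close> induced by a map \<open>B\<close> that is bilinear on
  \<open>X\<close> and \<open>Y\<close>. Since \<open>B\<close> need not be bilinear elsewhere, it is evaluated on a
  representative all of whose entries lie in \<open>X\<close> and \<open>Y\<close>; by the lemma
  \<open>tensor_lift_eq\<close> below the choice of the representative does not matter.\<close>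

definition tensor_lift ::
  "'a::complex_vector set \<Rightarrow> 'b::complex_vector set \<Rightarrow> ('a \<Rightarrow> 'b \<Rightarrow> 'c::complex_vector)
    \<Rightarrow> ('a, 'b) tensor \<Rightarrow> 'c"
  where "tensor_lift X Y B t = free_extend (case_prod B)
    (SOME r. abs_tensor r = t \<and> Poly_Mapping.keys r \<subseteq> X \<times> Y)"

lemma tensor_lift_eq:
  fixes B :: "'a::complex_vector \<Rightarrow> 'b::complex_vector \<Rightarrow> 'c::complex_vector"
  assumes X: "complex_vector.subspace X" and Y: "complex_vector.subspace Y"
    and B: "bilinear_on X Y B" and r: "Poly_Mapping.keys r \<subseteq> X \<times> Y"
  shows "tensor_lift X Y B (abs_tensor r) = free_extend (case_prod B) r"
proof -
  have proj: "\<exists>q. Vector_Spaces.linear scaleC scaleC q \<and> range q \<subseteq> S \<and> (\<forall>x\<in>S. q x = x)"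
    if S: "complex_vector.subspace S" for S :: "'d::complex_vector set"
  proof -
    interpret vector_space_pair "scaleC :: complex \<Rightarrow> 'd \<Rightarrow> 'd" "scaleC :: complex \<Rightarrow> 'd \<Rightarrow> 'd"
      by unfold_locales
    show ?thesis
      using linear_exists_left_inverse_on[OF complex_vector.linear_ident S] by auto
  qed
  obtain q where q: "Vector_Spaces.linear scaleC scaleC q" "range q \<subseteq> X" "\<forall>x\<in>X. q x = x"
    using proj[OF X] by blast
  obtain q' where q': "Vector_Spaces.linear scaleC scaleC q'" "range q' \<subseteq> Y" "\<forall>y\<in>Y. q' y = y"
    using proj[OF Y] by blast
  interpret q: Vector_Spaces.linear scaleC scaleC q by (fact q(1))
  interpret q': Vector_Spaces.linear scaleC scaleC q' by (fact q'(1))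
  define E where "E = free_extend (\<lambda>(x, y). B (q x) (q' y))"
  interpret E: Vector_Spaces.linear scaleC scaleC E
    unfolding E_def by (rule linear_free_extend)
  have E_single: "E (Poly_Mapping.single (x, y) c) = c *\<^sub>C B (q x) (q' y)" for x y c
    by (simp add: E_def free_extend_single)
  have mem: "q x \<in> X" "q' y \<in> Y" for x y
    using q(2) q'(2) by auto
  have E_rel: "E s = 0" if "s \<in> tensor_relations" for s
  proof -
    have add1: "B (u + u') v = B u v + B u' v" and scale1: "B (c *\<^sub>C u) v = c *\<^sub>C B u v"
      if "u \<in> X" "u' \<in> X" "v \<in> Y" for u u' v c
      using B that unfolding bilinear_on_def linear_on_def by blast+
    have add2: "B u (v + v') = B u v + B u v'" and scale2: "B u (c *\<^sub>C v) = c *\<^sub>C B u v"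
      if "u \<in> X" "v \<in> Y" "v' \<in> Y" for u v v' c
      using B that unfolding bilinear_on_def linear_on_def by blast+
    note simps = E.diff E_single q.add q.scale q'.add q'.scale scaleC_one
    from that consider
      (1) x x' y where "s = Poly_Mapping.single (x + x', y) 1 - Poly_Mapping.single (x, y) 1
          - Poly_Mapping.single (x', y) 1"
      | (2) x y y' where "s = Poly_Mapping.single (x, y + y') 1 - Poly_Mapping.single (x, y) 1
          - Poly_Mapping.single (x, y') 1"
      | (3) c x y where "s = Poly_Mapping.single (c *\<^sub>C x, y) 1 - Poly_Mapping.single (x, y) c"
      | (4) c x y where "s = Poly_Mapping.single (x, c *\<^sub>C y) 1 - Poly_Mapping.single (x, y) c"
      unfolding tensor_relations_def by blast
    then show ?thesis
    proof cases
      case 1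
      then show ?thesis by (simp add: simps add1[OF mem(1) mem(1) mem(2)])
    next
      case 2
      then show ?thesis by (simp add: simps add2[OF mem(1) mem(2) mem(2)])
    next
      case 3
      then show ?thesis by (simp add: simps scale1[OF mem(1) mem(1) mem(2)])
    next
      case 4
      then show ?thesis by (simp add: simps scale2[OF mem(1) mem(2) mem(2)])
    qed
  qed
  have E_span: "E s = 0" if "s \<in> complex_vector.span tensor_relations" for s
    using that
    by (induction rule: complex_vector.span_induct_alt) (simp_all add: E.add E.scale E_rel E.zero)
  have E_eq: "E s = free_extend (case_prod B) s" if "Poly_Mapping.keys s \<subseteq> X \<times> Y" for s
    unfolding E_def free_extend_def using that q(3) q'(3)
    by (intro sum.cong) auto
  define r' where "r' = (SOME s. abs_tensor s = abs_tensor r \<and> Poly_Mapping.keys s \<subseteq> X \<times> Y)"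
  have "abs_tensor r' = abs_tensor r \<and> Poly_Mapping.keys r' \<subseteq> X \<times> Y"
    unfolding r'_def by (rule someI[of _ r]) (use r in simp)
  then have r': "r' - r \<in> complex_vector.span tensor_relations" "Poly_Mapping.keys r' \<subseteq> X \<times> Y"
    by (auto simp: tensor.abs_eq_iff tensor_eq_def)
  have "E r' = E r"
    using E_span[OF r'(1)] by (simp add: E.diff)
  then show ?thesis
    by (simp add: tensor_lift_def r'_def[symmetric] E_eq[OF r'(2)] E_eq[OF r])
qed

lemma tensor_lift_pure:
  assumes "complex_vector.subspace X" "complex_vector.subspace Y" "bilinear_on X Y B"
    and "x \<in> X" "y \<in> Y"
  shows "tensor_lift X Y B (x \<otimes> y) = B x y"
  using tensor_lift_eq[OF assms(1-3), of "Poly_Mapping.single (x, y) 1"] assms(4,5)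
  by (simp add: pure_tensor.abs_eq free_extend_single scaleC_one)

definition tensor_map ::
  "'a::complex_vector set \<Rightarrow> 'b::complex_vector set \<Rightarrow> ('a \<Rightarrow> 'c::complex_vector)
    \<Rightarrow> ('b \<Rightarrow> 'd::complex_vector) \<Rightarrow> ('a, 'b) tensor \<Rightarrow> ('c, 'd) tensor"
  where "tensor_map X Y f g = tensor_lift X Y (\<lambda>x y. f x \<otimes> g y)"

definition tensor_assoc ::
  "'a::complex_vector set \<Rightarrow> 'b::complex_vector set \<Rightarrow> 'c::complex_vector set
    \<Rightarrow> (('a, 'b) tensor, 'c) tensor \<Rightarrow> ('a, ('b, 'c) tensor) tensor"
  where "tensor_assoc X Y Z =
    tensor_lift (tensor_space X Y) Z (\<lambda>t z. tensor_lift X Y (\<lambda>x y. x \<otimes> (y \<otimes> z)) t)"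

text \<open>The bilinear extension of \<open>(x \<otimes> y, x' \<otimes> y') \<mapsto> m x x' \<otimes> m' y y'\<close>: the product of an
  algebra tensor square, or the diagonal action on a tensor product.\<close>

definition tensor_mult ::
  "'a::complex_vector set \<Rightarrow> 'b::complex_vector set \<Rightarrow> 'c::complex_vector set
    \<Rightarrow> 'd::complex_vector set \<Rightarrow> ('a \<Rightarrow> 'c \<Rightarrow> 'e::complex_vector)
    \<Rightarrow> ('b \<Rightarrow> 'd \<Rightarrow> 'f::complex_vector)
    \<Rightarrow> ('a, 'b) tensor \<Rightarrow> ('c, 'd) tensor \<Rightarrow> ('e, 'f) tensor"
  where "tensor_mult X Y X' Y' m m' s t =
    tensor_lift X Y (\<lambda>x y. tensor_lift X' Y' (\<lambda>x' y'. m x x' \<otimes> m' y y') t) s"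


section \<open>Hopf algebras and bicovariant differential calculi\<close>

locale hopf_algebra =
  fixes \<Delta> :: "'h::complex_algebra_1 \<Rightarrow> ('h, 'h) tensor"
    and \<epsilon> :: "'h \<Rightarrow> complex"
    and S :: "'h \<Rightarrow> 'h"
  assumes linear_comult: "linear_on UNIV \<Delta>"
    and linear_counit: "linear_on UNIV \<epsilon>"
    and linear_antipode: "linear_on UNIV S"
    and coassoc: "tensor_assoc UNIV UNIV UNIV (tensor_map UNIV UNIV \<Delta> id (\<Delta> h))
      = tensor_map UNIV UNIV id \<Delta> (\<Delta> h)"
    and counit_left: "tensor_lift UNIV UNIV (\<lambda>a b. \<epsilon> a *\<^sub>C b) (\<Delta> h) = h"
    and counit_right: "tensor_lift UNIV UNIV (\<lambda>a b. \<epsilon> b *\<^sub>C a) (\<Delta> h) = h"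
    and comult_one: "\<Delta> 1 = 1 \<otimes> 1"
    and comult_mult: "\<Delta> (h * k) = tensor_mult UNIV UNIV UNIV UNIV (*) (*) (\<Delta> h) (\<Delta> k)"
    and counit_one: "\<epsilon> 1 = 1"
    and counit_mult: "\<epsilon> (h * k) = \<epsilon> h * \<epsilon> k"
    and antipode_left: "tensor_lift UNIV UNIV (\<lambda>a b. S a * b) (\<Delta> h) = \<epsilon> h *\<^sub>C 1"
    and antipode_right: "tensor_lift UNIV UNIV (\<lambda>a b. a * S b) (\<Delta> h) = \<epsilon> h *\<^sub>C 1"

text \<open>The space of 1-forms is a subspace \<open>forms\<close> of a surrounding vector space, so that
  calculi of all dimensions (also the zero calculus) can live in one type. The structure maps
  only matter on \<open>forms\<close>.\<close>

record (overloaded) ('h, 'v) calculus =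
  forms :: "'v set"
  lact :: "'h \<Rightarrow> 'v \<Rightarrow> 'v"
  ract :: "'v \<Rightarrow> 'h \<Rightarrow> 'v"
  lcoact :: "'v \<Rightarrow> ('h, 'v) tensor"
  rcoact :: "'v \<Rightarrow> ('v, 'h) tensor"
  diff :: "'h \<Rightarrow> 'v"

locale bicovariant_calculus = hopf_algebra \<Delta> \<epsilon> S
  for \<Delta> :: "'h::complex_algebra_1 \<Rightarrow> ('h, 'h) tensor"
    and \<epsilon> :: "'h \<Rightarrow> complex"
    and S :: "'h \<Rightarrow> 'h" +
  fixes \<Gamma> :: "('h, 'v::complex_vector) calculus"
  assumes subspace_forms: "complex_vector.subspace (forms \<Gamma>)"
    and lact_closed: "\<omega> \<in> forms \<Gamma> \<Longrightarrow> lact \<Gamma> h \<omega> \<in> forms \<Gamma>"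
    and lact_bilinear: "bilinear_on UNIV (forms \<Gamma>) (lact \<Gamma>)"
    and lact_one: "\<omega> \<in> forms \<Gamma> \<Longrightarrow> lact \<Gamma> 1 \<omega> = \<omega>"
    and lact_mult: "\<omega> \<in> forms \<Gamma> \<Longrightarrow> lact \<Gamma> (h * k) \<omega> = lact \<Gamma> h (lact \<Gamma> k \<omega>)"
    and ract_closed: "\<omega> \<in> forms \<Gamma> \<Longrightarrow> ract \<Gamma> \<omega> h \<in> forms \<Gamma>"
    and ract_bilinear: "bilinear_on (forms \<Gamma>) UNIV (ract \<Gamma>)"
    and ract_one: "\<omega> \<in> forms \<Gamma> \<Longrightarrow> ract \<Gamma> \<omega> 1 = \<omega>"
    and ract_mult: "\<omega> \<in> forms \<Gamma> \<Longrightarrow> ract \<Gamma> \<omega> (h * k) = ract \<Gamma> (ract \<Gamma> \<omega> h) k"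
    and lact_ract: "\<omega> \<in> forms \<Gamma> \<Longrightarrow> lact \<Gamma> h (ract \<Gamma> \<omega> k) = ract \<Gamma> (lact \<Gamma> h \<omega>) k"
    and lcoact_closed: "\<omega> \<in> forms \<Gamma> \<Longrightarrow> lcoact \<Gamma> \<omega> \<in> tensor_space UNIV (forms \<Gamma>)"
    and lcoact_linear: "linear_on (forms \<Gamma>) (lcoact \<Gamma>)"
    and lcoact_coassoc: "\<omega> \<in> forms \<Gamma> \<Longrightarrow>
      tensor_assoc UNIV UNIV (forms \<Gamma>) (tensor_map UNIV (forms \<Gamma>) \<Delta> id (lcoact \<Gamma> \<omega>))
      = tensor_map UNIV (forms \<Gamma>) id (lcoact \<Gamma>) (lcoact \<Gamma> \<omega>)"
    and lcoact_counit: "\<omega> \<in> forms \<Gamma> \<Longrightarrow>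
      tensor_lift UNIV (forms \<Gamma>) (\<lambda>h \<eta>. \<epsilon> h *\<^sub>C \<eta>) (lcoact \<Gamma> \<omega>) = \<omega>"
    and rcoact_closed: "\<omega> \<in> forms \<Gamma> \<Longrightarrow> rcoact \<Gamma> \<omega> \<in> tensor_space (forms \<Gamma>) UNIV"
    and rcoact_linear: "linear_on (forms \<Gamma>) (rcoact \<Gamma>)"
    and rcoact_coassoc: "\<omega> \<in> forms \<Gamma> \<Longrightarrow>
      tensor_assoc (forms \<Gamma>) UNIV UNIV (tensor_map (forms \<Gamma>) UNIV (rcoact \<Gamma>) id (rcoact \<Gamma> \<omega>))
      = tensor_map (forms \<Gamma>) UNIV id \<Delta> (rcoact \<Gamma> \<omega>)"
    and rcoact_counit: "\<omega> \<in> forms \<Gamma> \<Longrightarrow>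
      tensor_lift (forms \<Gamma>) UNIV (\<lambda>\<eta> h. \<epsilon> h *\<^sub>C \<eta>) (rcoact \<Gamma> \<omega>) = \<omega>"
    and coactions_commute: "\<omega> \<in> forms \<Gamma> \<Longrightarrow>
      tensor_assoc UNIV (forms \<Gamma>) UNIV (tensor_map (forms \<Gamma>) UNIV (lcoact \<Gamma>) id (rcoact \<Gamma> \<omega>))
      = tensor_map UNIV (forms \<Gamma>) id (rcoact \<Gamma>) (lcoact \<Gamma> \<omega>)"
    and lcoact_lact: "\<omega> \<in> forms \<Gamma> \<Longrightarrow> lcoact \<Gamma> (lact \<Gamma> h \<omega>)
      = tensor_mult UNIV UNIV UNIV (forms \<Gamma>) (*) (lact \<Gamma>) (\<Delta> h) (lcoact \<Gamma> \<omega>)"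
    and lcoact_ract: "\<omega> \<in> forms \<Gamma> \<Longrightarrow> lcoact \<Gamma> (ract \<Gamma> \<omega> h)
      = tensor_mult UNIV (forms \<Gamma>) UNIV UNIV (*) (ract \<Gamma>) (lcoact \<Gamma> \<omega>) (\<Delta> h)"
    and rcoact_lact: "\<omega> \<in> forms \<Gamma> \<Longrightarrow> rcoact \<Gamma> (lact \<Gamma> h \<omega>)
      = tensor_mult UNIV UNIV (forms \<Gamma>) UNIV (lact \<Gamma>) (*) (\<Delta> h) (rcoact \<Gamma> \<omega>)"
    and rcoact_ract: "\<omega> \<in> forms \<Gamma> \<Longrightarrow> rcoact \<Gamma> (ract \<Gamma> \<omega> h)
      = tensor_mult (forms \<Gamma>) UNIV UNIV UNIV (ract \<Gamma>) (*) (rcoact \<Gamma> \<omega>) (\<Delta> h)"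
    and diff_closed: "diff \<Gamma> h \<in> forms \<Gamma>"
    and diff_linear: "linear_on UNIV (diff \<Gamma>)"
    and lcoact_diff: "lcoact \<Gamma> (diff \<Gamma> h) = tensor_map UNIV UNIV id (diff \<Gamma>) (\<Delta> h)"
    and rcoact_diff: "rcoact \<Gamma> (diff \<Gamma> h) = tensor_map UNIV UNIV (diff \<Gamma>) id (\<Delta> h)"
    and Leibniz: "diff \<Gamma> (h * k) = ract \<Gamma> (diff \<Gamma> h) k + lact \<Gamma> h (diff \<Gamma> k)"
    and forms_span: "forms \<Gamma> = complex_vector.span {lact \<Gamma> h (diff \<Gamma> k) | h k. True}"

definition calculus_iso ::
  "('h::complex_algebra_1, 'v::complex_vector) calculus
    \<Rightarrow> ('h, 'w::complex_vector) calculus \<Rightarrow> bool"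
  where "calculus_iso \<Gamma> \<Gamma>' \<longleftrightarrow> (\<exists>f. bij_betw f (forms \<Gamma>) (forms \<Gamma>')
    \<and> linear_on (forms \<Gamma>) f
    \<and> (\<forall>h. \<forall>\<omega>\<in>forms \<Gamma>. f (lact \<Gamma> h \<omega>) = lact \<Gamma>' h (f \<omega>))
    \<and> (\<forall>h. \<forall>\<omega>\<in>forms \<Gamma>. f (ract \<Gamma> \<omega> h) = ract \<Gamma>' (f \<omega>) h)
    \<and> (\<forall>\<omega>\<in>forms \<Gamma>. lcoact \<Gamma>' (f \<omega>) = tensor_map UNIV (forms \<Gamma>) id f (lcoact \<Gamma> \<omega>))
    \<and> (\<forall>\<omega>\<in>forms \<Gamma>. rcoact \<Gamma>' (f \<omega>) = tensor_map (forms \<Gamma>) UNIV f id (rcoact \<Gamma> \<omega>))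
    \<and> (\<forall>h. f (diff \<Gamma> h) = diff \<Gamma>' h))"

definition right_invariant_forms ::
  "('h::complex_algebra_1, 'v::complex_vector) calculus \<Rightarrow> 'v set"
  where "right_invariant_forms \<Gamma> = {\<omega> \<in> forms \<Gamma>. rcoact \<Gamma> \<omega> = \<omega> \<otimes> 1}"

definition finite_dim_calculus ::
  "('h::complex_algebra_1, 'v::complex_vector) calculus \<Rightarrow> bool"
  where "finite_dim_calculus \<Gamma> \<longleftrightarrow>
    (\<exists>B. finite B \<and> complex_vector.span B = right_invariant_forms \<Gamma>)"

definition calculus_dim ::
  "('h::complex_algebra_1, 'v::complex_vector) calculus \<Rightarrow> nat"
  where "calculus_dim \<Gamma> = complex_vector.dim (right_invariant_forms \<Gamma>)"

definition right_invariant_basis ::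
  "('h::complex_algebra_1, 'v::complex_vector) calculus \<Rightarrow> 'i set \<Rightarrow> ('i \<Rightarrow> 'v) \<Rightarrow> bool"
  where "right_invariant_basis \<Gamma> K \<eta> \<longleftrightarrow> inj_on \<eta> K
    \<and> complex_vector.independent (\<eta> ` K)
    \<and> complex_vector.span (\<eta> ` K) = right_invariant_forms \<Gamma>"

definition form_commutator ::
  "('h::complex_algebra_1, 'v::complex_vector) calculus \<Rightarrow> 'h \<Rightarrow> 'v \<Rightarrow> 'v"
  where "form_commutator \<Gamma> a \<eta> = lact \<Gamma> a \<eta> - ract \<Gamma> \<eta> a"


section \<open>The Planck scale Hopf algebra\<close>

text \<open>The algebraic form: the position generator \<open>x\<close> enters only through
  \<open>g = exp (- x / G)\<close> and its inverse.

  The free algebra on an alphabet \<open>'x\<close> has the words as a basis, with concatenation as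
  product.\<close>

definition free_mult ::
  "('x list \<Rightarrow>\<^sub>0 complex) \<Rightarrow> ('x list \<Rightarrow>\<^sub>0 complex) \<Rightarrow> ('x list \<Rightarrow>\<^sub>0 complex)"
  where "free_mult a b =
    free_extend (\<lambda>u. free_extend (\<lambda>v. Poly_Mapping.single (u @ v) 1) b) a"

definition free_ideal :: "('x list \<Rightarrow>\<^sub>0 complex) set \<Rightarrow> ('x list \<Rightarrow>\<^sub>0 complex) set"
  where "free_ideal R = complex_vector.span {free_mult a (free_mult r b) | a r b. r \<in> R}"

definition free_eval :: "('x \<Rightarrow> 'h::complex_algebra_1) \<Rightarrow> ('x list \<Rightarrow>\<^sub>0 complex) \<Rightarrow> 'h"
  where "free_eval val = free_extend (\<lambda>w. prod_list (map val w))"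

text \<open>The algebra \<open>'h\<close> is the quotient of the free algebra by the two-sided ideal of \<open>R\<close>, via
  \<open>val\<close>.\<close>

definition algebra_presentation ::
  "('x \<Rightarrow> 'h::complex_algebra_1) \<Rightarrow> ('x list \<Rightarrow>\<^sub>0 complex) set \<Rightarrow> bool"
  where "algebra_presentation val R \<longleftrightarrow>
    surj (free_eval val) \<and> (\<forall>f. free_eval val f = 0 \<longleftrightarrow> f \<in> free_ideal R)"

datatype planck_gen = Gen_p | Gen_g | Gen_ginv

definition planck_relations :: "complex \<Rightarrow> (planck_gen list \<Rightarrow>\<^sub>0 complex) set"
  where "planck_relations A =
    {Poly_Mapping.single [Gen_p, Gen_g] 1 - Poly_Mapping.single [Gen_g, Gen_p] 1
       - (Poly_Mapping.single [Gen_g] (\<i> * A) - Poly_Mapping.single [Gen_g, Gen_g] (\<i> * A)),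
     Poly_Mapping.single [Gen_g, Gen_ginv] 1 - Poly_Mapping.single [] 1,
     Poly_Mapping.single [Gen_ginv, Gen_g] 1 - Poly_Mapping.single [] 1}"

locale planck_hopf_algebra = hopf_algebra \<Delta> \<epsilon> S
  for hbar G :: complex
    and p g ginv :: "'h::complex_algebra_1"
    and \<Delta> :: "'h \<Rightarrow> ('h, 'h) tensor"
    and \<epsilon> :: "'h \<Rightarrow> complex"
    and S :: "'h \<Rightarrow> 'h" +
  assumes presentation:
      "algebra_presentation (case_planck_gen p g ginv) (planck_relations (hbar / G))"
    and comult_p: "\<Delta> p = p \<otimes> g + 1 \<otimes> p"
    and comult_g: "\<Delta> g = g \<otimes> g"
    and counit_p: "\<epsilon> p = 0"
    and counit_g: "\<epsilon> g = 1"
    and antipode_p: "S p = - p * ginv"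
    and antipode_g: "S g = ginv"

definition planck_calculus_formulas ::
  "complex \<Rightarrow> 'h \<Rightarrow> 'h \<Rightarrow> 'h \<Rightarrow> ('h::complex_algebra_1, 'v::complex_vector) calculus
    \<Rightarrow> nat \<Rightarrow> (nat \<Rightarrow> 'v) \<Rightarrow> bool"
  where "planck_calculus_formulas A p g ginv \<Gamma> n \<eta> \<longleftrightarrow>
    diff \<Gamma> g = lact \<Gamma> g (\<eta> 0) \<and> diff \<Gamma> p = lact \<Gamma> g (\<eta> 1)
    \<and> (\<forall>k<n. form_commutator \<Gamma> g (\<eta> k) =
          (if k = 1 then (\<i> * A) *\<^sub>C lact \<Gamma> g (\<eta> 0) else 0))
    \<and> (\<forall>k<n. form_commutator \<Gamma> p (\<eta> k) =
          (\<i> * A * of_nat k) *\<^sub>C lact \<Gamma> g (\<eta> k)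
          + (if k = 0 \<or> k = n - 1 then 0 else lact \<Gamma> g (\<eta> (k + 1))))
    \<and> (\<forall>k<n. lcoact \<Gamma> (\<eta> k) =
          (if k = 1 then ginv \<otimes> \<eta> 1 + ginv * p \<otimes> \<eta> 0 else ginv ^ k \<otimes> \<eta> k))"

end

theory Submission
  imports Defs "HOL-Library.Nat_Bijection"
begin

text \<open>
  Put \<open>lam = \<i> * hbar / G\<close>. A calculus is governed by a cyclic left module with a compatible
  left coaction, namely the invariant forms enlarged by a vector \<open>w 0 0\<close> with
  \<open>d h = h (w 0 0) - (w 0 0) h\<close>. The coefficients of the coaction on the elements
  \<open>(p (p + lam) \<dots> (p + (i - 1) lam)) ginv ^ k\<close> give a grading by \<open>k\<close> and a lowering
  operator \<open>low\<close>. In terms of these the action becomes \<open>p = up' + lam k\<close> in degree \<open>k\<close> and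
  \<open>g = (1 + up) (1 - lam low)\<inverse>\<close> with commuting \<open>up\<close>, \<open>up'\<close> and \<open>[low, up'] = up\<close>, so that
  all traces of \<open>hbar\<close> disappear: the invariant forms are spanned by the
  vectors \<open>w k a = up' ^ k (up ^ a (w 0 0))\<close> other than \<open>w 0 0\<close>, the nonzero ones are
  linearly independent, and
  \<open>low (w k a) = k w (k - 1) (a + 1)\<close>. A finite dimensional calculus therefore amounts to
  numbers \<open>d k\<close>, where \<open>w k a = 0\<close> iff \<open>a \<ge> d k\<close>, with \<open>d 0 > 0\<close> and
  \<open>d k - 1 \<le> d (k + 1) \<le> d k\<close>. These are exactly the functions
  \<open>d k = card {n \<in> I. k < n}\<close> for nonempty finite sets \<open>I\<close> of positive integers, and
  \<open>\<Sum>k. d k = \<Sum>I\<close>.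
\<close>

section \<open>Linear maps\<close>

text \<open>The right-invariant forms are a crossed module: besides the left coaction,
  \<open>h\<close> acts by \<open>v \<mapsto> h\<^sub>1 v (S h\<^sub>2)\<close>, so \<open>g\<close>
  by \<open>g v ginv\<close> and \<open>p\<close> by \<open>(p v - v p) ginv\<close>. Adding
  \<open>w 0 0\<close> makes this module cyclic with an invariant generator, but
  \<open>w 0 0\<close> is not a form: a given calculus only sees \<open>w 0 1 = (d g) ginv\<close>,
  \<open>w 1 0 = (d p) ginv\<close> and what they generate. Hence statements about a calculus leave
  out the index (0, 0), and the dimension is one less than the sum of \<open>I\<close>.

  The operators \<open>up\<close>, \<open>up'\<close> and \<open>low\<close> send each
  \<open>w k a\<close> to a multiple of one other such vector, and the multiple \<open>k\<close> of
  \<open>low\<close> is non-zero for \<open>k > 0\<close>. So the places where \<open>w k a\<close>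
  vanishes are closed under three moves, and they determine the calculus up to isomorphism. The move
  of \<open>low\<close>, from \<open>(k + 1, a)\<close> to \<open>(k, a + 1)\<close>, bounds the
  drops of \<open>d\<close> by one: \<open>d\<close> is the conjugate of a partition with distinct
  parts, and \<open>I\<close> is the set of these parts. Conversely \<open>up\<close> and
  \<open>low\<close> are nilpotent for such \<open>d\<close>, so that both factors of the action of
  \<open>g\<close> can be inverted by finite geometric series.\<close>

abbreviation lin :: "('a::complex_vector \<Rightarrow> 'b::complex_vector) \<Rightarrow> bool"
  where "lin \<equiv> linear_on UNIV"

abbreviation bilin :: "('a::complex_vector \<Rightarrow> 'b::complex_vector \<Rightarrow> 'c::complex_vector) \<Rightarrow> bool"
  where "bilin \<equiv> bilinear_on UNIV UNIV"

lemma scaleC_zero_simps [simp]: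
  "0 *\<^sub>C (x::'a::complex_vector) = 0" "c *\<^sub>C (0::'a) = 0" "(1::complex) *\<^sub>C x = x"
  by (simp_all add: scaleC_one)

lemma complex_scaleC [simp]: "a *\<^sub>C (x::complex) = a * x"
  by (simp add: scaleC_complex_def)

lemma linear_on_add: "linear_on X f \<Longrightarrow> x \<in> X \<Longrightarrow> y \<in> X \<Longrightarrow> f (x + y) = f x + f y"
  by (simp add: linear_on_def)

lemma linear_on_scale: "linear_on X f \<Longrightarrow> x \<in> X \<Longrightarrow> f (c *\<^sub>C x) = c *\<^sub>C f x"
  by (simp add: linear_on_def)

lemma linear_on_zero: "linear_on X f \<Longrightarrow> 0 \<in> X \<Longrightarrow> f 0 = 0"
  using linear_on_scale[of X f 0 0] by simp

lemma linear_on_minus: "linear_on X f \<Longrightarrow> x \<in> X \<Longrightarrow> f (- x) = - f x"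
  using linear_on_scale[of X f x "-1"] by simp

lemma linear_on_diff:
  assumes "linear_on X f" "complex_vector.subspace X" "x \<in> X" "y \<in> X"
  shows "f (x - y) = f x - f y"
  using linear_on_add[OF assms(1,3), of "- y"] assms
  by (simp add: linear_on_minus[OF assms(1)] complex_vector.subspace_neg)

lemma linear_on_sum:
  assumes "linear_on X f" "complex_vector.subspace X" "\<And>i. i \<in> A \<Longrightarrow> x i \<in> X"
  shows "f (\<Sum>i\<in>A. x i) = (\<Sum>i\<in>A. f (x i))"
  using assms(3)
proof (induction A rule: infinite_finite_induct)
  case (insert i A)
  then show ?case
    by (simp add: linear_on_add[OF assms(1)] complex_vector.subspace_sum[OF assms(2)])
qed (simp_all add: linear_on_zero[OF assms(1)] complex_vector.subspace_0[OF assms(2)])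

lemma subspace_UNIV [simp]: "complex_vector.subspace UNIV"
  by (simp add: complex_vector.subspace_def)

lemma linI: "(\<And>x y. f (x + y) = f x + f y) \<Longrightarrow> (\<And>c x. f (c *\<^sub>C x) = c *\<^sub>C f x) \<Longrightarrow> lin f"
  by (simp add: linear_on_def)

lemma linear_on_subset: "linear_on Y f \<Longrightarrow> X \<subseteq> Y \<Longrightarrow> linear_on X f"
  unfolding linear_on_def by blast

lemma lin_linear: "lin f \<longleftrightarrow> Vector_Spaces.linear scaleC scaleC f"
proof
  assume "lin f"
  then show "Vector_Spaces.linear scaleC scaleC f"
    by unfold_locales (simp_all add: linear_on_def)
next
  assume "Vector_Spaces.linear scaleC scaleC f"
  then interpret Vector_Spaces.linear scaleC scaleC f .
  show "lin f" by (rule linI) (simp_all add: add scale)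
qed

lemma lin_add: "lin f \<Longrightarrow> f (x + y) = f x + f y"
  by (erule linear_on_add; rule UNIV_I)

lemma lin_scale: "lin f \<Longrightarrow> f (c *\<^sub>C x) = c *\<^sub>C f x"
  by (erule linear_on_scale) (rule UNIV_I)

lemma lin_zero: "lin f \<Longrightarrow> f 0 = 0"
  by (erule linear_on_zero) (rule UNIV_I)

lemma lin_minus: "lin f \<Longrightarrow> f (- x) = - f x"
  by (erule linear_on_minus) (rule UNIV_I)

lemma lin_diff: "lin f \<Longrightarrow> f (x - y) = f x - f y"
  by (erule linear_on_diff) (rule subspace_UNIV UNIV_I)+

lemma lin_sum: "lin f \<Longrightarrow> f (\<Sum>i\<in>A. g i) = (\<Sum>i\<in>A. f (g i))"
  by (erule linear_on_sum) (rule subspace_UNIV UNIV_I)+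

lemmas lin_simps = lin_add lin_scale lin_zero lin_minus lin_diff lin_sum

lemma linear_on_eq_span:
  assumes "linear_on X f" "linear_on X h" "complex_vector.subspace X" "B \<subseteq> X"
    and "\<And>b. b \<in> B \<Longrightarrow> f b = h b" "x \<in> complex_vector.span B"
  shows "f x = h x"
proof -
  have "x \<in> X \<and> f x = h x"
    using assms(6)
    by (induction rule: complex_vector.span_induct_alt)
      (use assms(4,5) in \<open>auto simp: linear_on_zero[OF assms(1)] linear_on_zero[OF assms(2)]
        linear_on_add[OF assms(1)] linear_on_add[OF assms(2)]
        linear_on_scale[OF assms(1)] linear_on_scale[OF assms(2)]
        complex_vector.subspace_0[OF assms(3)] complex_vector.subspace_add[OF assms(3)]
        complex_vector.subspace_scale[OF assms(3)]\<close>)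
  then show ?thesis by simp
qed

lemma bilinear_onI:
  "(\<And>x. x \<in> X \<Longrightarrow> linear_on Y (B x)) \<Longrightarrow> (\<And>y. y \<in> Y \<Longrightarrow> linear_on X (\<lambda>x. B x y))
    \<Longrightarrow> bilinear_on X Y B"
  by (auto simp: bilinear_on_def)

lemma bilinear_on_subset: "bilinear_on X' Y' B \<Longrightarrow> X \<subseteq> X' \<Longrightarrow> Y \<subseteq> Y' \<Longrightarrow> bilinear_on X Y B"
  unfolding bilinear_on_def by (meson linear_on_subset subsetD)

lemma bilinear_on_cong:
  "complex_vector.subspace X \<Longrightarrow> complex_vector.subspace Y \<Longrightarrow> bilinear_on X Y B
    \<Longrightarrow> (\<And>x y. x \<in> X \<Longrightarrow> y \<in> Y \<Longrightarrow> B' x y = B x y) \<Longrightarrow> bilinear_on X Y B'"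
  by (simp add: bilinear_on_def linear_on_def complex_vector.subspace_def)

section \<open>Calculating with tensors\<close>

lemma pure_tensor_add_left: "(x + x') \<otimes> y = x \<otimes> y + x' \<otimes> y"
  apply transfer
  unfolding tensor_eq_def diff_diff_add[symmetric] tensor_relations_def
  by (rule complex_vector.span_base, (rule UnI1)+) blast

lemma pure_tensor_add_right: "x \<otimes> (y + y') = x \<otimes> y + x \<otimes> y'"
  apply transfer
  unfolding tensor_eq_def diff_diff_add[symmetric] tensor_relations_def
  by (rule complex_vector.span_base, rule UnI1, rule UnI1, rule UnI2) blast

lemma single_scaleC: "c *\<^sub>C Poly_Mapping.single k x = Poly_Mapping.single k (c *\<^sub>C x)"
  by (rule poly_mapping_eqI) (simp add: lookup_scaleC lookup_single when_def)

lemma pure_tensor_scale_left: "(c *\<^sub>C x) \<otimes> y = c *\<^sub>C (x \<otimes> y)"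
  apply transfer
  unfolding tensor_eq_def single_scaleC tensor_relations_def
  by (rule complex_vector.span_base, rule UnI1, rule UnI2) (simp, blast)

lemma pure_tensor_scale_right: "x \<otimes> (c *\<^sub>C y) = c *\<^sub>C (x \<otimes> y)"
  apply transfer
  unfolding tensor_eq_def single_scaleC tensor_relations_def
  by (rule complex_vector.span_base, rule UnI2) (simp, blast)

lemma bilin_pure_tensor: "bilin (\<otimes>)"
  by (auto intro!: bilinear_onI linI simp: pure_tensor_add_left pure_tensor_add_right
      pure_tensor_scale_left pure_tensor_scale_right)

lemma lin_pure_left: "lin (\<lambda>x. x \<otimes> y)" and lin_pure_right: "lin (\<lambda>y. x \<otimes> y)"
  using bilin_pure_tensor by (auto simp: bilinear_on_def)

lemmas pure_tensor_simps = lin_simps[OF lin_pure_left] lin_simps[OF lin_pure_right]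

lemma pure_in_tensor_space: "x \<in> X \<Longrightarrow> y \<in> Y \<Longrightarrow> x \<otimes> y \<in> tensor_space X Y"
  unfolding tensor_space_def by (rule complex_vector.span_base) auto

lemma subspace_tensor_space [simp]: "complex_vector.subspace (tensor_space X Y)"
  by (simp add: tensor_space_def)

lemma abs_tensor_add: "abs_tensor (r + s) = abs_tensor r + abs_tensor s"
  by (simp add: plus_tensor.abs_eq)

lemma abs_tensor_scaleC: "abs_tensor (c *\<^sub>C r) = c *\<^sub>C abs_tensor r"
  by (simp add: scaleC_tensor.abs_eq)

lemma keys_scaleC: "Poly_Mapping.keys (c *\<^sub>C f) \<subseteq> Poly_Mapping.keys (f :: 'a \<Rightarrow>\<^sub>0 complex)"
  by (auto simp: in_keys_iff lookup_scaleC)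

text \<open>Supplies the representatives over which \<open>tensor_lift\<close> chooses; with one of
  them \<open>tensor_lift_eq\<close> evaluates the lift.\<close>

lemma tensor_space_representative:
  assumes "t \<in> tensor_space X Y"
  shows "\<exists>r. abs_tensor r = t \<and> Poly_Mapping.keys r \<subseteq> X \<times> Y"
  using assms unfolding tensor_space_def
proof (induction rule: complex_vector.span_induct_alt)
  case base
  show ?case by (rule exI[of _ 0]) (simp add: zero_tensor_def)
next
  case (step c s t)
  then obtain r x y where r: "abs_tensor r = t" "Poly_Mapping.keys r \<subseteq> X \<times> Y"
    and s: "s = x \<otimes> y" "x \<in> X" "y \<in> Y" by auto
  let ?r = "c *\<^sub>C Poly_Mapping.single (x, y) 1 + r"
  have "abs_tensor ?r = c *\<^sub>C s + t"
    by (simp add: abs_tensor_add abs_tensor_scaleC r s pure_tensor.abs_eq)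
  moreover have "Poly_Mapping.keys ?r \<subseteq> X \<times> Y"
    using Poly_Mapping.keys_add[of "c *\<^sub>C Poly_Mapping.single (x, y) 1" r] r s
      keys_scaleC[of c "Poly_Mapping.single (x, y) 1"] by fastforce
  ultimately show ?case by blast
qed

lemma tensor_space_UNIV [simp]: "tensor_space UNIV UNIV = UNIV"
proof -
  have "abs_tensor r \<in> tensor_space UNIV UNIV" for r :: "'a \<times> 'b \<Rightarrow>\<^sub>0 complex"
  proof (induction r rule: update_induct)
    case const
    then show ?case
      using complex_vector.subspace_0[OF subspace_tensor_space]
      by (simp add: zero_tensor_def)
  next
    case (update r a b)
    have "Poly_Mapping.update a b r = b *\<^sub>C Poly_Mapping.single a 1 + r"
      using update by (intro poly_mapping_eqI)
        (auto simp: lookup_update lookup_add lookup_scaleC lookup_single when_def in_keys_iff)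
    then have "abs_tensor (Poly_Mapping.update a b r) = b *\<^sub>C (fst a \<otimes> snd a) + abs_tensor r"
      by (simp add: abs_tensor_add abs_tensor_scaleC pure_tensor.abs_eq)
    then show ?case
      using update by (simp add: complex_vector.subspace_add complex_vector.subspace_scale
          pure_in_tensor_space)
  qed
  then have "t \<in> tensor_space UNIV UNIV" for t :: "('a, 'b) tensor"
    by (induction t rule: tensor.abs_induct)
  then show ?thesis by blast
qed

text \<open>Scalars are absorbed into the left factor, which stays in \<open>X\<close> because
  \<open>X\<close> is a subspace; the induction step is then free of scalars.\<close>

lemma tensor_space_induct [consumes 2, case_names zero add]:
  assumes "t \<in> tensor_space X Y" "complex_vector.subspace X"
    and "P 0"
    and "\<And>x y s. x \<in> X \<Longrightarrow> y \<in> Y \<Longrightarrow> s \<in> tensor_space X Y \<Longrightarrow> P s \<Longrightarrow> P (x \<otimes> y + s)"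
  shows "P t"
proof -
  have "t \<in> tensor_space X Y \<and> P t"
    using assms(1) unfolding tensor_space_def
  proof (induction rule: complex_vector.span_induct_alt)
    case base
    then show ?case using assms(3) by (simp add: complex_vector.span_zero)
  next
    case (step c s t)
    then obtain x y where s: "s = x \<otimes> y" "x \<in> X" "y \<in> Y" by auto
    have eq: "c *\<^sub>C s + t = (c *\<^sub>C x) \<otimes> y + t" by (simp add: s pure_tensor_simps)
    have x: "c *\<^sub>C x \<in> X" using s assms(2) by (simp add: complex_vector.subspace_scale)
    have t: "t \<in> tensor_space X Y" "P t" using step by (simp_all add: tensor_space_def)
    have "(c *\<^sub>C x) \<otimes> y + t \<in> tensor_space X Y"
      using x s t by (simp add: complex_vector.subspace_add pure_in_tensor_space)
    then show ?case
      using assms(4)[OF x s(3) t] unfolding eq tensor_space_def ..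
  qed
  then show ?thesis ..
qed

lemma tensor_induct [case_names zero add]:
  assumes "P 0" "\<And>x y s. P s \<Longrightarrow> P (x \<otimes> y + s)"
  shows "P t"
  by (rule tensor_space_induct[of t UNIV UNIV P]) (use assms in auto)

lemma tensor_lift_linear_on:
  assumes X: "complex_vector.subspace X" and Y: "complex_vector.subspace Y"
    and B: "bilinear_on X Y B"
  shows "linear_on (tensor_space X Y) (tensor_lift X Y B)"
  unfolding linear_on_def
proof (intro conjI ballI allI)
  note eq = tensor_lift_eq[OF X Y B]
  fix s assume "s \<in> tensor_space X Y"
  then obtain r where r: "abs_tensor r = s" "Poly_Mapping.keys r \<subseteq> X \<times> Y"
    using tensor_space_representative by blast
  {
    fix t assume "t \<in> tensor_space X Y"
    then obtain r' where r': "abs_tensor r' = t" "Poly_Mapping.keys r' \<subseteq> X \<times> Y"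
      using tensor_space_representative by blast
    have "Poly_Mapping.keys (r + r') \<subseteq> X \<times> Y"
      using Poly_Mapping.keys_add[of r r'] r r' by blast
    from eq[OF this] show "tensor_lift X Y B (s + t) = tensor_lift X Y B s + tensor_lift X Y B t"
      using eq[OF r(2)] eq[OF r'(2)] r r' by (simp add: free_extend_add abs_tensor_add)
  }
  fix c
  have "Poly_Mapping.keys (c *\<^sub>C r) \<subseteq> X \<times> Y" using keys_scaleC[of c r] r by blast
  from eq[OF this] show "tensor_lift X Y B (c *\<^sub>C s) = c *\<^sub>C tensor_lift X Y B s"
    using eq[OF r(2)] r by (simp add: free_extend_scaleC abs_tensor_scaleC)
qed

lemma linear_on_tensor_eq:
  assumes "linear_on (tensor_space X Y) f" "linear_on (tensor_space X Y) h"
    and "\<And>x y. x \<in> X \<Longrightarrow> y \<in> Y \<Longrightarrow> f (x \<otimes> y) = h (x \<otimes> y)" "t \<in> tensor_space X Y"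
  shows "f t = h t"
  by (rule linear_on_eq_span[OF assms(1,2) subspace_tensor_space _ _
        assms(4)[unfolded tensor_space_def]])
    (use assms(3) in \<open>auto intro: pure_in_tensor_space\<close>)

text \<open>The structure maps of a calculus are controlled on the forms only. Replacing a lift over
  the forms by one over a larger space, along a map that is bilinear there, makes the rules for
  \<open>tlift\<close> available.\<close>

lemma tensor_lift_cong:
  assumes "complex_vector.subspace X" "complex_vector.subspace Y"
    and "complex_vector.subspace X'" "complex_vector.subspace Y'" "X \<subseteq> X'" "Y \<subseteq> Y'"
    and B': "bilinear_on X' Y' B'" and eq: "\<And>x y. x \<in> X \<Longrightarrow> y \<in> Y \<Longrightarrow> B x y = B' x y"
    and t: "t \<in> tensor_space X Y"
  shows "tensor_lift X Y B t = tensor_lift X' Y' B' t"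
proof -
  have B: "bilinear_on X Y B"
    by (rule bilinear_on_cong[OF assms(1,2) bilinear_on_subset[OF B' assms(5,6)] eq])
  have "tensor_space X Y \<subseteq> tensor_space X' Y'"
    unfolding tensor_space_def using assms by (intro complex_vector.span_mono) blast
  then have "linear_on (tensor_space X Y) (tensor_lift X' Y' B')"
    using tensor_lift_linear_on[OF assms(3,4) B'] linear_on_subset by blast
  from linear_on_tensor_eq[OF tensor_lift_linear_on[OF assms(1,2) B] this _ t]
  show ?thesis
    using assms by (simp add: tensor_lift_pure[OF _ _ B] tensor_lift_pure[OF _ _ B'] subset_iff)
qed

lemma tensor_lift_in_subspace:
  assumes "complex_vector.subspace X" "complex_vector.subspace Y" "bilinear_on X Y B"
    and "complex_vector.subspace Z" "\<And>x y. x \<in> X \<Longrightarrow> y \<in> Y \<Longrightarrow> B x y \<in> Z" "t \<in> tensor_space X Y"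
  shows "tensor_lift X Y B t \<in> Z"
  using assms(6,1)
proof (induction rule: tensor_space_induct)
  case zero
  then show ?case
    using linear_on_zero[OF tensor_lift_linear_on[OF assms(1-3)]] assms(4)
    by (simp add: complex_vector.subspace_0)
next
  case (add x y s)
  then show ?case
    using linear_on_add[OF tensor_lift_linear_on[OF assms(1-3)], of "x \<otimes> y" s]
      tensor_lift_pure[OF assms(1-3)] assms(4,5)
    by (simp add: pure_in_tensor_space complex_vector.subspace_add)
qed

section \<open>Lifts over whole spaces and closure rules for linearity\<close>

abbreviation tlift :: "('a::complex_vector \<Rightarrow> 'b::complex_vector \<Rightarrow> 'c::complex_vector)
    \<Rightarrow> ('a, 'b) tensor \<Rightarrow> 'c"
  where "tlift \<equiv> tensor_lift UNIV UNIV"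

lemma lin_tlift: "bilin B \<Longrightarrow> lin (tlift B)"
  using tensor_lift_linear_on[of UNIV UNIV B] by simp

lemma tlift_pure: "bilin B \<Longrightarrow> tlift B (x \<otimes> y) = B x y"
  by (simp add: tensor_lift_pure)

lemma lin_tensor_eq:
  assumes "lin f" "lin h" "\<And>x y. f (x \<otimes> y) = h (x \<otimes> y)"
  shows "f t = h t"
  using linear_on_tensor_eq[of UNIV UNIV f h t] assms by simp

lemma lin_id: "lin (\<lambda>x. x)" and lin_id': "lin id" and lin_const0: "lin (\<lambda>x. 0)"
  by (rule linI; simp)+

lemma lin_plus: "lin f \<Longrightarrow> lin h \<Longrightarrow> lin (\<lambda>x. f x + h x)"
  unfolding linear_on_def by (simp_all add: scaleC_add_right)

lemma lin_uminus: "lin f \<Longrightarrow> lin (\<lambda>x. - f x)"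
  unfolding linear_on_def by simp_all

lemma lin_subtract: "lin f \<Longrightarrow> lin h \<Longrightarrow> lin (\<lambda>x. f x - h x)"
  using lin_plus[of f "\<lambda>x. - h x"] by (simp add: lin_uminus)

lemma lin_scaleC: "lin f \<Longrightarrow> lin (\<lambda>x. c *\<^sub>C f x)"
  unfolding linear_on_def by (simp_all add: scaleC_add_right scaleC_scaleC mult.commute)

lemma lin_scaleC_left: "lin k \<Longrightarrow> lin (\<lambda>x. k x *\<^sub>C v)"
  unfolding linear_on_def by (simp_all add: scaleC_add_left scaleC_scaleC)

lemma lin_compose: "lin u \<Longrightarrow> lin f \<Longrightarrow> lin (\<lambda>x. u (f x))"
  unfolding linear_on_def by simp_all

lemma lin_sum_fun: "(\<And>i. i \<in> A \<Longrightarrow> lin (F i)) \<Longrightarrow> lin (\<lambda>x. \<Sum>i\<in>A. F i x)"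
  unfolding linear_on_def by (simp_all add: sum.distrib complex_vector.scale_sum_right)

lemma lin_mult_left: "lin f \<Longrightarrow> lin (\<lambda>x. a * (f x :: 'a::complex_algebra_1))"
  and lin_mult_right: "lin f \<Longrightarrow> lin (\<lambda>x. f x * (a :: 'a::complex_algebra_1))"
  unfolding linear_on_def by (simp_all add: distrib_left distrib_right mult_scaleC_left
      mult_scaleC_right)

lemma lin_tensor_left: "lin f \<Longrightarrow> lin (\<lambda>x. f x \<otimes> y)"
  and lin_tensor_right: "lin f \<Longrightarrow> lin (\<lambda>x. y \<otimes> f x)"
  by (rule lin_compose[OF lin_pure_left] lin_compose[OF lin_pure_right]; assumption)+

lemma lin_eta: "lin ((*) (a :: 'a::complex_algebra_1))" "lin ((\<otimes>) x)" "lin ((*\<^sub>C) c)"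
  by (rule lin_mult_left[OF lin_id] lin_pure_right lin_scaleC[OF lin_id])+

lemma bilinI: "(\<And>x. lin (B x)) \<Longrightarrow> (\<And>y. lin (\<lambda>x. B x y)) \<Longrightarrow> bilin B"
  by (simp add: bilinear_on_def)

lemma lin_tlift_compose: "(\<And>x. lin (B x)) \<Longrightarrow> (\<And>y. lin (\<lambda>x. B x y)) \<Longrightarrow> lin f
    \<Longrightarrow> lin (\<lambda>x. tlift B (f x))"
  by (rule lin_compose[OF lin_tlift]) (auto intro: bilinI)

text \<open>Linearity in a parameter passes through sums of pure tensors. With this rule nested
  Sweedler sums are seen to be linear in their outer variables.\<close>

lemma lin_tlift_param:
  assumes "\<And>z x. lin (B z x)" "\<And>z y. lin (\<lambda>x. B z x y)" "\<And>x y. lin (\<lambda>z. B z x y)"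
  shows "lin (\<lambda>z. tlift (B z) t)"
proof -
  have B: "bilin (B z)" for z using assms by (intro bilinI)
  have "lin (tlift (B z))" for z by (rule lin_tlift[OF B])
  note l = lin_simps[OF this]
  show ?thesis
  proof (induction t rule: tensor_induct)
    case zero
    then show ?case by (simp add: l lin_const0)
  next
    case (add x y s)
    then show ?case by (simp add: l tlift_pure[OF B] lin_plus assms)
  qed
qed

lemmas lin_intros = lin_id lin_id' lin_const0 lin_plus lin_subtract lin_uminus lin_scaleC
  lin_sum_fun lin_mult_left lin_mult_right lin_tensor_left lin_tensor_right bilinI
  lin_tlift_compose lin_tlift_param lin_eta

text \<open>In Sweedler notation \<open>tlift B (\<Delta> h)\<close> is the sum of
  \<open>B h\<^sub>1 h\<^sub>2\<close>; this rule moves a linear map inside such a sum.\<close>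

lemma lin_tlift_push:
  assumes u: "lin u" and B: "bilin B"
  shows "u (tlift B t) = tlift (\<lambda>x y. u (B x y)) t"
proof -
  have uB: "bilin (\<lambda>x y. u (B x y))"
    using B by (intro bilinI lin_compose[OF u]) (simp_all add: bilinear_on_def)
  show ?thesis
    using lin_tensor_eq[OF lin_compose[OF u lin_tlift[OF B]] lin_tlift[OF uB]]
    by (simp add: tlift_pure[OF B] tlift_pure[OF uB])
qed

lemma tlift_tensor: "tlift (\<otimes>) t = t"
  using lin_tensor_eq[OF lin_tlift[OF bilin_pure_tensor] lin_id]
  by (simp add: tlift_pure[OF bilin_pure_tensor])

section \<open>Sweedler calculus\<close>

lemma tensor_assoc_UNIV:
  "tensor_assoc UNIV UNIV UNIV = tlift (\<lambda>t z. tlift (\<lambda>x y. x \<otimes> (y \<otimes> z)) t)"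
  by (simp add: tensor_assoc_def)

lemma lin_tensor_map: "lin f \<Longrightarrow> lin k \<Longrightarrow> lin (tensor_map UNIV UNIV f k)"
  unfolding tensor_map_def by (intro lin_tlift lin_intros)

lemma tensor_map_pure: "lin f \<Longrightarrow> lin k \<Longrightarrow> tensor_map UNIV UNIV f k (x \<otimes> y) = f x \<otimes> k y"
  unfolding tensor_map_def by (intro tlift_pure lin_intros)

context hopf_algebra
begin

lemma lin_comult: "lin f \<Longrightarrow> lin (\<lambda>x. \<Delta> (f x))"
  by (rule lin_compose[OF linear_comult])

lemma lin_counit: "lin f \<Longrightarrow> lin (\<lambda>x. \<epsilon> (f x) *\<^sub>C v)"
  by (rule lin_scaleC_left[OF lin_compose[OF linear_counit]])

lemma lin_antipode: "lin f \<Longrightarrow> lin (\<lambda>x. S (f x))"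
  by (rule lin_compose[OF linear_antipode])

lemmas hopf_lin = lin_intros lin_comult lin_counit lin_antipode

lemma sweedler_one: "bilin B \<Longrightarrow> tlift B (\<Delta> 1) = B 1 1"
  by (simp add: comult_one tlift_pure)

lemma sweedler_mult:
  assumes B: "bilin B"
  shows "tlift B (\<Delta> (h * k)) = tlift (\<lambda>a b. tlift (\<lambda>c d. B (a * c) (b * d)) (\<Delta> k)) (\<Delta> h)"
proof -
  have i: "bilin (\<lambda>x' y'. (x * x') \<otimes> (y * y'))" for x y :: 'h
    by (intro lin_intros)
  have o: "bilin (\<lambda>x y. tlift (\<lambda>x' y'. (x * x') \<otimes> (y * y')) t)" for t :: "('h, 'h) tensor"
    by (intro lin_intros)
  show ?thesis
    unfolding comult_mult tensor_mult_def
    by (simp add: lin_tlift_push[OF lin_tlift[OF B] o] lin_tlift_push[OF lin_tlift[OF B] i]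
        tlift_pure[OF B])
qed

lemma sweedler_coassoc:
  assumes F: "\<And>x y. lin (F x y)" "\<And>x z. lin (\<lambda>y. F x y z)" "\<And>y z. lin (\<lambda>x. F x y z)"
  shows "tlift (\<lambda>a b. tlift (\<lambda>c d. F c d b) (\<Delta> a)) (\<Delta> h)
    = tlift (\<lambda>a b. tlift (\<lambda>c d. F a c d) (\<Delta> b)) (\<Delta> h)"
proof -
  \<comment> \<open>\<open>T\<close> is the linear map that \<open>F\<close> induces on the triple
    tensor product bracketed to the right. Applied to both sides of coassociativity it gives the two
    nested sums.\<close>
  define T where "T = tlift (\<lambda>a. tlift (F a))"
  have bF: "bilin (F a)" for a by (intro bilinI F)
  have bT: "bilin (\<lambda>a. tlift (F a))"
    by (intro bilinI lin_tlift[OF bF] lin_tlift_param F)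
  have T: "lin T" unfolding T_def by (rule lin_tlift[OF bT])
  have Tp: "T (x \<otimes> (y \<otimes> z)) = F x y z" for x y z
    by (simp add: T_def tlift_pure[OF bT] tlift_pure[OF bF])
  have b1: "bilin (\<lambda>x y. x \<otimes> (y \<otimes> z))" for z :: 'h by (intro lin_intros)
  have b2: "bilin (\<lambda>t z. tlift (\<lambda>x y. x \<otimes> (y \<otimes> z)) (t :: ('h, 'h) tensor))"
    by (intro lin_intros)
  have b3: "bilin (\<lambda>x y. \<Delta> x \<otimes> y)" and b4: "bilin (\<lambda>x y. x \<otimes> \<Delta> y)"
    by (intro hopf_lin)+
  have "T (tensor_assoc UNIV UNIV UNIV (tensor_map UNIV UNIV \<Delta> id (\<Delta> h)))
      = tlift (\<lambda>a b. tlift (\<lambda>c d. F c d b) (\<Delta> a)) (\<Delta> h)"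
    unfolding tensor_assoc_UNIV tensor_map_def id_def
    using lin_tlift_push[OF lin_compose[OF T lin_tlift[OF b2]] b3]
    by (simp add: tlift_pure[OF b2] lin_tlift_push[OF T b1] Tp)
  moreover have "T (tensor_map UNIV UNIV id \<Delta> (\<Delta> h))
      = tlift (\<lambda>a b. tlift (\<lambda>c d. F a c d) (\<Delta> b)) (\<Delta> h)"
    unfolding tensor_map_def id_def
    using lin_tlift_push[OF T b4]
    by (simp add: T_def tlift_pure[OF bT])
  ultimately show ?thesis by (simp add: coassoc)
qed

lemma sweedler_counit_left:
  assumes "lin f" shows "tlift (\<lambda>a b. \<epsilon> a *\<^sub>C f b) (\<Delta> h) = f h"
proof -
  have "bilin (\<lambda>a b. \<epsilon> a *\<^sub>C b)" by (intro hopf_lin)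
  from lin_tlift_push[OF assms this, of "\<Delta> h"] show ?thesis
    by (simp add: counit_left lin_scale[OF assms])
qed

lemma sweedler_counit_right:
  assumes "lin f" shows "tlift (\<lambda>a b. \<epsilon> b *\<^sub>C f a) (\<Delta> h) = f h"
proof -
  have "bilin (\<lambda>a b. \<epsilon> b *\<^sub>C a)" by (intro hopf_lin)
  from lin_tlift_push[OF assms this, of "\<Delta> h"] show ?thesis
    by (simp add: counit_right lin_scale[OF assms])
qed

text \<open>Coassociativity moves the second splitting to the first factor, where
  \<open>a\<^sub>1 (S a\<^sub>2)\<close> collapses to the counit. The identity is the core of the
  freeness argument in \<open>right_invariant_free\<close>.\<close>

lemma sweedler_antipode:
  assumes F: "\<And>x. lin (F x)" "\<And>y. lin (\<lambda>x. F x y)"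
  shows "tlift (\<lambda>a b. tlift (\<lambda>c d. F (a * S c) d) (\<Delta> b)) (\<Delta> h) = F 1 h"
proof -
  have b: "bilin (\<lambda>c d. c * S d)" by (intro hopf_lin)
  have F3: "lin (\<lambda>z. F (x * S y) z)" "lin (\<lambda>y. F (x * S y) z)" "lin (\<lambda>x. F (x * S y) z)" for x y z
    by (intro lin_compose[OF F(2)] hopf_lin F)+
  have "tlift (\<lambda>a b. tlift (\<lambda>c d. F (a * S c) d) (\<Delta> b)) (\<Delta> h)
      = tlift (\<lambda>a b. tlift (\<lambda>c d. F (c * S d) b) (\<Delta> a)) (\<Delta> h)"
    by (rule sweedler_coassoc[symmetric]; rule F3)
  also have "\<dots> = tlift (\<lambda>a b. F (tlift (\<lambda>c d. c * S d) (\<Delta> a)) b) (\<Delta> h)"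
    by (simp add: lin_tlift_push[OF F(2) b])
  also have "\<dots> = F 1 h"
    by (simp add: antipode_right lin_scale[OF F(2)] sweedler_counit_left F(1))
  finally show ?thesis .
qed

end

section \<open>Modules over presented algebras\<close>

definition word_act :: "('x \<Rightarrow> 'v \<Rightarrow> 'v) \<Rightarrow> ('x list \<Rightarrow>\<^sub>0 complex) \<Rightarrow> 'v \<Rightarrow> 'v::complex_vector"
  where "word_act T f v = free_extend (\<lambda>w. foldr T w v) f"

lemma lin_free_extend: "lin (free_extend \<phi>)"
  by (simp add: lin_linear linear_free_extend)

lemma free_extend_fun_add: "free_extend (\<lambda>k. \<phi> k + \<psi> k) f = free_extend \<phi> f + free_extend \<psi> f"
  by (simp add: free_extend_def scaleC_add_right sum.distrib)

lemma free_extend_fun_scaleC: "free_extend (\<lambda>k. c *\<^sub>C \<phi> k) f = c *\<^sub>C free_extend \<phi> f"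
  by (simp add: free_extend_def scaleC_scaleC complex_vector.scale_sum_right mult.commute)

lemma lin_free_extend_param: "(\<And>k. lin (\<phi> k)) \<Longrightarrow> lin (\<lambda>v. free_extend (\<lambda>k. \<phi> k v) f)"
  by (rule linI) (simp_all add: free_extend_fun_add free_extend_fun_scaleC lin_add lin_scale)

lemma poly_mapping_induct [case_names zero add]:
  fixes f :: "'k \<Rightarrow>\<^sub>0 'b::ab_group_add"
  assumes "P 0" "\<And>k c g. P g \<Longrightarrow> P (Poly_Mapping.single k c + g)"
  shows "P f"
proof (induction f rule: update_induct)
  case const
  then show ?case by (rule assms)
next
  case (update f a b)
  have "Poly_Mapping.update a b f = Poly_Mapping.single a b + f"
    using update by (intro poly_mapping_eqI)
      (auto simp: lookup_update lookup_add lookup_single when_def in_keys_iff)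
  then show ?case using assms(2) update by simp
qed

lemma lin_free_eq:
  assumes "lin u" "lin v" "\<And>k. u (Poly_Mapping.single k 1) = v (Poly_Mapping.single k 1)"
  shows "u f = v (f :: 'k \<Rightarrow>\<^sub>0 complex)"
proof (induction f rule: poly_mapping_induct)
  case (add k c f)
  have "Poly_Mapping.single k c = c *\<^sub>C Poly_Mapping.single k 1"
    by (simp add: single_scaleC)
  then show ?case
    using add by (simp add: lin_add[OF assms(1)] lin_add[OF assms(2)] lin_scale[OF assms(1)]
        lin_scale[OF assms(2)] assms(3))
qed (simp add: lin_zero[OF assms(1)] lin_zero[OF assms(2)])

lemma lin_foldr: "(\<And>x. lin (T x)) \<Longrightarrow> lin (foldr T w)"
  by (induction w) (simp_all add: lin_id lin_id'[unfolded id_def] lin_compose comp_def id_def)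

lemma lin_word_act: "(\<And>x. lin (T x)) \<Longrightarrow> lin (word_act T f)"
  unfolding word_act_def by (rule lin_free_extend_param) (simp add: lin_foldr)

lemma lin_word_act_param: "lin (\<lambda>f. word_act T f v)"
  unfolding word_act_def by (rule lin_free_extend)

lemma word_act_single: "word_act T (Poly_Mapping.single w c) v = c *\<^sub>C foldr T w v"
  by (simp add: word_act_def free_extend_single)

lemma lin_free_mult_left: "lin (\<lambda>a. free_mult a b)"
  unfolding free_mult_def by (rule lin_free_extend)

lemma lin_free_mult_right: "lin (\<lambda>b. free_mult a b)"
  unfolding free_mult_def by (rule lin_free_extend_param) (rule lin_free_extend)

lemma free_mult_single:
  "free_mult (Poly_Mapping.single u 1) (Poly_Mapping.single v 1) = Poly_Mapping.single (u @ v) 1"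
  by (simp add: free_mult_def free_extend_single)

lemma word_act_mult:
  assumes T: "\<And>x. lin (T x)"
  shows "word_act T (free_mult a b) v = word_act T a (word_act T b v)"
proof (rule lin_free_eq[where f = a])
  show "lin (\<lambda>a. word_act T (free_mult a b) v)"
    by (rule lin_compose[OF lin_word_act_param lin_free_mult_left])
  show "lin (\<lambda>a. word_act T a (word_act T b v))" by (rule lin_word_act_param)
  fix u
  show "word_act T (free_mult (Poly_Mapping.single u 1) b) v
      = word_act T (Poly_Mapping.single u 1) (word_act T b v)"
  proof (rule lin_free_eq[where f = b])
    show "lin (\<lambda>b. word_act T (free_mult (Poly_Mapping.single u 1) b) v)"
      by (rule lin_compose[OF lin_word_act_param lin_free_mult_right])
    show "lin (\<lambda>b. word_act T (Poly_Mapping.single u 1) (word_act T b v))"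
      by (rule lin_compose[OF lin_word_act[OF T] lin_word_act_param])
  qed (simp add: free_mult_single word_act_single)
qed

lemma lin_free_eval: "lin (free_eval val)"
  unfolding free_eval_def by (rule lin_free_extend)

lemma free_eval_single: "free_eval val (Poly_Mapping.single w c) = c *\<^sub>C prod_list (map val w)"
  by (simp add: free_eval_def free_extend_single)

lemma free_eval_mult: "free_eval val (free_mult a b) = free_eval val a * free_eval val b"
proof (rule lin_free_eq[where f = a])
  show "lin (\<lambda>a. free_eval val (free_mult a b))"
    by (rule lin_compose[OF lin_free_eval lin_free_mult_left])
  show "lin (\<lambda>a. free_eval val a * free_eval val b)"
    by (intro lin_intros lin_free_eval)
  fix u
  show "free_eval val (free_mult (Poly_Mapping.single u 1) b)
      = free_eval val (Poly_Mapping.single u 1) * free_eval val b"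
  proof (rule lin_free_eq[where f = b])
    show "lin (\<lambda>b. free_eval val (free_mult (Poly_Mapping.single u 1) b))"
      by (rule lin_compose[OF lin_free_eval lin_free_mult_right])
    show "lin (\<lambda>b. free_eval val (Poly_Mapping.single u 1) * free_eval val b)"
      by (intro lin_intros lin_free_eval)
  qed (simp add: free_mult_single free_eval_single)
qed

lemma presented_algebra_induct [consumes 1, case_names one gen mult add scale]:
  assumes "algebra_presentation val R"
    and "P 1" "\<And>x. P (val x)" "\<And>a b. P a \<Longrightarrow> P b \<Longrightarrow> P (a * b)"
    and "\<And>a b. P a \<Longrightarrow> P b \<Longrightarrow> P (a + b)" "\<And>c a. P a \<Longrightarrow> P (c *\<^sub>C a)"
  shows "P h"
proof -
  have w: "P (prod_list (map val w))" for w
    by (induction w) (simp_all add: assms)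
  have "P (free_eval val f)" for f
  proof (induction f rule: poly_mapping_induct)
    case zero
    show ?case using assms(6)[OF assms(2), of 0] by (simp add: lin_zero[OF lin_free_eval])
  next
    case (add k c f)
    then show ?case
      by (simp add: lin_add[OF lin_free_eval] free_eval_single assms(5,6) w)
  qed
  moreover obtain f where "h = free_eval val f"
    using assms(1) unfolding algebra_presentation_def by blast
  ultimately show ?thesis by simp
qed

text \<open>The chosen representative does not matter as soon as the relations act as zero, because
  two representatives differ by an element of the ideal.\<close>

definition presented_act ::
  "('x \<Rightarrow> 'h::complex_algebra_1) \<Rightarrow> ('x \<Rightarrow> 'v \<Rightarrow> 'v) \<Rightarrow> 'h \<Rightarrow> 'v \<Rightarrow> 'v::complex_vector"
  where "presented_act val T h = word_act T (SOME f. free_eval val f = h)"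

context
  fixes val :: "'x \<Rightarrow> 'h::complex_algebra_1" and R and T :: "'x \<Rightarrow> 'v \<Rightarrow> 'v::complex_vector"
  assumes pres: "algebra_presentation val R"
    and T: "\<And>x. lin (T x)"
    and rel: "\<And>r v. r \<in> R \<Longrightarrow> word_act T r v = 0"
begin

lemma presented_act_eval: "presented_act val T (free_eval val f) v = word_act T f v"
proof -
  have ideal: "word_act T f v = 0" if "f \<in> free_ideal R" for f v
    using that unfolding free_ideal_def
  proof (induction rule: complex_vector.span_induct_alt)
    case base
    then show ?case by (simp add: lin_zero[OF lin_word_act_param])
  next
    case (step c x y)
    then obtain a r b where "x = free_mult a (free_mult r b)" "r \<in> R" by blast
    then have "word_act T x v = 0"
      by (simp add: word_act_mult[OF T] rel lin_zero[OF lin_word_act[OF T]])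
    then show ?case
      using step by (simp add: lin_add[OF lin_word_act_param] lin_scale[OF lin_word_act_param])
  qed
  define f' where "f' = (SOME f'. free_eval val f' = free_eval val f)"
  have "free_eval val f' = free_eval val f"
    unfolding f'_def by (rule someI) (rule refl)
  then have "free_eval val (f' - f) = 0" by (simp add: lin_diff[OF lin_free_eval])
  then have "f' - f \<in> free_ideal R"
    using pres by (simp add: algebra_presentation_def)
  then have "word_act T f' v = word_act T f v"
    using ideal[of "f' - f" v] by (simp add: lin_diff[OF lin_word_act_param])
  then show ?thesis by (simp add: presented_act_def f'_def)
qed

lemma presented_repr: obtains f where "h = free_eval val f"
  using pres unfolding algebra_presentation_def by blast

lemma lin_presented_act: "lin (presented_act val T h)"
proof -
  obtain f where "h = free_eval val f" by (rule presented_repr)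
  then have "presented_act val T h = word_act T f" by (auto simp: presented_act_eval)
  then show ?thesis by (simp add: lin_word_act[OF T])
qed

lemma lin_presented_act_param: "lin (\<lambda>h. presented_act val T h v)"
proof (rule linI)
  fix h k :: 'h and c
  obtain a where a: "h = free_eval val a" by (rule presented_repr)
  obtain b where b: "k = free_eval val b" by (rule presented_repr)
  show "presented_act val T (h + k) v = presented_act val T h v + presented_act val T k v"
    by (simp only: a b lin_add[OF lin_free_eval, symmetric] presented_act_eval
        lin_add[OF lin_word_act_param])
  show "presented_act val T (c *\<^sub>C h) v = c *\<^sub>C presented_act val T h v"
    by (simp only: a lin_scale[OF lin_free_eval, symmetric] presented_act_eval
        lin_scale[OF lin_word_act_param])
qed

lemma presented_act_mult:
  "presented_act val T (h * k) v = presented_act val T h (presented_act val T k v)"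
proof -
  obtain a where a: "h = free_eval val a" by (rule presented_repr)
  obtain b where b: "k = free_eval val b" by (rule presented_repr)
  show ?thesis
    by (simp only: a b free_eval_mult[symmetric] presented_act_eval word_act_mult[OF T])
qed

lemma presented_act_one: "presented_act val T 1 v = v"
  using presented_act_eval[of "Poly_Mapping.single [] 1" v]
  by (simp add: free_eval_single word_act_single)

lemma presented_act_gen: "presented_act val T (val x) v = T x v"
  using presented_act_eval[of "Poly_Mapping.single [x] 1" v]
  by (simp add: free_eval_single word_act_single)

end

section \<open>Relations in the Planck scale Hopf algebra\<close>

text \<open>Pascal's rule in summed form.\<close>

lemma binomial_sum_Suc:
  fixes F :: "nat \<Rightarrow> 'a::complex_vector"
  shows "(\<Sum>l\<le>Suc i. of_nat (Suc i choose l) *\<^sub>C F l)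
    = (\<Sum>l\<le>i. of_nat (i choose l) *\<^sub>C (F (Suc l) + F l))"
proof -
  have "(\<Sum>l\<le>Suc i. of_nat (Suc i choose l) *\<^sub>C F l)
      = F 0 + (\<Sum>l\<le>i. of_nat (i choose Suc l) *\<^sub>C F (Suc l))
        + (\<Sum>l\<le>i. of_nat (i choose l) *\<^sub>C F (Suc l))"
    by (simp add: sum.atMost_Suc_shift scaleC_add_left sum.distrib add.commute del: sum.atMost_Suc)
  also have "F 0 + (\<Sum>l\<le>i. of_nat (i choose Suc l) *\<^sub>C F (Suc l))
      = (\<Sum>l\<le>Suc i. of_nat (i choose l) *\<^sub>C F l)"
    by (simp add: sum.atMost_Suc_shift del: sum.atMost_Suc)
  also have "\<dots> = (\<Sum>l\<le>i. of_nat (i choose l) *\<^sub>C F l)" by simp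
  finally show ?thesis by (simp add: scaleC_add_right sum.distrib add.commute)
qed

lemma scaleC_two: "(2 * c) *\<^sub>C x = c *\<^sub>C x + c *\<^sub>C (x :: 'a::complex_vector)"
  by (simp add: scaleC_add_left[symmetric])

lemmas scaleC_simps = scaleC_two scaleC_add_right scaleC_add_left scaleC_scaleC
  complex_vector.scale_right_diff_distrib complex_vector.scale_left_diff_distrib
  complex_vector.scale_minus_left complex_vector.scale_minus_right

context planck_hopf_algebra
begin

abbreviation gens where "gens \<equiv> case_planck_gen p g ginv"
abbreviation rels where "rels \<equiv> planck_relations (hbar / G)"

definition lam :: complex where "lam = \<i> * (hbar / G)"

lemma free_eval_rels: assumes "r \<in> rels" shows "free_eval gens r = 0"
proof -
  have one: "free_mult (Poly_Mapping.single [] 1) a = a" "free_mult a (Poly_Mapping.single [] 1) = a"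
    for a :: "planck_gen list \<Rightarrow>\<^sub>0 complex"
    using lin_free_eq[OF lin_free_mult_right lin_id, of "Poly_Mapping.single [] 1" a]
      lin_free_eq[OF lin_free_mult_left lin_id, of "Poly_Mapping.single [] 1" a]
    by (simp_all add: free_mult_single)
  have "free_mult (Poly_Mapping.single [] 1) (free_mult r (Poly_Mapping.single [] 1)) \<in> free_ideal rels"
    unfolding free_ideal_def using assms by (intro complex_vector.span_base) blast
  then show ?thesis using presentation by (simp add: one algebra_presentation_def)
qed

lemma g_ginv: "g * ginv = 1" and ginv_g: "ginv * g = 1"
proof -
  have "Poly_Mapping.single [Gen_g, Gen_ginv] 1 - Poly_Mapping.single [] 1 \<in> rels"
    "Poly_Mapping.single [Gen_ginv, Gen_g] 1 - Poly_Mapping.single [] 1 \<in> rels"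
    by (simp_all add: planck_relations_def)
  from free_eval_rels[OF this(1)] free_eval_rels[OF this(2)]
  show "g * ginv = 1" "ginv * g = 1"
    by (simp_all add: lin_diff[OF lin_free_eval] free_eval_single)
qed

lemma p_g: "p * g = g * p + lam *\<^sub>C (g - g * g)"
proof -
  have "Poly_Mapping.single [Gen_p, Gen_g] 1 - Poly_Mapping.single [Gen_g, Gen_p] 1
       - (Poly_Mapping.single [Gen_g] (\<i> * (hbar / G)) - Poly_Mapping.single [Gen_g, Gen_g] (\<i> * (hbar / G)))
      \<in> rels"
    by (simp add: planck_relations_def)
  from free_eval_rels[OF this] show ?thesis
    unfolding lin_diff[OF lin_free_eval] free_eval_single lam_def[symmetric]
    by (simp add: algebra_simps complex_vector.scale_right_diff_distrib)
qed

lemma g_ginv_assoc: "g * (ginv * x) = x" and ginv_g_assoc: "ginv * (g * x) = x"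
  by (simp_all add: mult.assoc[symmetric] g_ginv ginv_g)

lemma p_ginv: "p * ginv = ginv * p + lam *\<^sub>C (1 - ginv)"
proof -
  have "ginv * (p * g) * ginv = ginv * (g * p + lam *\<^sub>C (g - g * g)) * ginv"
    by (simp add: p_g)
  then show ?thesis
    by (simp add: distrib_left distrib_right mult.assoc g_ginv ginv_g_assoc mult_scaleC_left
        mult_scaleC_right left_diff_distrib right_diff_distrib scaleC_simps algebra_simps)
qed

lemma planck_induct [case_names one p g ginv mult add scale]:
  assumes "P 1" "P p" "P g" "P ginv" "\<And>a b. P a \<Longrightarrow> P b \<Longrightarrow> P (a * b)"
    "\<And>a b. P a \<Longrightarrow> P b \<Longrightarrow> P (a + b)" "\<And>c a. P a \<Longrightarrow> P (c *\<^sub>C a)"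
  shows "P h"
proof (rule presented_algebra_induct[OF presentation])
  show "P (gens x)" for x by (cases x) (simp_all add: assms)
qed (rule assms; assumption)+

text \<open>The axioms give no coproduct of \<open>ginv\<close>, but \<open>g\<close> is grouplike:
  multiplying \<open>\<Delta> (g * ginv) = 1 \<otimes> 1\<close> by
  \<open>ginv \<otimes> ginv\<close> from the left isolates it.\<close>

lemma comult_ginv: "\<Delta> ginv = ginv \<otimes> ginv"
proof -
  have b: "bilin (\<lambda>a b. (ginv * a) \<otimes> (ginv * b))" by (intro hopf_lin)
  have c: "bilin (\<lambda>a b. tlift (\<lambda>c d. (ginv * (a * c)) \<otimes> (ginv * (b * d))) (\<Delta> ginv))"
    by (intro hopf_lin)
  have "tlift (\<lambda>a b. (ginv * a) \<otimes> (ginv * b)) (\<Delta> (g * ginv))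
      = tlift (\<lambda>c d. c \<otimes> d) (\<Delta> ginv)"
    by (simp add: sweedler_mult[OF b] comult_g tlift_pure[OF c] ginv_g_assoc del: comult_mult)
  then show ?thesis
    by (simp add: g_ginv comult_one tlift_pure[OF b] tlift_tensor)
qed

lemma counit_ginv: "\<epsilon> ginv = 1"
  using counit_mult[of g ginv] by (simp add: g_ginv counit_g counit_one)

lemma comult_ginv_power: "\<Delta> (ginv ^ k) = ginv ^ k \<otimes> ginv ^ k"
proof (induction k)
  case (Suc k)
  have b: "bilin (\<lambda>a b. tlift (\<lambda>c d. (a * c) \<otimes> (b * d)) t)" for t :: "('h, 'h) tensor"
    by (intro lin_intros)
  have b': "bilin (\<lambda>c d. (ginv * c) \<otimes> (ginv * d))" by (intro lin_intros)
  have "\<Delta> (ginv * ginv ^ k) = tlift (\<otimes>) (\<Delta> (ginv * ginv ^ k))" by (simp add: tlift_tensor)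
  also have "\<dots> = (ginv * ginv ^ k) \<otimes> (ginv * ginv ^ k)"
    by (simp add: sweedler_mult[OF bilin_pure_tensor] comult_ginv Suc tlift_pure[OF b]
        tlift_pure[OF b'])
  finally show ?case by simp
qed (simp add: comult_one)

lemma counit_ginv_power: "\<epsilon> (ginv ^ k) = 1"
  by (induction k) (simp_all add: counit_one counit_mult counit_ginv)

text \<open>The rising factorials \<open>pf i\<close> are the elements for which the coproduct obeys
  the binomial theorem.\<close>

primrec pf :: "nat \<Rightarrow> 'h" where
  "pf 0 = 1"
| "pf (Suc i) = pf i * p + (of_nat i * lam) *\<^sub>C pf i"

lemma p_pf_commute: "p * pf i = pf i * p"
  by (induction i) (simp_all add: distrib_left distrib_right mult.assoc[symmetric] mult_scaleC_left
      mult_scaleC_right)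

lemma p_pf: "p * pf i = pf (Suc i) - (of_nat i * lam) *\<^sub>C pf i"
  and pf_p: "pf i * p = pf (Suc i) - (of_nat i * lam) *\<^sub>C pf i"
  by (simp_all add: p_pf_commute)

lemma g_power_p: "g ^ l * p = p * g ^ l - (of_nat l * lam) *\<^sub>C (g ^ l - g ^ Suc l)"
proof (induction l)
  case (Suc l)
  have "g ^ Suc l * p = g * (g ^ l * p)" by (simp add: mult.assoc)
  also have "\<dots> = (g * p) * g ^ l - (of_nat l * lam) *\<^sub>C (g ^ Suc l - g ^ Suc (Suc l))"
    by (simp only: Suc) (simp add: right_diff_distrib mult_scaleC_right mult.assoc)
  also have "g * p = p * g - lam *\<^sub>C (g - g * g)" by (simp add: p_g)
  finally show ?case
    by (simp add: left_diff_distrib mult_scaleC_left mult.assoc scaleC_simps algebra_simps)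
qed simp

lemma ginv_power_p:
  "ginv ^ k * p = p * ginv ^ k + (of_nat k * lam) *\<^sub>C (ginv ^ k - ginv ^ k * g)"
proof (induction k)
  case (Suc k)
  have "ginv ^ Suc k * p = ginv * (ginv ^ k * p)" by (simp add: mult.assoc)
  also have "\<dots> = (ginv * p) * ginv ^ k
      + (of_nat k * lam) *\<^sub>C (ginv ^ Suc k - ginv ^ Suc k * g)"
    by (simp only: Suc) (simp add: right_diff_distrib distrib_left mult_scaleC_right mult.assoc)
  also have "ginv * p = p * ginv - lam *\<^sub>C (1 - ginv)" by (simp add: p_ginv)
  also have "(p * ginv - lam *\<^sub>C (1 - ginv)) * ginv ^ k
      = p * ginv ^ Suc k - lam *\<^sub>C (ginv ^ k - ginv ^ Suc k)"
    by (simp add: left_diff_distrib mult_scaleC_left mult.assoc)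
  also have "ginv ^ k = ginv ^ Suc k * g"
    by (simp only: power_Suc2 mult.assoc ginv_g mult_1_right)
  finally show ?case
    by (simp add: scaleC_simps algebra_simps)
qed simp

text \<open>Moving \<open>g\<close> past a rising factorial leaves corrections with a shorter one,
  and in the last of them \<open>g\<close> still stands on the left. This implicit form matches the
  action of \<open>g\<close>, where a factor \<open>1 - lam low\<close> has to be inverted, and is
  used as such in \<open>coaction_g_identity\<close>.\<close>

lemma g_pf: "g * pf (Suc i) = pf (Suc i) * g - (of_nat (Suc i) * lam) *\<^sub>C (pf i * g)
    + (of_nat (Suc i) * lam) *\<^sub>C (g * pf i * g)"
proof (induction i)
  case 0
  show ?case by (simp add: p_g scaleC_simps algebra_simps)
next
  case (Suc i)
  have gp: "g * p = p * g - lam *\<^sub>C g + lam *\<^sub>C (g * g)"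
    by (simp add: p_g scaleC_simps)
  have pp: "pf (Suc i) * (p * g) = pf (Suc (Suc i)) * g - (of_nat (Suc i) * lam) *\<^sub>C (pf (Suc i) * g)"
    "pf i * (p * g) = pf (Suc i) * g - (of_nat i * lam) *\<^sub>C (pf i * g)" 
    "g * (pf i * (p * g)) = g * (pf (Suc i) * g) - (of_nat i * lam) *\<^sub>C (g * (pf i * g))" 
    by (simp_all add: distrib_right mult_scaleC_left mult_scaleC_right distrib_left mult.assoc)
  have *: "g * pf (Suc i) * g = pf (Suc i) * (g * g) - (of_nat (Suc i) * lam) *\<^sub>C (pf i * (g * g))
    + (of_nat (Suc i) * lam) *\<^sub>C (g * (pf i * (g * g)))"
    unfolding Suc by (simp only: distrib_right left_diff_distrib mult_scaleC_left mult.assoc)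
  have star: "lam *\<^sub>C (g * (pf (Suc i) * g)) = lam *\<^sub>C (pf (Suc i) * (g * g))
    - lam *\<^sub>C ((of_nat (Suc i) * lam) *\<^sub>C (pf i * (g * g)))
    + lam *\<^sub>C ((of_nat (Suc i) * lam) *\<^sub>C (g * (pf i * (g * g))))"
    using arg_cong[OF *, of "\<lambda>x. lam *\<^sub>C x"]
    by (simp only: scaleC_add_right complex_vector.scale_right_diff_distrib mult.assoc)
  have "g * pf (Suc (Suc i)) = (g * pf (Suc i)) * p + (of_nat (Suc i) * lam) *\<^sub>C (g * pf (Suc i))"
    by (simp only: pf.simps(2)[of "Suc i"] distrib_left mult_scaleC_right mult.assoc)
  also have "(g * pf (Suc i)) * p = pf (Suc i) * (g * p) - (of_nat (Suc i) * lam) *\<^sub>C (pf i * (g * p))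
    + (of_nat (Suc i) * lam) *\<^sub>C (g * (pf i * (g * p)))"
    unfolding Suc by (simp only: distrib_right left_diff_distrib mult_scaleC_left mult.assoc)
  also have "\<dots> + (of_nat (Suc i) * lam) *\<^sub>C (g * pf (Suc i)) = 
     pf (Suc (Suc i)) * g - (of_nat (Suc (Suc i)) * lam) *\<^sub>C (pf (Suc i) * g)
    + (of_nat (Suc i) * lam) *\<^sub>C (g * pf (Suc i) * g) + lam *\<^sub>C (g * pf (Suc i) * g)"
    unfolding arg_cong[OF Suc, of "\<lambda>x. (of_nat (Suc i) * lam) *\<^sub>C x"]
    by (simp only: gp distrib_left right_diff_distrib mult_scaleC_right pp, simp only: mult.assoc)
      (simp add: star scaleC_simps algebra_simps del: pf.simps)
  finally show ?case by (simp add: scaleC_simps algebra_simps del: pf.simps)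
qed

lemma comult_times_p: "\<Delta> (x * p) = tlift (\<lambda>a b. (a * p) \<otimes> (b * g) + a \<otimes> (b * p)) (\<Delta> x)"
proof -
  have b: "bilin (\<lambda>c d. (a * c) \<otimes> (b * d))" for a b :: 'h by (intro lin_intros)
  have "\<Delta> (x * p) = tlift (\<otimes>) (\<Delta> (x * p))" by (simp add: tlift_tensor)
  also have "\<dots> = tlift (\<lambda>a b. (a * p) \<otimes> (b * g) + a \<otimes> (b * p)) (\<Delta> x)"
    by (simp add: sweedler_mult[OF bilin_pure_tensor] comult_p lin_add[OF lin_tlift[OF b]]
        tlift_pure[OF b])
  finally show ?thesis .
qed

lemma comult_pf: "\<Delta> (pf i) = (\<Sum>l\<le>i. of_nat (i choose l) *\<^sub>C (pf l \<otimes> (pf (i - l) * g ^ l)))"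
proof (induction i)
  case (Suc i)
  let ?B = "\<lambda>a b. (a * p) \<otimes> (b * g) + a \<otimes> (b * p)"
  have B: "bilin ?B" by (intro lin_intros)
  define F where "F l = pf l \<otimes> (pf (Suc i - l) * g ^ l)" for l
  \<comment> \<open>This is where the shift in \<open>pf (Suc i)\<close> is needed. Moving
    \<open>p\<close> past \<open>g ^ l\<close> and completing the factorials produces terms with
    \<open>g ^ Suc l\<close>, which cancel, and terms with \<open>g ^ l\<close>, which add up to
    \<open>- i * lam\<close> times the summand and are cancelled by the shift.\<close>
  have F: "?B (pf l) (pf (i - l) * g ^ l) + (of_nat i * lam) *\<^sub>C (pf l \<otimes> (pf (i - l) * g ^ l))
      = F (Suc l) + F l" if "l \<le> i" for l
  proof -
    have n: "(of_nat (i - l) :: complex) = of_nat i - of_nat l" using that by simp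
    have "pf (i - l) * g ^ l * p = pf (i - l) * (g ^ l * p)" by (simp add: mult.assoc)
    also have "\<dots> = pf (i - l) * p * g ^ l - (of_nat l * lam) *\<^sub>C (pf (i - l) * g ^ l)
         + (of_nat l * lam) *\<^sub>C (pf (i - l) * g ^ Suc l)"
      by (simp only: g_power_p)
        (simp add: mult.assoc right_diff_distrib mult_scaleC_right scaleC_simps)
    also have "pf (i - l) * p * g ^ l = pf (Suc (i - l)) * g ^ l
        - (of_nat (i - l) * lam) *\<^sub>C (pf (i - l) * g ^ l)"
      by (simp add: distrib_right mult_scaleC_left)
    finally have 1: "pf (i - l) * g ^ l * p = pf (Suc (i - l)) * g ^ l
        - (of_nat i * lam) *\<^sub>C (pf (i - l) * g ^ l) + (of_nat l * lam) *\<^sub>C (pf (i - l) * g ^ Suc l)"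
      by (simp add: n scaleC_simps algebra_simps del: pf.simps)
    have 2: "pf (i - l) * g ^ l * g = pf (i - l) * g ^ Suc l"
      by (simp only: mult.assoc power_Suc2)
    show ?thesis
      using that
      by (simp only: 1 2 pf_p F_def Suc_diff_le diff_Suc_Suc pure_tensor_simps)
        (simp add: algebra_simps scaleC_simps del: pf.simps)
  qed
  have "\<Delta> (pf (Suc i)) = tlift ?B (\<Delta> (pf i)) + (of_nat i * lam) *\<^sub>C \<Delta> (pf i)"
    by (simp add: lin_add[OF linear_comult] lin_scale[OF linear_comult] comult_times_p)
  also have "\<dots> = (\<Sum>l\<le>i. of_nat (i choose l) *\<^sub>C (?B (pf l) (pf (i - l) * g ^ l)
      + (of_nat i * lam) *\<^sub>C (pf l \<otimes> (pf (i - l) * g ^ l))))"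
    unfolding Suc by (simp add: lin_sum[OF lin_tlift[OF B]] lin_scale[OF lin_tlift[OF B]]
        tlift_pure[OF B] complex_vector.scale_sum_right scaleC_add_right sum.distrib
        scaleC_scaleC mult.commute)
  also have "\<dots> = (\<Sum>l\<le>i. of_nat (i choose l) *\<^sub>C (F (Suc l) + F l))"
    by (intro sum.cong refl) (simp only: F atMost_iff)
  also have "\<dots> = (\<Sum>l\<le>Suc i. of_nat (Suc i choose l) *\<^sub>C F l)"
    by (rule binomial_sum_Suc[symmetric])
  finally show ?case unfolding F_def .
qed (simp add: comult_one)

lemma counit_pf: "\<epsilon> (pf i) = (if i = 0 then 1 else 0)"
  by (induction i) (auto simp: counit_one lin_add[OF linear_counit] lin_scale[OF linear_counit]
      counit_mult counit_p)

end

section \<open>Dual functionals and the binomial identities behind the left coaction\<close>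

lemma lin_lookup: "lin (\<lambda>f. Poly_Mapping.lookup f k)"
  by (rule linI) (simp_all add: lookup_add lookup_scaleC)

text \<open>The weights agree by \<open>(i + 1) (k choose i + 1) = (k - i) (k choose i)\<close>; the
  first term on the left and the last one on the right vanish.\<close>

lemma binomial_sum_shift:
  fixes F :: "nat \<Rightarrow> 'a::complex_vector"
  shows "(\<Sum>i\<le>k. (of_nat (k choose i) * of_nat i) *\<^sub>C F i)
    = (\<Sum>i\<le>k. (of_nat (k choose i) * of_nat (k - i)) *\<^sub>C F (Suc i))"
proof (cases k)
  case (Suc k')
  have "of_nat (Suc k' choose Suc j) * of_nat (Suc j)
      = (of_nat (Suc k' choose j) * of_nat (Suc k' - j) :: complex)" if "j \<le> k'" for j
  proof -
    have "Suc j * (Suc k' choose Suc j) = Suc k' * (k' choose j)"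
      by (rule Suc_times_binomial)
    also have "\<dots> = (Suc k' choose j) * (Suc k' - j)"
      using that binomial_absorb_comp[of "Suc k'" j] by (simp add: mult.commute)
    finally show ?thesis by (metis mult.commute of_nat_mult)
  qed
  then have "(\<Sum>j\<le>k'. (of_nat (Suc k' choose Suc j) * of_nat (Suc j)) *\<^sub>C F (Suc j))
      = (\<Sum>j\<le>k'. (of_nat (Suc k' choose j) * of_nat (Suc k' - j)) *\<^sub>C F (Suc j))"
    by (intro sum.cong refl) (simp only: atMost_iff)
  then show ?thesis
    unfolding Suc
    by (simp add: sum.atMost_Suc_shift[of "\<lambda>i. (of_nat (Suc k' choose i) * of_nat i) *\<^sub>C F i"]
        del: sum.atMost_Suc binomial_Suc_Suc of_nat_Suc)
      (simp add: sum.atMost_Suc)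
qed simp

context planck_hopf_algebra
begin

text \<open>The representation is dual to right multiplication on the basis
  \<open>pf m * g ^ j\<close> of the algebra.\<close>

lemma coefficient_functional:
  "\<exists>\<phi> :: 'h \<Rightarrow> complex. lin \<phi> \<and> (\<forall>i k. \<phi> (pf i * ginv ^ k) = (if i = i0 \<and> k = k0 then 1 else 0))"
proof -
  let ?s = "\<lambda>j m. Poly_Mapping.single (j :: int, m :: nat) (1 :: complex)"
  define Tg where "Tg = free_extend (\<lambda>(j, m). ?s (j - 1) m)"
  define Ti where "Ti = free_extend (\<lambda>(j, m). ?s (j + 1) m)"
  define Tp where "Tp = free_extend (\<lambda>(j, m). ?s j (Suc m)
    - ((of_nat m + of_int j) * lam) *\<^sub>C ?s j m + (of_int (j - 1) * lam) *\<^sub>C ?s (j - 1) m)"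
  define T where "T = case_planck_gen Tp Tg Ti"
  have lin: "lin Tg" "lin Ti" "lin Tp"
    by (simp_all add: Tg_def Ti_def Tp_def lin_free_extend)
  note ls = lin_simps[OF lin(1)] lin_simps[OF lin(2)] lin_simps[OF lin(3)]
  have s: "Tg (?s j m) = ?s (j - 1) m" "Ti (?s j m) = ?s (j + 1) m"
    "Tp (?s j m) = ?s j (Suc m) - ((of_nat m + of_int j) * lam) *\<^sub>C ?s j m
      + (of_int (j - 1) * lam) *\<^sub>C ?s (j - 1) m" for j m
    by (simp_all add: Tg_def Ti_def Tp_def free_extend_single)
  have T: "lin (T x)" for x by (cases x) (simp_all add: T_def lin)
  have rel: "word_act T r v = 0" if "r \<in> rels" for r v
  proof -
    have r1: "Tp (Tg v) - Tg (Tp v) - (lam *\<^sub>C Tg v - lam *\<^sub>C Tg (Tg v)) = 0"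
    proof (rule lin_free_eq[where f = v and v = "\<lambda>v. 0"])
      show "lin (\<lambda>v. Tp (Tg v) - Tg (Tp v) - (lam *\<^sub>C Tg v - lam *\<^sub>C Tg (Tg v)))"
        by (intro lin_intros lin_compose[OF lin(1)] lin_compose[OF lin(3)] lin)
      show "Tp (Tg (Poly_Mapping.single k 1)) - Tg (Tp (Poly_Mapping.single k 1))
          - (lam *\<^sub>C Tg (Poly_Mapping.single k 1) - lam *\<^sub>C Tg (Tg (Poly_Mapping.single k 1))) = 0"
        for k
        by (cases k) (simp add: s ls scaleC_simps algebra_simps)
    qed (rule lin_const0)
    have r2: "Tg (Ti v) = v"
      by (rule lin_free_eq[where f = v and v = "\<lambda>v. v"])
        (auto intro!: lin_id lin_compose[OF lin(1)] lin simp: s)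
    have r3: "Ti (Tg v) = v"
      by (rule lin_free_eq[where f = v and v = "\<lambda>v. v"])
        (auto intro!: lin_id lin_compose[OF lin(2)] lin simp: s)
    from that r1 r2 r3 show ?thesis
      unfolding planck_relations_def
      by (auto simp: lin_diff[OF lin_word_act_param] word_act_single T_def lam_def)
  qed
  define act where "act = presented_act gens T"
  note pr = presentation T rel
  have act1: "lin (act h)" "lin (\<lambda>h. act h v)" "act (h * k) v = act h (act k v)" "act 1 v = v"
    for h k v
    unfolding act_def
    by (rule lin_presented_act[OF pr] lin_presented_act_param[OF pr]
        presented_act_mult[OF pr] presented_act_one[OF pr] | assumption)+
  have act2: "act p v = Tp v" "act g v = Tg v" "act ginv v = Ti v" for v
    using presented_act_gen[OF pr, of Gen_p v] presented_act_gen[OF pr, of Gen_g v]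
      presented_act_gen[OF pr, of Gen_ginv v]
    by (simp_all add: act_def T_def)
  note act = act1 act2
  \<comment> \<open>The only way into the row \<open>j = 0\<close> from outside is the last term of
    \<open>Tp\<close> at \<open>j = 1\<close>, and its coefficient \<open>j - 1\<close> is zero
    there. So the coefficients in this row can be followed without knowing the rest of the
    vector.\<close>
  have row: "Poly_Mapping.lookup (Tp z) (0, m)
      = (if m = 0 then 0 else Poly_Mapping.lookup z (0, m - 1))
        - (of_nat m * lam) * Poly_Mapping.lookup z (0, m)" for z m
  proof (rule lin_free_eq[where f = z])
    show "lin (\<lambda>z. Poly_Mapping.lookup (Tp z) (0, m))"
      by (rule lin_compose[OF lin_lookup lin(3)])
    show "lin (\<lambda>z. (if m = 0 then 0 else Poly_Mapping.lookup z (0, m - 1))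
        - (of_nat m * lam) * Poly_Mapping.lookup z (0, m))"
      by (rule linI) (auto simp: lookup_add lookup_scaleC algebra_simps)
    fix k
    show "Poly_Mapping.lookup (Tp (Poly_Mapping.single k 1)) (0, m)
        = (if m = 0 then 0 else Poly_Mapping.lookup (Poly_Mapping.single k 1) (0, m - 1))
        - (of_nat m * lam) * Poly_Mapping.lookup (Poly_Mapping.single k 1) (0, m)"
      by (cases k) (auto simp: s lookup_add lookup_minus lookup_scaleC lookup_single when_def)
  qed
  have pf_row: "Poly_Mapping.lookup (act (pf i) (?s j 0)) (0, m) = (if m = i \<and> j = 0 then 1 else 0)"
    for i j m
  proof (induction i arbitrary: m)
    case 0
    then show ?case by (auto simp: act lookup_single when_def)
  next
    case (Suc i)
    have eq: "act (pf (Suc i)) (?s j 0) = Tp (act (pf i) (?s j 0))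
        + (of_nat i * lam) *\<^sub>C act (pf i) (?s j 0)"
      by (simp only: pf.simps p_pf_commute[symmetric] lin_add[OF act(2)] lin_scale[OF act(2)] act)
    show ?case
      unfolding eq lookup_add lookup_scaleC row Suc.IH by auto
  qed
  have gk: "act (ginv ^ k) (?s j 0) = ?s (j + int k) 0" for k j
    by (induction k) (simp_all add: act s algebra_simps)
  \<comment> \<open>Started at \<open>- k0\<close>, the vector is carried to row 0 by
    \<open>ginv ^ k\<close> exactly if \<open>k = k0\<close>. Within row 0 the shifts in
    \<open>pf i\<close> cancel the scalars of \<open>row\<close>, so that \<open>pf i\<close> takes
    the place 0 to the place \<open>i\<close>.\<close>
  define \<phi> where "\<phi> h = Poly_Mapping.lookup (act h (?s (- int k0) 0)) (0, i0)" for h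
  have "lin \<phi>" unfolding \<phi>_def by (rule lin_compose[OF lin_lookup act(2)])
  moreover have "\<phi> (pf i * ginv ^ k) = (if i = i0 \<and> k = k0 then 1 else 0)" for i k
    by (auto simp: \<phi>_def act gk pf_row)
  ultimately show ?thesis by blast
qed

text \<open>The defect \<open>p * pf i - pf (Suc i)\<close> is carried by
  \<open>binomial_sum_shift\<close> to the next index, where it cancels the part of
  \<open>x i\<close> that contains \<open>x (Suc i)\<close>.\<close>

lemma p_times_binomial_sum:
  fixes x y :: "nat \<Rightarrow> 'v::complex_vector"
  assumes x: "\<And>i. i \<le> k \<Longrightarrow> x i = (of_nat (k - i) * lam) *\<^sub>C x (Suc i) + y i"
  shows "(\<Sum>i\<le>k. of_nat (k choose i) *\<^sub>C ((p * (pf i * c)) \<otimes> x i))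
    = (\<Sum>i\<le>k. of_nat (k choose i) *\<^sub>C ((pf (Suc i) * c) \<otimes> y i))"
proof -
  have t: "(p * (pf i * c)) \<otimes> x i = (pf (Suc i) * c) \<otimes> x i - of_nat i *\<^sub>C (lam *\<^sub>C ((pf i * c) \<otimes> x i))"
    for i
    by (simp add: mult.assoc[symmetric] p_pf left_diff_distrib mult_scaleC_left pure_tensor_simps
        scaleC_scaleC del: pf.simps)
  have "(\<Sum>i\<le>k. of_nat (k choose i) *\<^sub>C ((p * (pf i * c)) \<otimes> x i))
      = (\<Sum>i\<le>k. of_nat (k choose i) *\<^sub>C ((pf (Suc i) * c) \<otimes> x i))
        - (\<Sum>i\<le>k. (of_nat (k choose i) * of_nat i) *\<^sub>C (lam *\<^sub>C ((pf i * c) \<otimes> x i)))"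
    unfolding t by (simp add: complex_vector.scale_right_diff_distrib sum_subtractf scaleC_scaleC
        mult.assoc del: pf.simps)
  also have "(\<Sum>i\<le>k. (of_nat (k choose i) * of_nat i) *\<^sub>C (lam *\<^sub>C ((pf i * c) \<otimes> x i)))
      = (\<Sum>i\<le>k. (of_nat (k choose i) * of_nat (k - i)) *\<^sub>C (lam *\<^sub>C ((pf (Suc i) * c) \<otimes> x (Suc i))))"
    by (rule binomial_sum_shift)
  also have "(\<Sum>i\<le>k. of_nat (k choose i) *\<^sub>C ((pf (Suc i) * c) \<otimes> x i)) - \<dots>
      = (\<Sum>i\<le>k. of_nat (k choose i) *\<^sub>C ((pf (Suc i) * c) \<otimes> y i))"
    unfolding sum_subtractf[symmetric]
  proof (intro sum.cong refl)
    fix i assume "i \<in> {..k}"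
    then have "y i = x i - (of_nat (k - i) * lam) *\<^sub>C x (Suc i)" using x[of i] by simp
    then show "of_nat (k choose i) *\<^sub>C ((pf (Suc i) * c) \<otimes> x i)
        - (of_nat (k choose i) * of_nat (k - i)) *\<^sub>C (lam *\<^sub>C ((pf (Suc i) * c) \<otimes> x (Suc i)))
        = of_nat (k choose i) *\<^sub>C ((pf (Suc i) * c) \<otimes> y i)"
      by (simp only: pure_tensor_simps complex_vector.scale_right_diff_distrib scaleC_scaleC mult.assoc)
  qed
  finally show ?thesis .
qed

text \<open>With \<open>v i = w (k - i) (a + i)\<close>, read \<open>x i\<close>,
  \<open>l i\<close>, \<open>r i\<close>, \<open>t i\<close> as \<open>g v i\<close>,
  \<open>p v i\<close>, \<open>v i g\<close>, \<open>v i p\<close>, and \<open>s i\<close> as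
  \<open>w (Suc k - i) (a + i) g\<close>. The left side is then \<open>\<Delta> p\<close> acting on
  the coaction of \<open>w k a\<close>, and the right side is the coaction of the three summands of
  \<open>p (w k a)\<close>. Abstract sequences allow both uses: computing the coaction in a given
  calculus and verifying it in the model.\<close>

lemma coaction_p_identity:
  fixes x r s t l :: "nat \<Rightarrow> 'v::complex_vector"
  assumes x: "\<And>i. i \<le> k \<Longrightarrow> x i = (of_nat (k - i) * lam) *\<^sub>C x (Suc i) + (r i + s (Suc i))"
    and l: "\<And>i. i \<le> k \<Longrightarrow> l i = s i + (of_nat (k - i) * lam) *\<^sub>C r i + t i"
  shows "(\<Sum>i\<le>k. of_nat (k choose i) *\<^sub>C ((p * (pf i * ginv ^ k)) \<otimes> x i + (pf i * ginv ^ k) \<otimes> l i))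
    = (\<Sum>i\<le>Suc k. of_nat (Suc k choose i) *\<^sub>C ((pf i * ginv ^ Suc k * g) \<otimes> s i))
      + (of_nat k * lam) *\<^sub>C (\<Sum>i\<le>k. of_nat (k choose i) *\<^sub>C ((pf i * ginv ^ k * g) \<otimes> r i))
      + (\<Sum>i\<le>k. of_nat (k choose i) *\<^sub>C ((pf i * ginv ^ k * p) \<otimes> r i + (pf i * ginv ^ k) \<otimes> t i))"
proof -
  have gk: "pf i * ginv ^ Suc k * g = pf i * ginv ^ k" for i
    by (simp only: power_Suc2 mult.assoc ginv_g mult_1_right)
  have kp: "(pf i * ginv ^ k * p) = pf (Suc i) * ginv ^ k + ((of_nat k - of_nat i) * lam) *\<^sub>C (pf i * ginv ^ k)
      - (of_nat k * lam) *\<^sub>C (pf i * ginv ^ k * g)" for i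
  proof -
    have "pf i * ginv ^ k * p = pf i * (ginv ^ k * p)" by (simp add: mult.assoc)
    also have "\<dots> = (pf i * p) * ginv ^ k + (of_nat k * lam) *\<^sub>C (pf i * ginv ^ k)
        - (of_nat k * lam) *\<^sub>C (pf i * ginv ^ k * g)"
      by (simp only: ginv_power_p) (simp add: distrib_left right_diff_distrib mult_scaleC_right
          mult.assoc scaleC_simps)
    finally show ?thesis
      by (simp only: pf_p) (simp add: left_diff_distrib mult_scaleC_left scaleC_simps algebra_simps
          del: pf.simps)
  qed
  have n: "i \<le> k \<Longrightarrow> (of_nat (k - i) :: complex) = of_nat k - of_nat i" for i by simp
  have "(\<Sum>i\<le>k. of_nat (k choose i) *\<^sub>C ((p * (pf i * ginv ^ k)) \<otimes> x i + (pf i * ginv ^ k) \<otimes> l i))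
      = (\<Sum>i\<le>k. of_nat (k choose i) *\<^sub>C ((pf (Suc i) * ginv ^ k) \<otimes> (r i + s (Suc i))
        + (pf i * ginv ^ k) \<otimes> l i))"
    by (simp only: scaleC_add_right sum.distrib p_times_binomial_sum[OF x])
  moreover have "(\<Sum>i\<le>Suc k. of_nat (Suc k choose i) *\<^sub>C ((pf i * ginv ^ Suc k * g) \<otimes> s i))
      + (of_nat k * lam) *\<^sub>C (\<Sum>i\<le>k. of_nat (k choose i) *\<^sub>C ((pf i * ginv ^ k * g) \<otimes> r i))
      + (\<Sum>i\<le>k. of_nat (k choose i) *\<^sub>C ((pf i * ginv ^ k * p) \<otimes> r i + (pf i * ginv ^ k) \<otimes> t i))
    = (\<Sum>i\<le>k. of_nat (k choose i) *\<^sub>C ((pf (Suc i) * ginv ^ k) \<otimes> s (Suc i) + (pf i * ginv ^ k) \<otimes> s i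
        + (of_nat k * lam) *\<^sub>C ((pf i * ginv ^ k * g) \<otimes> r i)
        + ((pf i * ginv ^ k * p) \<otimes> r i + (pf i * ginv ^ k) \<otimes> t i)))"
    by (simp only: binomial_sum_Suc gk complex_vector.scale_sum_right sum.distrib[symmetric]
        scaleC_add_right scaleC_scaleC) (simp only: mult.commute)
  moreover have "(\<Sum>i\<le>k. of_nat (k choose i) *\<^sub>C ((pf (Suc i) * ginv ^ k) \<otimes> (r i + s (Suc i))
        + (pf i * ginv ^ k) \<otimes> l i)) = \<dots>"
    by (intro sum.cong refl arg_cong[where f = "\<lambda>x. _ *\<^sub>C x"])
      (simp add: l n kp[unfolded mult.assoc] pure_tensor_simps scaleC_simps algebra_simps del: pf.simps)
  ultimately show ?thesis by simp
qed

text \<open>Here \<open>x i\<close> stands for \<open>g (w (k - i) (a + i))\<close> and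
  \<open>y i\<close> for \<open>(w (k - i) (a + i) + w (k - i) (a + i + 1)) g\<close>. The left side
  is \<open>\<Delta> g\<close> acting on the coaction of \<open>(1 - lam low) (w k a)\<close>, the
  right side the coaction of \<open>((1 + up) (w k a)) g\<close>.\<close>

lemma coaction_g_identity:
  fixes x y :: "nat \<Rightarrow> 'v::complex_vector"
  assumes x: "\<And>i. i \<le> k \<Longrightarrow> x i = (of_nat (k - i) * lam) *\<^sub>C x (Suc i) + y i"
  shows "(\<Sum>i\<le>k. of_nat (k choose i) *\<^sub>C ((g * (pf i * ginv ^ k)) \<otimes> x i))
    - (of_nat k * lam) *\<^sub>C (\<Sum>i\<le>k - 1. of_nat (k - 1 choose i) *\<^sub>C
        ((g * (pf i * ginv ^ (k - 1))) \<otimes> x (Suc i)))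
    = (\<Sum>i\<le>k. of_nat (k choose i) *\<^sub>C ((pf i * ginv ^ k * g) \<otimes> y i))"
proof (cases k)
  case 0
  then show ?thesis using x[of 0] by simp
next
  case (Suc k')
  have gk: "ginv ^ k * g = ginv ^ k'"
    unfolding Suc by (simp only: power_Suc2 mult.assoc ginv_g mult_1_right)
  have "(\<Sum>i\<le>k. of_nat (k choose i) *\<^sub>C ((pf i * ginv ^ k * g) \<otimes> y i))
      = (\<Sum>i\<le>k. of_nat (k choose i) *\<^sub>C ((pf i * ginv ^ k * g) \<otimes> x i))
        - (\<Sum>i\<le>k. (of_nat (k choose i) * of_nat (k - i)) *\<^sub>C
            (lam *\<^sub>C ((pf (Suc i - 1) * ginv ^ k * g) \<otimes> x (Suc i))))"
    unfolding sum_subtractf[symmetric]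
  proof (intro sum.cong refl)
    fix i assume "i \<in> {..k}"
    then have "y i = x i - (of_nat (k - i) * lam) *\<^sub>C x (Suc i)" using x[of i] by simp
    then show "of_nat (k choose i) *\<^sub>C ((pf i * ginv ^ k * g) \<otimes> y i)
        = of_nat (k choose i) *\<^sub>C ((pf i * ginv ^ k * g) \<otimes> x i)
        - (of_nat (k choose i) * of_nat (k - i)) *\<^sub>C
            (lam *\<^sub>C ((pf (Suc i - 1) * ginv ^ k * g) \<otimes> x (Suc i)))"
      by (simp only: pure_tensor_simps complex_vector.scale_right_diff_distrib scaleC_scaleC
          mult.assoc diff_Suc_1)
  qed
  also have "(\<Sum>i\<le>k. (of_nat (k choose i) * of_nat (k - i)) *\<^sub>C
            (lam *\<^sub>C ((pf (Suc i - 1) * ginv ^ k * g) \<otimes> x (Suc i))))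
      = (\<Sum>i\<le>k. (of_nat (k choose i) * of_nat i) *\<^sub>C
            (lam *\<^sub>C ((pf (i - 1) * ginv ^ k * g) \<otimes> x i)))"
    by (rule binomial_sum_shift[symmetric])
  finally have rhs: "(\<Sum>i\<le>k. of_nat (k choose i) *\<^sub>C ((pf i * ginv ^ k * g) \<otimes> y i))
      = (\<Sum>i\<le>k. of_nat (k choose i) *\<^sub>C ((pf i * ginv ^ k * g) \<otimes> x i))
        - (\<Sum>i\<le>k. (of_nat (k choose i) * of_nat i) *\<^sub>C
            (lam *\<^sub>C ((pf (i - 1) * ginv ^ k * g) \<otimes> x i)))" .
  have "(\<Sum>i\<le>k. (of_nat (k choose i) * of_nat i) *\<^sub>C
            (lam *\<^sub>C ((g * (pf (i - 1) * ginv ^ k')) \<otimes> x i)))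
      = (\<Sum>i\<le>k'. (of_nat (k choose Suc i) * of_nat (Suc i)) *\<^sub>C
            (lam *\<^sub>C ((g * (pf i * ginv ^ k')) \<otimes> x (Suc i))))"
    unfolding Suc by (simp add: sum.atMost_Suc_shift del: sum.atMost_Suc binomial_Suc_Suc of_nat_Suc)
  also have "\<dots> = (\<Sum>i\<le>k'. (of_nat k * of_nat (k' choose i)) *\<^sub>C
            (lam *\<^sub>C ((g * (pf i * ginv ^ k')) \<otimes> x (Suc i))))"
  proof (intro sum.cong refl arg_cong[where f = "\<lambda>c. c *\<^sub>C _"])
    fix i
    have "Suc i * (k choose Suc i) = k * (k' choose i)"
      unfolding Suc by (rule Suc_times_binomial)
    then show "of_nat (k choose Suc i) * of_nat (Suc i) = (of_nat k * of_nat (k' choose i) :: complex)"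
      by (metis mult.commute of_nat_mult)
  qed
  finally have lhs: "(of_nat k * lam) *\<^sub>C (\<Sum>i\<le>k - 1. of_nat (k - 1 choose i) *\<^sub>C
        ((g * (pf i * ginv ^ (k - 1))) \<otimes> x (Suc i)))
      = (\<Sum>i\<le>k. (of_nat (k choose i) * of_nat i) *\<^sub>C
            (lam *\<^sub>C ((g * (pf (i - 1) * ginv ^ k')) \<otimes> x i)))"
    by (simp add: Suc complex_vector.scale_sum_right scaleC_scaleC mult.commute mult.left_commute
        del: of_nat_Suc)
  \<comment> \<open>Now both sides are single sums over the same range with the same binomial
    weights, so it suffices to compare summands, and this is \<open>g_pf\<close> for
    \<open>pf i\<close>.\<close>
  have "(g * (pf i * ginv ^ k)) \<otimes> x i - of_nat i *\<^sub>C (lam *\<^sub>C ((g * (pf (i - 1) * ginv ^ k')) \<otimes> x i))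
      = (pf i * ginv ^ k * g) \<otimes> x i - of_nat i *\<^sub>C (lam *\<^sub>C ((pf (i - 1) * ginv ^ k * g) \<otimes> x i))" for i
  proof (cases i)
    case 0
    then show ?thesis by (simp add: power_commuting_commutes[of ginv g k, symmetric] g_ginv ginv_g)
  next
    case (Suc j)
    have gk': "g * ginv ^ k = ginv ^ k'"
      using \<open>k = Suc k'\<close> by (simp add: g_ginv_assoc)
    have "g * (pf (Suc j) * ginv ^ k) = (g * pf (Suc j)) * ginv ^ k" by (simp only: mult.assoc)
    also have "\<dots> = pf (Suc j) * ginv ^ k' - (of_nat (Suc j) * lam) *\<^sub>C (pf j * ginv ^ k')
        + (of_nat (Suc j) * lam) *\<^sub>C (g * (pf j * ginv ^ k'))"
      by (simp only: g_pf distrib_right left_diff_distrib mult_scaleC_left mult.assoc gk')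
    finally show ?thesis
      by (simp only: Suc mult.assoc gk diff_Suc_1) (simp only: pure_tensor_simps scaleC_scaleC, simp)
  qed
  then show ?thesis
    unfolding lhs rhs sum_subtractf[symmetric]
    by (intro sum.cong refl)
      (simp only: mult.assoc scaleC_scaleC[symmetric] complex_vector.scale_right_diff_distrib[symmetric])
qed

end

section \<open>Bicovariant calculi\<close>

lemma tensor_lift_param_linear_on:
  assumes X': "complex_vector.subspace X'" and Y': "complex_vector.subspace Y'"
    and Z: "complex_vector.subspace Z"
    and B: "\<And>z. z \<in> Z \<Longrightarrow> bilinear_on X' Y' (B z)"
    and L: "\<And>x y. x \<in> X' \<Longrightarrow> y \<in> Y' \<Longrightarrow> linear_on Z (\<lambda>z. B z x y)"
    and t: "t \<in> tensor_space X' Y'"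
  shows "linear_on Z (\<lambda>z. tensor_lift X' Y' (B z) t)"
  using t X'
proof (induction rule: tensor_space_induct)
  case zero
  have "tensor_lift X' Y' (B z) 0 = 0" if "z \<in> Z" for z
    using linear_on_zero[OF tensor_lift_linear_on[OF X' Y' B[OF that]]]
    by (simp add: complex_vector.subspace_0)
  then show ?case
    using Z by (simp add: linear_on_def complex_vector.subspace_add complex_vector.subspace_scale)
next
  case (add x y s)
  have "tensor_lift X' Y' (B z) (x \<otimes> y + s) = B z x y + tensor_lift X' Y' (B z) s" if "z \<in> Z" for z
    using linear_on_add[OF tensor_lift_linear_on[OF X' Y' B[OF that]], of "x \<otimes> y" s] add
      tensor_lift_pure[OF X' Y' B[OF that], of x y] by (simp add: pure_in_tensor_space)
  then show ?case
    using Z add.IH L[OF add.hyps(1,2)]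
    by (simp add: linear_on_def complex_vector.subspace_add complex_vector.subspace_scale
        scaleC_add_right)
qed

section \<open>Products and diagonal actions on tensor products of subspaces\<close>

context
  fixes X :: "'a::complex_vector set" and Y :: "'b::complex_vector set"
    and X' :: "'c::complex_vector set" and Y' :: "'d::complex_vector set"
    and m :: "'a \<Rightarrow> 'c \<Rightarrow> 'e::complex_vector" and m' :: "'b \<Rightarrow> 'd \<Rightarrow> 'f::complex_vector"
  assumes X: "complex_vector.subspace X" and Y: "complex_vector.subspace Y"
    and X': "complex_vector.subspace X'" and Y': "complex_vector.subspace Y'"
    and m: "bilinear_on X X' m" and m': "bilinear_on Y Y' m'"
begin

lemma tensor_mult_inner: "x \<in> X \<Longrightarrow> y \<in> Y \<Longrightarrow> bilinear_on X' Y' (\<lambda>x' y'. m x x' \<otimes> m' y y')"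
  and tensor_mult_left: "y \<in> Y \<Longrightarrow> x' \<in> X' \<Longrightarrow> y' \<in> Y' \<Longrightarrow> linear_on X (\<lambda>x. m x x' \<otimes> m' y y')"
  and tensor_mult_right: "x \<in> X \<Longrightarrow> x' \<in> X' \<Longrightarrow> y' \<in> Y' \<Longrightarrow> linear_on Y (\<lambda>y. m x x' \<otimes> m' y y')"
  using m m' unfolding bilinear_on_def linear_on_def by (simp_all add: pure_tensor_simps)

lemma tensor_mult_outer:
  assumes "t \<in> tensor_space X' Y'"
  shows "bilinear_on X Y (\<lambda>x y. tensor_lift X' Y' (\<lambda>x' y'. m x x' \<otimes> m' y y') t)"
  by (intro bilinear_onI tensor_lift_param_linear_on X Y X' Y' assms tensor_mult_inner
      tensor_mult_left tensor_mult_right)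

lemma tensor_mult_pure_left:
  assumes "x \<in> X" "y \<in> Y" "t \<in> tensor_space X' Y'"
  shows "tensor_mult X Y X' Y' m m' (x \<otimes> y) t = tensor_lift X' Y' (\<lambda>x' y'. m x x' \<otimes> m' y y') t"
  unfolding tensor_mult_def by (rule tensor_lift_pure[OF X Y tensor_mult_outer[OF assms(3)] assms(1,2)])

lemma tensor_mult_add_left:
  assumes "s \<in> tensor_space X Y" "s' \<in> tensor_space X Y" "t \<in> tensor_space X' Y'"
  shows "tensor_mult X Y X' Y' m m' (s + s') t
    = tensor_mult X Y X' Y' m m' s t + tensor_mult X Y X' Y' m m' s' t"
  unfolding tensor_mult_def
  by (rule linear_on_add[OF tensor_lift_linear_on[OF X Y tensor_mult_outer[OF assms(3)]] assms(1,2)])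

lemma tensor_mult_pure_sum:
  assumes "x \<in> X" "y \<in> Y" "\<And>i. i \<in> A \<Longrightarrow> u i \<in> X'" "\<And>i. i \<in> A \<Longrightarrow> v i \<in> Y'"
  shows "tensor_mult X Y X' Y' m m' (x \<otimes> y) (\<Sum>i\<in>A. c i *\<^sub>C (u i \<otimes> v i))
    = (\<Sum>i\<in>A. c i *\<^sub>C (m x (u i) \<otimes> m' y (v i)))"
proof -
  note l = tensor_lift_linear_on[OF X' Y' tensor_mult_inner[OF assms(1,2)]]
  have uv: "u i \<otimes> v i \<in> tensor_space X' Y'" if "i \<in> A" for i
    using that assms by (simp add: pure_in_tensor_space)
  then have cuv: "c i *\<^sub>C (u i \<otimes> v i) \<in> tensor_space X' Y'" if "i \<in> A" for i
    using that by (simp add: complex_vector.subspace_scale)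
  then have "(\<Sum>i\<in>A. c i *\<^sub>C (u i \<otimes> v i)) \<in> tensor_space X' Y'"
    by (simp add: complex_vector.subspace_sum)
  then show ?thesis
    using assms uv cuv
    by (simp add: tensor_mult_pure_left linear_on_sum[OF l] linear_on_scale[OF l]
        tensor_lift_pure[OF X' Y' tensor_mult_inner])
qed

lemma tensor_mult_sum_left:
  assumes "\<And>i. i \<in> A \<Longrightarrow> u i \<in> X" "\<And>i. i \<in> A \<Longrightarrow> v i \<in> Y" and t: "t \<in> tensor_space X' Y'"
  shows "tensor_mult X Y X' Y' m m' (\<Sum>i\<in>A. c i *\<^sub>C (u i \<otimes> v i)) t
    = (\<Sum>i\<in>A. c i *\<^sub>C tensor_lift X' Y' (\<lambda>x' y'. m (u i) x' \<otimes> m' (v i) y') t)"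
proof -
  have uv: "u i \<otimes> v i \<in> tensor_space X Y" if "i \<in> A" for i
    using that assms by (simp add: pure_in_tensor_space)
  then have cuv: "c i *\<^sub>C (u i \<otimes> v i) \<in> tensor_space X Y" if "i \<in> A" for i
    using that by (simp add: complex_vector.subspace_scale)
  note l = tensor_lift_linear_on[OF X Y tensor_mult_outer[OF t]]
  show ?thesis
    unfolding tensor_mult_def using assms uv cuv
    by (simp add: linear_on_sum[OF l] linear_on_scale[OF l]
        tensor_lift_pure[OF X Y tensor_mult_outer[OF t]])
qed

lemma tensor_mult_sum_pure:
  assumes "x \<in> X'" "y \<in> Y'" "\<And>i. i \<in> A \<Longrightarrow> u i \<in> X" "\<And>i. i \<in> A \<Longrightarrow> v i \<in> Y"
  shows "tensor_mult X Y X' Y' m m' (\<Sum>i\<in>A. c i *\<^sub>C (u i \<otimes> v i)) (x \<otimes> y)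
    = (\<Sum>i\<in>A. c i *\<^sub>C (m (u i) x \<otimes> m' (v i) y))"
  using assms
  by (simp add: tensor_mult_sum_left pure_in_tensor_space tensor_lift_pure[OF X' Y' tensor_mult_inner])

lemma tensor_mult_sum_add_right:
  assumes "\<And>i. i \<in> A \<Longrightarrow> u i \<in> X" "\<And>i. i \<in> A \<Longrightarrow> v i \<in> Y"
    and "t \<in> tensor_space X' Y'" "t' \<in> tensor_space X' Y'"
  shows "tensor_mult X Y X' Y' m m' (\<Sum>i\<in>A. c i *\<^sub>C (u i \<otimes> v i)) (t + t')
    = tensor_mult X Y X' Y' m m' (\<Sum>i\<in>A. c i *\<^sub>C (u i \<otimes> v i)) t
      + tensor_mult X Y X' Y' m m' (\<Sum>i\<in>A. c i *\<^sub>C (u i \<otimes> v i)) t'"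
proof -
  have "tensor_lift X' Y' (\<lambda>x' y'. m (u i) x' \<otimes> m' (v i) y') (t + t')
      = tensor_lift X' Y' (\<lambda>x' y'. m (u i) x' \<otimes> m' (v i) y') t
        + tensor_lift X' Y' (\<lambda>x' y'. m (u i) x' \<otimes> m' (v i) y') t'" if "i \<in> A" for i
    using linear_on_add[OF tensor_lift_linear_on[OF X' Y' tensor_mult_inner]] assms that by simp
  then show ?thesis
    using assms
    by (simp add: tensor_mult_sum_left complex_vector.subspace_add scaleC_add_right sum.distrib)
qed

end

lemma subspace_projection:
  assumes "complex_vector.subspace (X :: 'a::complex_vector set)"
  shows "\<exists>q. lin q \<and> range q \<subseteq> X \<and> (\<forall>x\<in>X. q x = x)"
proof -
  interpret vector_space_pair "scaleC :: complex \<Rightarrow> 'a \<Rightarrow> 'a" "scaleC :: complex \<Rightarrow> 'a \<Rightarrow> 'a"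
    by unfold_locales
  show ?thesis
    using linear_exists_left_inverse_on[OF complex_vector.linear_ident assms]
    by (auto simp: lin_linear)
qed

lemma dual_functional:
  assumes "complex_vector.independent (B :: 'a::complex_vector set)" "b \<in> B"
  shows "\<exists>\<phi> :: 'a \<Rightarrow> complex. lin \<phi> \<and> (\<forall>x\<in>B. \<phi> x = (if x = b then 1 else 0))"
proof -
  interpret vector_space_pair "scaleC :: complex \<Rightarrow> 'a \<Rightarrow> 'a" "scaleC :: complex \<Rightarrow> complex \<Rightarrow> complex"
    by unfold_locales
  show ?thesis
    using linear_independent_extend[OF assms(1), of "\<lambda>x. if x = b then 1 else 0"]
    by (auto simp: lin_linear)
qed

context bicovariant_calculus
begin

abbreviation "F \<equiv> forms \<Gamma>"

lemma forms_closed [simp, intro]: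
  "0 \<in> F" "\<omega> \<in> F \<Longrightarrow> \<omega>' \<in> F \<Longrightarrow> \<omega> + \<omega>' \<in> F" "\<omega> \<in> F \<Longrightarrow> \<omega>' \<in> F \<Longrightarrow> \<omega> - \<omega>' \<in> F"
  "\<omega> \<in> F \<Longrightarrow> - \<omega> \<in> F" "\<omega> \<in> F \<Longrightarrow> c *\<^sub>C \<omega> \<in> F" "\<omega> \<in> F \<Longrightarrow> lact \<Gamma> h \<omega> \<in> F" "\<omega> \<in> F \<Longrightarrow> ract \<Gamma> \<omega> h \<in> F"
  "diff \<Gamma> h \<in> F" "(\<And>i. i \<in> A \<Longrightarrow> \<eta> i \<in> F) \<Longrightarrow> sum \<eta> A \<in> F"
  using subspace_forms
  by (simp_all add: complex_vector.subspace_0 complex_vector.subspace_add complex_vector.subspace_diff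
      complex_vector.subspace_neg complex_vector.subspace_scale lact_closed ract_closed diff_closed
      complex_vector.subspace_sum)

lemma lact_linear_on: "linear_on F (lact \<Gamma> h)" and lin_lact: "\<omega> \<in> F \<Longrightarrow> lin (\<lambda>h. lact \<Gamma> h \<omega>)"
  using lact_bilinear by (simp_all add: bilinear_on_def)

lemma ract_linear_on: "linear_on F (\<lambda>\<omega>. ract \<Gamma> \<omega> h)" and lin_ract: "\<omega> \<in> F \<Longrightarrow> lin (ract \<Gamma> \<omega>)"
  using ract_bilinear by (simp_all add: bilinear_on_def)

lemma lact_simps:
  "\<omega> \<in> F \<Longrightarrow> \<omega>' \<in> F \<Longrightarrow> lact \<Gamma> h (\<omega> + \<omega>') = lact \<Gamma> h \<omega> + lact \<Gamma> h \<omega>'"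
  "\<omega> \<in> F \<Longrightarrow> \<omega>' \<in> F \<Longrightarrow> lact \<Gamma> h (\<omega> - \<omega>') = lact \<Gamma> h \<omega> - lact \<Gamma> h \<omega>'"
  "\<omega> \<in> F \<Longrightarrow> lact \<Gamma> h (- \<omega>) = - lact \<Gamma> h \<omega>"
  "\<omega> \<in> F \<Longrightarrow> lact \<Gamma> h (c *\<^sub>C \<omega>) = c *\<^sub>C lact \<Gamma> h \<omega>"
  "lact \<Gamma> h 0 = 0"
  "\<omega> \<in> F \<Longrightarrow> lact \<Gamma> (h + k) \<omega> = lact \<Gamma> h \<omega> + lact \<Gamma> k \<omega>"
  "\<omega> \<in> F \<Longrightarrow> lact \<Gamma> (h - k) \<omega> = lact \<Gamma> h \<omega> - lact \<Gamma> k \<omega>"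
  "\<omega> \<in> F \<Longrightarrow> lact \<Gamma> (c *\<^sub>C h) \<omega> = c *\<^sub>C lact \<Gamma> h \<omega>"
  by (simp_all add: linear_on_add[OF lact_linear_on] linear_on_scale[OF lact_linear_on]
      linear_on_minus[OF lact_linear_on] linear_on_zero[OF lact_linear_on]
      linear_on_diff[OF lact_linear_on subspace_forms] lin_add[OF lin_lact] lin_diff[OF lin_lact]
      lin_scale[OF lin_lact])

lemma ract_simps:
  "\<omega> \<in> F \<Longrightarrow> \<omega>' \<in> F \<Longrightarrow> ract \<Gamma> (\<omega> + \<omega>') h = ract \<Gamma> \<omega> h + ract \<Gamma> \<omega>' h"
  "\<omega> \<in> F \<Longrightarrow> \<omega>' \<in> F \<Longrightarrow> ract \<Gamma> (\<omega> - \<omega>') h = ract \<Gamma> \<omega> h - ract \<Gamma> \<omega>' h"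
  "\<omega> \<in> F \<Longrightarrow> ract \<Gamma> (- \<omega>) h = - ract \<Gamma> \<omega> h"
  "\<omega> \<in> F \<Longrightarrow> ract \<Gamma> (c *\<^sub>C \<omega>) h = c *\<^sub>C ract \<Gamma> \<omega> h"
  "ract \<Gamma> 0 h = 0"
  "\<omega> \<in> F \<Longrightarrow> ract \<Gamma> \<omega> (h + k) = ract \<Gamma> \<omega> h + ract \<Gamma> \<omega> k"
  "\<omega> \<in> F \<Longrightarrow> ract \<Gamma> \<omega> (h - k) = ract \<Gamma> \<omega> h - ract \<Gamma> \<omega> k"
  "\<omega> \<in> F \<Longrightarrow> ract \<Gamma> \<omega> (c *\<^sub>C h) = c *\<^sub>C ract \<Gamma> \<omega> h"
  by (simp_all add: linear_on_add[OF ract_linear_on] linear_on_scale[OF ract_linear_on]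
      linear_on_minus[OF ract_linear_on] linear_on_zero[OF ract_linear_on]
      linear_on_diff[OF ract_linear_on subspace_forms] lin_add[OF lin_ract] lin_diff[OF lin_ract]
      lin_scale[OF lin_ract])

lemma lact_sum: "(\<And>i. i \<in> A \<Longrightarrow> \<eta> i \<in> F) \<Longrightarrow> lact \<Gamma> h (\<Sum>i\<in>A. \<eta> i) = (\<Sum>i\<in>A. lact \<Gamma> h (\<eta> i))"
  and ract_sum: "(\<And>i. i \<in> A \<Longrightarrow> \<eta> i \<in> F) \<Longrightarrow> ract \<Gamma> (\<Sum>i\<in>A. \<eta> i) h = (\<Sum>i\<in>A. ract \<Gamma> (\<eta> i) h)"
  by (rule linear_on_sum[OF lact_linear_on subspace_forms]
      linear_on_sum[OF ract_linear_on subspace_forms]; assumption)+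

lemma bilin_mult: "bilin ((*) :: 'h \<Rightarrow> 'h \<Rightarrow> 'h)" by (intro lin_intros)

text \<open>The first letter of each name is the side of the coaction, the second the side of the
  action.\<close>

lemmas tm_ll = tensor_mult_pure_sum[OF subspace_UNIV subspace_UNIV subspace_UNIV subspace_forms
    bilin_mult lact_bilinear]
  and tm_lr = tensor_mult_sum_pure[OF subspace_UNIV subspace_forms subspace_UNIV subspace_UNIV
    bilin_mult ract_bilinear]
  and tm_lr_left = tensor_mult_sum_left[OF subspace_UNIV subspace_forms subspace_UNIV subspace_UNIV
    bilin_mult ract_bilinear]
  and tm_rr_left = tensor_mult_pure_left[OF subspace_forms subspace_UNIV subspace_UNIV subspace_UNIV
    ract_bilinear bilin_mult]
  and tm_ll_add = tensor_mult_add_left[OF subspace_UNIV subspace_UNIV subspace_UNIV subspace_forms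
    bilin_mult lact_bilinear]
  and tm_lr_add = tensor_mult_sum_add_right[OF subspace_UNIV subspace_forms subspace_UNIV subspace_UNIV
    bilin_mult ract_bilinear]
  and tm_rl = tensor_mult_pure_sum[OF subspace_UNIV subspace_UNIV subspace_forms subspace_UNIV
    lact_bilinear bilin_mult]
  and tm_rr = tensor_mult_sum_pure[OF subspace_forms subspace_UNIV subspace_UNIV subspace_UNIV
    ract_bilinear bilin_mult]
  and tm_rl_add = tensor_mult_add_left[OF subspace_UNIV subspace_UNIV subspace_forms subspace_UNIV
    lact_bilinear bilin_mult]
  and tm_rr_add = tensor_mult_sum_add_right[OF subspace_forms subspace_UNIV subspace_UNIV subspace_UNIV
    ract_bilinear bilin_mult]

context
  fixes \<omega> c u v and A :: "'i set"
  assumes \<omega>: "\<omega> \<in> F" and v: "\<And>i. i \<in> A \<Longrightarrow> v i \<in> F"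
    and co: "lcoact \<Gamma> \<omega> = (\<Sum>i\<in>A. c i *\<^sub>C (u i \<otimes> v i))"
begin

lemma lcoact_lact_pure:
  assumes "\<Delta> x = a \<otimes> b"
  shows "lcoact \<Gamma> (lact \<Gamma> x \<omega>) = (\<Sum>i\<in>A. c i *\<^sub>C ((a * u i) \<otimes> lact \<Gamma> b (v i)))"
  unfolding lcoact_lact[OF \<omega>] assms co by (rule tm_ll) (simp_all add: v)

lemma lcoact_ract_pure:
  assumes "\<Delta> x = a \<otimes> b"
  shows "lcoact \<Gamma> (ract \<Gamma> \<omega> x) = (\<Sum>i\<in>A. c i *\<^sub>C ((u i * a) \<otimes> ract \<Gamma> (v i) b))"
  unfolding lcoact_ract[OF \<omega>] assms co by (rule tm_lr) (simp_all add: v)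

lemma lcoact_lact_pure2:
  assumes "\<Delta> x = a \<otimes> b + a' \<otimes> b'"
  shows "lcoact \<Gamma> (lact \<Gamma> x \<omega>) = (\<Sum>i\<in>A. c i *\<^sub>C ((a * u i) \<otimes> lact \<Gamma> b (v i)
    + (a' * u i) \<otimes> lact \<Gamma> b' (v i)))"
proof -
  have "(\<Sum>i\<in>A. c i *\<^sub>C (u i \<otimes> v i)) \<in> tensor_space UNIV F"
    unfolding co[symmetric] by (rule lcoact_closed[OF \<omega>])
  then show ?thesis
    unfolding lcoact_lact[OF \<omega>] assms co
    by (simp add: tm_ll_add tm_ll v scaleC_add_right sum.distrib)
qed

lemma lcoact_ract_pure2:
  assumes "\<Delta> x = a \<otimes> b + a' \<otimes> b'"
  shows "lcoact \<Gamma> (ract \<Gamma> \<omega> x) = (\<Sum>i\<in>A. c i *\<^sub>C ((u i * a) \<otimes> ract \<Gamma> (v i) b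
    + (u i * a') \<otimes> ract \<Gamma> (v i) b'))"
  unfolding lcoact_ract[OF \<omega>] assms co
  by (simp add: tm_lr_add tm_lr v scaleC_add_right sum.distrib)

end

context
  fixes \<omega> c u v and A :: "'i set"
  assumes \<omega>: "\<omega> \<in> F" and u: "\<And>i. i \<in> A \<Longrightarrow> u i \<in> F"
    and co: "rcoact \<Gamma> \<omega> = (\<Sum>i\<in>A. c i *\<^sub>C (u i \<otimes> v i))"
begin

lemma rcoact_lact_pure:
  assumes "\<Delta> x = a \<otimes> b"
  shows "rcoact \<Gamma> (lact \<Gamma> x \<omega>) = (\<Sum>i\<in>A. c i *\<^sub>C (lact \<Gamma> a (u i) \<otimes> (b * v i)))"
  unfolding rcoact_lact[OF \<omega>] assms co by (rule tm_rl) (simp_all add: u)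

lemma rcoact_ract_pure:
  assumes "\<Delta> x = a \<otimes> b"
  shows "rcoact \<Gamma> (ract \<Gamma> \<omega> x) = (\<Sum>i\<in>A. c i *\<^sub>C (ract \<Gamma> (u i) a \<otimes> (v i * b)))"
  unfolding rcoact_ract[OF \<omega>] assms co by (rule tm_rr) (simp_all add: u)

lemma rcoact_lact_pure2:
  assumes "\<Delta> x = a \<otimes> b + a' \<otimes> b'"
  shows "rcoact \<Gamma> (lact \<Gamma> x \<omega>) = (\<Sum>i\<in>A. c i *\<^sub>C (lact \<Gamma> a (u i) \<otimes> (b * v i)
    + lact \<Gamma> a' (u i) \<otimes> (b' * v i)))"
proof -
  have "(\<Sum>i\<in>A. c i *\<^sub>C (u i \<otimes> v i)) \<in> tensor_space F UNIV"
    unfolding co[symmetric] by (rule rcoact_closed[OF \<omega>])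
  then show ?thesis
    unfolding rcoact_lact[OF \<omega>] assms co
    by (simp add: tm_rl_add tm_rl u scaleC_add_right sum.distrib)
qed

lemma rcoact_ract_pure2:
  assumes "\<Delta> x = a \<otimes> b + a' \<otimes> b'"
  shows "rcoact \<Gamma> (ract \<Gamma> \<omega> x) = (\<Sum>i\<in>A. c i *\<^sub>C (ract \<Gamma> (u i) a \<otimes> (v i * b)
    + ract \<Gamma> (u i) a' \<otimes> (v i * b')))"
  unfolding rcoact_ract[OF \<omega>] assms co
  by (simp add: tm_rr_add tm_rr u scaleC_add_right sum.distrib)

end

lemma right_invariant_subspace: "complex_vector.subspace (right_invariant_forms \<Gamma>)"
  unfolding right_invariant_forms_def complex_vector.subspace_def
  using linear_on_add[OF rcoact_linear] linear_on_scale[OF rcoact_linear] linear_on_zero[OF rcoact_linear]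
  by (simp add: pure_tensor_simps)

text \<open>The argument behind the fundamental theorem of Hopf modules: the map
  \<open>\<omega> \<mapsto> \<omega>\<^sub>0 S(\<omega>\<^sub>1) \<otimes> \<omega>\<^sub>2\<close> sends \<open>x h\<close> to \<open>x \<otimes> h\<close> for right-invariant \<open>x\<close>.\<close>

lemma right_invariant_free:
  assumes K: "finite K" and inj: "inj_on x K"
    and x: "\<And>n. n \<in> K \<Longrightarrow> x n \<in> right_invariant_forms \<Gamma>"
    and ind: "complex_vector.independent (x ` K)"
    and zero: "(\<Sum>n\<in>K. ract \<Gamma> (x n) (h n)) = 0" and n: "n \<in> K"
  shows "h n = 0"
proof -
  \<comment> \<open>\<open>ract\<close> is bilinear on the forms only. Composing it with a
    projection onto them gives a map that is bilinear everywhere and agrees with it where it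
    matters.\<close>
  obtain q where q: "lin q" "range q \<subseteq> F" "\<forall>\<omega>\<in>F. q \<omega> = \<omega>"
    using subspace_projection[OF subspace_forms] by blast
  have qF: "q v \<in> F" for v using q(2) by auto
  have xF: "x m \<in> F" and xinv: "rcoact \<Gamma> (x m) = x m \<otimes> 1" if "m \<in> K" for m
    using x[OF that] by (auto simp: right_invariant_forms_def)
  have lin1: "lin (\<lambda>v. ract \<Gamma> (q v) a)" for a
    by (rule linI) (simp_all add: lin_add[OF q(1)] lin_scale[OF q(1)] ract_simps qF)
  have lin2: "lin f \<Longrightarrow> lin (\<lambda>c. ract \<Gamma> (q v) (f c))" for v and f :: "'h \<Rightarrow> 'h"
    by (rule lin_compose[OF lin_ract[OF qF]])
  define B where "B = (\<lambda>v b. tlift (\<lambda>c d. ract \<Gamma> (q v) (S c) \<otimes> d) (\<Delta> b))"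
  have B: "bilin B" unfolding B_def by (intro hopf_lin lin1 lin2)
  have key: "tlift B (rcoact \<Gamma> (ract \<Gamma> (x m) (h m))) = x m \<otimes> h m" if m: "m \<in> K" for m
  proof -
    have bl: "bilin (\<lambda>a b. ract \<Gamma> (q (x m)) a \<otimes> b)" by (intro hopf_lin lin2)
    have "rcoact \<Gamma> (ract \<Gamma> (x m) (h m)) = tlift (\<lambda>a b. ract \<Gamma> (q (x m)) a \<otimes> b) (\<Delta> (h m))"
      using tm_rr_left[of "x m" 1 "\<Delta> (h m)"]
      by (simp add: rcoact_ract xF m xinv q(3))
    also have "tlift B \<dots> = tlift (\<lambda>a b. tlift (\<lambda>c d. ract \<Gamma> (q (x m)) (a * S c) \<otimes> d) (\<Delta> b)) (\<Delta> (h m))"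
      by (simp add: lin_tlift_push[OF lin_tlift[OF B] bl] tlift_pure[OF B])
        (simp add: B_def q(3) xF m ract_mult)
    also have "\<dots> = ract \<Gamma> (q (x m)) 1 \<otimes> h m"
      by (rule sweedler_antipode) (intro hopf_lin lin2)+
    finally show ?thesis by (simp add: q(3) xF m ract_one)
  qed
  have "0 = tlift B (rcoact \<Gamma> (\<Sum>m\<in>K. ract \<Gamma> (x m) (h m)))"
    unfolding zero using linear_on_zero[OF rcoact_linear] by (simp add: lin_zero[OF lin_tlift[OF B]])
  also have "\<dots> = (\<Sum>m\<in>K. x m \<otimes> h m)"
    by (simp add: linear_on_sum[OF rcoact_linear subspace_forms] xF lin_sum[OF lin_tlift[OF B]] key)
  finally have sum0: "(\<Sum>m\<in>K. x m \<otimes> h m) = 0" by simp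
  \<comment> \<open>Pairing the left factors with the functional dual to \<open>x n\<close> isolates
    \<open>h n\<close>.\<close>
  obtain \<phi> :: "'v \<Rightarrow> complex" where \<phi>: "lin \<phi>" "\<forall>y\<in>x ` K. \<phi> y = (if y = x n then 1 else 0)"
    using dual_functional[OF ind] n by blast
  have b: "bilin (\<lambda>v k. \<phi> v *\<^sub>C (k :: 'h))" by (intro bilinI lin_scaleC lin_id lin_scaleC_left \<phi>)
  have "0 = tlift (\<lambda>v k. \<phi> v *\<^sub>C k) (\<Sum>m\<in>K. x m \<otimes> h m)"
    by (simp add: sum0 lin_zero[OF lin_tlift[OF b]])
  also have "\<dots> = (\<Sum>m\<in>K. if m = n then h n else 0)"
    unfolding lin_sum[OF lin_tlift[OF b]] tlift_pure[OF b]
    using \<phi>(2) inj n by (intro sum.cong) (auto simp: inj_on_eq_iff)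
  also have "\<dots> = h n" using K n by simp
  finally show ?thesis by simp
qed

end

section \<open>Generators of the invariant forms\<close>

locale planck_calculus = planck_hopf_algebra hbar G p g ginv \<Delta> \<epsilon> S
    + bicovariant_calculus \<Delta> \<epsilon> S \<Gamma>
  for hbar G :: complex and p g ginv :: "'h::complex_algebra_1"
    and \<Delta> :: "'h \<Rightarrow> ('h, 'h) tensor" and \<epsilon> :: "'h \<Rightarrow> complex" and S :: "'h \<Rightarrow> 'h"
    and \<Gamma> :: "('h, 'v::complex_vector) calculus"
begin

text \<open>Conjugation by \<open>g\<close> minus the identity, iterated on
  \<open>(d g) ginv\<close>. In degree 0 the lowering operator vanishes, so this is
  \<open>up\<close>, and \<open>wcol a\<close> is \<open>w 0 (Suc a)\<close>.\<close>

primrec wcol :: "nat \<Rightarrow> 'v" where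
  "wcol 0 = ract \<Gamma> (diff \<Gamma> g) ginv"
| "wcol (Suc a) = ract \<Gamma> (lact \<Gamma> g (wcol a)) ginv - wcol a"

text \<open>The value \<open>w 0 0 = 0\<close> is junk: the vector with \<open>d h = h (w 0 0) - (w 0 0) h\<close> is not a form.\<close>

primrec w :: "nat \<Rightarrow> nat \<Rightarrow> 'v" where
  "w 0 = (\<lambda>a. case a of 0 \<Rightarrow> 0 | Suc b \<Rightarrow> wcol b)"
| "w (Suc k) = (\<lambda>a. if k = 0 \<and> a = 0 then ract \<Gamma> (diff \<Gamma> p) ginv
    else ract \<Gamma> (lact \<Gamma> p (w k a) - ract \<Gamma> (w k a) p) ginv - (of_nat k * lam) *\<^sub>C w k a)"

lemma wcol_form [simp]: "wcol a \<in> F"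
  by (induction a) simp_all

lemma w_form [simp]: "w k a \<in> F"
  by (induction k arbitrary: a) (simp_all split: nat.split)

lemma ract_inverse [simp]:
  assumes "\<omega> \<in> F"
  shows "ract \<Gamma> (ract \<Gamma> \<omega> ginv) g = \<omega>" "ract \<Gamma> (ract \<Gamma> \<omega> g) ginv = \<omega>"
  using assms by (simp_all add: ract_mult[symmetric] ginv_g g_ginv ract_one)

lemma p_w: "k \<noteq> 0 \<or> a \<noteq> 0 \<Longrightarrow> lact \<Gamma> p (w k a)
    = ract \<Gamma> (w (Suc k) a) g + (of_nat k * lam) *\<^sub>C ract \<Gamma> (w k a) g + ract \<Gamma> (w k a) p"
  by (auto simp: ract_simps)

lemma pg_ract: "\<omega> \<in> F \<Longrightarrow> ract \<Gamma> (ract \<Gamma> \<omega> p) g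
    = ract \<Gamma> (ract \<Gamma> \<omega> g) p + lam *\<^sub>C ract \<Gamma> \<omega> g - lam *\<^sub>C ract \<Gamma> (ract \<Gamma> \<omega> g) g"
  by (subst ract_mult[symmetric], assumption)
    (simp add: p_g ract_simps ract_mult complex_vector.scale_right_diff_distrib)

lemma pg_lact: "\<omega> \<in> F \<Longrightarrow> lact \<Gamma> p (lact \<Gamma> g \<omega>)
    = lact \<Gamma> g (lact \<Gamma> p \<omega>) + lam *\<^sub>C lact \<Gamma> g \<omega> - lam *\<^sub>C lact \<Gamma> g (lact \<Gamma> g \<omega>)"
  by (subst lact_mult[symmetric], assumption)
    (simp add: p_g lact_simps lact_mult complex_vector.scale_right_diff_distrib)

text \<open>The differential of the relation between \<open>p\<close> and \<open>g\<close>. This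
  case of \<open>g_w\<close> comes from the calculus itself: the inductive step that would lead to
  it starts at \<open>w 0 0\<close>, which is not a form.\<close>

lemma g_w_10: "lact \<Gamma> g (w 1 0)
    = lam *\<^sub>C lact \<Gamma> g (w 0 1) + ract \<Gamma> (w 1 0) g + ract \<Gamma> (w 1 1) g"
proof -
  let ?dp = "diff \<Gamma> p" and ?dg = "diff \<Gamma> g"
  have "diff \<Gamma> (p * g) = diff \<Gamma> (g * p + lam *\<^sub>C (g - g * g))" by (simp add: p_g)
  then have L: "lact \<Gamma> g ?dp = ract \<Gamma> ?dp g + lact \<Gamma> p ?dg - ract \<Gamma> ?dg p - lam *\<^sub>C ?dg
      + lam *\<^sub>C ract \<Gamma> ?dg g + lam *\<^sub>C lact \<Gamma> g ?dg"
    by (simp add: lin_add[OF diff_linear] lin_diff[OF diff_linear] lin_scale[OF diff_linear]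
        Leibniz scaleC_simps algebra_simps)
  have gp: "ract \<Gamma> (ract \<Gamma> ?dg p) ginv
      = ract \<Gamma> (ract \<Gamma> ?dg ginv) p + lam *\<^sub>C ?dg - lam *\<^sub>C ract \<Gamma> ?dg ginv"
    by (simp add: ract_mult[symmetric] p_ginv)
      (simp add: ract_simps ract_mult ract_one complex_vector.scale_right_diff_distrib)
  have w: "w 0 (Suc 0) = ract \<Gamma> ?dg ginv" "w (Suc 0) 0 = ract \<Gamma> ?dp ginv"
    "w (Suc 0) (Suc 0) = ract \<Gamma> (lact \<Gamma> p (ract \<Gamma> ?dg ginv) - ract \<Gamma> (ract \<Gamma> ?dg ginv) p) ginv"
    by simp_all
  show ?thesis
    unfolding One_nat_def w
    by (simp add: lact_ract L ract_simps lact_simps gp algebra_simps)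
qed

text \<open>In operator form, conjugation by \<open>g\<close> after \<open>1 - lam low\<close> is
  \<open>1 + up\<close>. The passage from \<open>k\<close> to \<open>k + 1\<close> applies
  \<open>p\<close> to this equation and reorders \<open>p\<close> and \<open>g\<close> by the
  relation of the algebra.\<close>

lemma g_w: "k \<noteq> 0 \<or> a \<noteq> 0 \<Longrightarrow> lact \<Gamma> g (w k a) = (of_nat k * lam) *\<^sub>C lact \<Gamma> g (w (k - 1) (Suc a))
    + (ract \<Gamma> (w k a) g + ract \<Gamma> (w k (Suc a)) g)"
proof (induction k)
  case 0
  then obtain b where "a = Suc b" by (cases a) auto
  then show ?case by (simp add: ract_simps)
next
  case (Suc k)
  show ?case
  proof (cases "k = 0 \<and> a = 0")
    case True
    then show ?thesis using g_w_10 by (simp add: algebra_simps del: w.simps)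
  next
    case False
    define A where "A = w k a"
    define B where "B = w k (Suc a)"
    define C where "C = w (k - 1) (Suc a)"
    define D where "D = w (Suc k) a"
    define E where "E = w (Suc k) (Suc a)"
    have mem [simp]: "A \<in> F" "B \<in> F" "C \<in> F" "D \<in> F" "E \<in> F"
      by (simp_all add: A_def B_def C_def D_def E_def del: w.simps)
    let ?k = "of_nat k :: complex"
    have pA: "lact \<Gamma> p A = ract \<Gamma> D g + (?k * lam) *\<^sub>C ract \<Gamma> A g + ract \<Gamma> A p"
      using p_w[of k a] False by (simp add: A_def D_def del: w.simps)
    have pB: "lact \<Gamma> p B = ract \<Gamma> E g + (?k * lam) *\<^sub>C ract \<Gamma> B g + ract \<Gamma> B p"
      using p_w[of k "Suc a"] by (simp add: B_def E_def del: w.simps)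
    have pC: "(?k * lam) *\<^sub>C lact \<Gamma> p C
        = (?k * lam) *\<^sub>C (ract \<Gamma> B g + ((?k - 1) * lam) *\<^sub>C ract \<Gamma> C g + ract \<Gamma> C p)"
    proof (cases k)
      case (Suc k')
      then show ?thesis
        using p_w[of k' "Suc a"] by (simp add: B_def C_def del: w.simps)
    qed simp
    have gA: "lact \<Gamma> g A = (?k * lam) *\<^sub>C lact \<Gamma> g C + ract \<Gamma> A g + ract \<Gamma> B g"
      using Suc.IH False by (simp add: A_def B_def C_def add.assoc del: w.simps)
    \<comment> \<open>\<open>y\<close> is \<open>(1 - lam low) (w k a)\<close> and \<open>z\<close>
      is \<open>(1 + up) (w k a)\<close>; the induction hypothesis becomes
      \<open>g y = z g\<close>.\<close>
    define y where "y = A - (?k * lam) *\<^sub>C C"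
    define z where "z = A + B"
    have mem' [simp]: "y \<in> F" "z \<in> F" by (simp_all add: y_def z_def)
    have gy: "lact \<Gamma> g y = ract \<Gamma> z g"
      by (simp add: y_def z_def lact_simps ract_simps gA)
    \<comment> \<open>The left side is \<open>((1 - lam low) (w (Suc k) a)) g\<close>. Applying
      \<open>g\<close> to it must therefore give \<open>(D + E) g g\<close>, after which one
      \<open>g\<close> is cancelled.\<close>
    have py: "ract \<Gamma> D g - ((?k + 1) * lam) *\<^sub>C ract \<Gamma> B g
        = lact \<Gamma> p y - ract \<Gamma> y p - ((?k - 1) * lam) *\<^sub>C ract \<Gamma> y g - lam *\<^sub>C ract \<Gamma> z g"
      by (simp add: y_def z_def lact_simps ract_simps pA pC scaleC_simps algebra_simps)
    have pz: "lact \<Gamma> p z = ract \<Gamma> D g + ract \<Gamma> E g + (?k * lam) *\<^sub>C ract \<Gamma> z g + ract \<Gamma> z p"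
      by (simp add: z_def lact_simps ract_simps pA pB scaleC_simps algebra_simps)
    have gpy: "lact \<Gamma> g (lact \<Gamma> p y)
        = ract \<Gamma> (lact \<Gamma> p z) g - lam *\<^sub>C ract \<Gamma> z g + lam *\<^sub>C ract \<Gamma> (lact \<Gamma> g z) g"
      using pg_lact[of y] by (simp add: gy lact_ract algebra_simps)
    have "ract \<Gamma> (lact \<Gamma> g (D - ((?k + 1) * lam) *\<^sub>C B)) g
        = lact \<Gamma> g (ract \<Gamma> D g - ((?k + 1) * lam) *\<^sub>C ract \<Gamma> B g)"
      by (simp add: lact_simps ract_simps lact_ract)
    also have "\<dots> = lact \<Gamma> g (lact \<Gamma> p y) - ract \<Gamma> (ract \<Gamma> z g) p
        - ((?k - 1) * lam) *\<^sub>C ract \<Gamma> (ract \<Gamma> z g) g - lam *\<^sub>C ract \<Gamma> (lact \<Gamma> g z) g"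
      unfolding py by (simp add: lact_simps ract_simps lact_ract gy)
    also have "\<dots> = ract \<Gamma> (ract \<Gamma> (D + E) g) g"
      unfolding gpy pz by (simp add: ract_simps pg_ract scaleC_simps algebra_simps)
    finally have "ract \<Gamma> (ract \<Gamma> (lact \<Gamma> g (D - ((?k + 1) * lam) *\<^sub>C B)) g) ginv
        = ract \<Gamma> (ract \<Gamma> (ract \<Gamma> (D + E) g) g) ginv" by simp
    then have "lact \<Gamma> g (D - ((?k + 1) * lam) *\<^sub>C B) = ract \<Gamma> (D + E) g" by simp
    then have "lact \<Gamma> g D = ((?k + 1) * lam) *\<^sub>C lact \<Gamma> g B + (ract \<Gamma> D g + ract \<Gamma> E g)"
      by (simp add: lact_simps ract_simps algebra_simps)
    then show ?thesis by (simp add: B_def D_def E_def add.commute del: w.simps)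
  qed
qed

text \<open>Apply the coaction to \<open>p_w\<close>, solved for \<open>w (Suc k) a\<close> times
  \<open>g\<close>: \<open>coaction_p_identity\<close> collects the three terms, and multiplying by
  \<open>ginv\<close> removes the \<open>g\<close>.\<close>

lemma lcoact_w:
  "k \<noteq> 0 \<or> a \<noteq> 0 \<Longrightarrow> lcoact \<Gamma> (w k a)
    = (\<Sum>i\<le>k. of_nat (k choose i) *\<^sub>C ((pf i * ginv ^ k) \<otimes> w (k - i) (a + i)))"
proof (induction k)
  case 0
  have "lcoact \<Gamma> (wcol b) = 1 \<otimes> wcol b" for b
  proof (induction b)
    case 0
    have "lcoact \<Gamma> (diff \<Gamma> g) = g \<otimes> diff \<Gamma> g"
      by (simp add: lcoact_diff comult_g tensor_map_pure lin_id' diff_linear)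
    then show ?case
      using lcoact_ract_pure[of "diff \<Gamma> g" "{()}" "\<lambda>_. diff \<Gamma> g" "\<lambda>_. 1" "\<lambda>_. g", OF _ _ _ comult_ginv]
      by (simp add: g_ginv)
  next
    case (Suc b)
    have "lcoact \<Gamma> (lact \<Gamma> g (wcol b)) = g \<otimes> lact \<Gamma> g (wcol b)"
      using lcoact_lact_pure[of "wcol b" "{()}" "\<lambda>_. wcol b" "\<lambda>_. 1" "\<lambda>_. 1", OF _ _ _ comult_g] Suc
      by simp
    then have "lcoact \<Gamma> (ract \<Gamma> (lact \<Gamma> g (wcol b)) ginv) = 1 \<otimes> ract \<Gamma> (lact \<Gamma> g (wcol b)) ginv"
      using lcoact_ract_pure[of "lact \<Gamma> g (wcol b)" "{()}" "\<lambda>_. lact \<Gamma> g (wcol b)" "\<lambda>_. 1" "\<lambda>_. g",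
          OF _ _ _ comult_ginv]
      by (simp add: g_ginv)
    then show ?case
      by (simp add: linear_on_diff[OF lcoact_linear subspace_forms] Suc pure_tensor_simps)
  qed
  moreover obtain b where "a = Suc b" using 0 by (cases a) auto
  ultimately show ?case by simp
next
  case (Suc k)
  show ?case
  proof (cases "k = 0 \<and> a = 0")
    case True
    have "lcoact \<Gamma> (diff \<Gamma> p) = p \<otimes> diff \<Gamma> g + 1 \<otimes> diff \<Gamma> p"
      by (simp add: lcoact_diff comult_p lin_add[OF lin_tensor_map[OF lin_id' diff_linear]]
          tensor_map_pure lin_id' diff_linear)
    then have "lcoact \<Gamma> (diff \<Gamma> p) = (\<Sum>i\<le>Suc 0. 1 *\<^sub>C ((if i = 0 then 1 else p)
        \<otimes> (if i = 0 then diff \<Gamma> p else diff \<Gamma> g)))"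
      by (simp add: add.commute)
    from lcoact_ract_pure[OF _ _ this comult_ginv] True show ?thesis by simp
  next
    case False
    let ?co = "\<lambda>k a. \<Sum>i\<le>k. of_nat (k choose i) *\<^sub>C ((pf i * ginv ^ k) \<otimes> w (k - i) (a + i))"
    have IH: "lcoact \<Gamma> (w k a) = ?co k a" using Suc.IH False by simp
    note co = lcoact_ract_pure[OF w_form w_form IH comult_g]
      lcoact_ract_pure2[OF w_form w_form IH comult_p] lcoact_lact_pure2[OF w_form w_form IH comult_p]
    have pos: "k - i \<noteq> 0 \<or> a + i \<noteq> 0" if "i \<le> k" for i using False that by auto
    have x: "lact \<Gamma> g (w (k - i) (a + i)) = (of_nat (k - i) * lam) *\<^sub>C lact \<Gamma> g (w (k - Suc i) (a + Suc i))
        + (ract \<Gamma> (w (k - i) (a + i)) g + ract \<Gamma> (w (Suc k - Suc i) (a + Suc i)) g)"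
      if "i \<le> k" for i
      using g_w[OF pos[OF that]] by (simp del: w.simps)
    have l: "lact \<Gamma> p (w (k - i) (a + i)) = ract \<Gamma> (w (Suc k - i) (a + i)) g
        + (of_nat (k - i) * lam) *\<^sub>C ract \<Gamma> (w (k - i) (a + i)) g + ract \<Gamma> (w (k - i) (a + i)) p"
      if "i \<le> k" for i
      using p_w[OF pos[OF that]] that by (simp add: Suc_diff_le del: w.simps)
    have "ract \<Gamma> (w (Suc k) a) g = lact \<Gamma> p (w k a) - (of_nat k * lam) *\<^sub>C ract \<Gamma> (w k a) g
        - ract \<Gamma> (w k a) p"
      using p_w[of k a] False by (simp del: w.simps)
    then have "lcoact \<Gamma> (ract \<Gamma> (w (Suc k) a) g) = lcoact \<Gamma> (lact \<Gamma> p (w k a))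
        - (of_nat k * lam) *\<^sub>C lcoact \<Gamma> (ract \<Gamma> (w k a) g) - lcoact \<Gamma> (ract \<Gamma> (w k a) p)"
      by (simp add: linear_on_diff[OF lcoact_linear subspace_forms] linear_on_scale[OF lcoact_linear]
          del: w.simps)
    also have "\<dots> = (\<Sum>i\<le>Suc k. of_nat (Suc k choose i) *\<^sub>C ((pf i * ginv ^ Suc k * g)
        \<otimes> ract \<Gamma> (w (Suc k - i) (a + i)) g))"
      unfolding co
      using coaction_p_identity[of k "\<lambda>i. lact \<Gamma> g (w (k - i) (a + i))" "\<lambda>i. ract \<Gamma> (w (k - i) (a + i)) g"
          "\<lambda>i. ract \<Gamma> (w (Suc k - i) (a + i)) g" "\<lambda>i. lact \<Gamma> p (w (k - i) (a + i))"
          "\<lambda>i. ract \<Gamma> (w (k - i) (a + i)) p", OF x l]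
      by (simp only: mult_1_left mult_1_right) simp
    finally have "lcoact \<Gamma> (ract \<Gamma> (w (Suc k) a) g) = (\<Sum>i\<le>Suc k. of_nat (Suc k choose i) *\<^sub>C
        ((pf i * ginv ^ Suc k * g) \<otimes> ract \<Gamma> (w (Suc k - i) (a + i)) g))" .
    from lcoact_ract_pure[OF _ _ this comult_ginv]
    show ?thesis by (simp add: mult.assoc g_ginv ginv_g del: w.simps pf.simps sum.atMost_Suc power_Suc)
  qed
qed

text \<open>In the commutator with \<open>p\<close> the terms \<open>w k a \<otimes> p\<close>
  cancel. What remains has coaction of the form \<open>v \<otimes> g\<close>, and multiplication by
  \<open>ginv\<close> makes it invariant.\<close>

lemma rcoact_w: "rcoact \<Gamma> (w k a) = w k a \<otimes> 1"
proof -
  have inv: "rcoact \<Gamma> (ract \<Gamma> \<omega> ginv) = ract \<Gamma> \<omega> ginv \<otimes> 1" if "\<omega> \<in> F" "rcoact \<Gamma> \<omega> = \<omega> \<otimes> g" for \<omega>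
    using rcoact_ract_pure[of \<omega> "{()}" "\<lambda>_. \<omega>" "\<lambda>_. 1" "\<lambda>_. g", OF _ _ _ comult_ginv] that
    by (simp add: g_ginv)
  have "rcoact \<Gamma> (wcol b) = wcol b \<otimes> 1" for b
  proof (induction b)
    case 0
    have "rcoact \<Gamma> (diff \<Gamma> g) = diff \<Gamma> g \<otimes> g"
      by (simp add: rcoact_diff comult_g tensor_map_pure lin_id' diff_linear)
    then show ?case by (simp add: inv)
  next
    case (Suc b)
    have "rcoact \<Gamma> (lact \<Gamma> g (wcol b)) = lact \<Gamma> g (wcol b) \<otimes> g"
      using rcoact_lact_pure[of "wcol b" "{()}" "\<lambda>_. wcol b" "\<lambda>_. 1" "\<lambda>_. 1", OF _ _ _ comult_g] Suc
      by simp
    then show ?case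
      by (simp add: linear_on_diff[OF rcoact_linear subspace_forms] Suc pure_tensor_simps inv)
  qed
  then show ?thesis
  proof (induction k arbitrary: a)
    case 0
    then show ?case using linear_on_zero[OF rcoact_linear] by (simp add: pure_tensor_simps split: nat.split)
  next
    case (Suc k)
    have IH: "rcoact \<Gamma> (w k a) = w k a \<otimes> 1" by (rule Suc.IH[OF Suc.prems])
    have 1: "rcoact \<Gamma> (diff \<Gamma> p) = diff \<Gamma> p \<otimes> g"
      using linear_on_zero[OF diff_linear] Leibniz[of 1 1]
      by (simp add: rcoact_diff comult_p lin_add[OF lin_tensor_map[OF diff_linear lin_id']]
          tensor_map_pure lin_id' diff_linear lact_one ract_one pure_tensor_simps)
    have "rcoact \<Gamma> (lact \<Gamma> p (w k a)) = lact \<Gamma> p (w k a) \<otimes> g + w k a \<otimes> p"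
      using rcoact_lact_pure2[of "w k a" "{()}" "\<lambda>_. w k a" "\<lambda>_. 1" "\<lambda>_. 1", OF _ _ _ comult_p] IH
      by (simp add: lact_one)
    moreover have "rcoact \<Gamma> (ract \<Gamma> (w k a) p) = ract \<Gamma> (w k a) p \<otimes> g + w k a \<otimes> p"
      using rcoact_ract_pure2[of "w k a" "{()}" "\<lambda>_. w k a" "\<lambda>_. 1" "\<lambda>_. 1", OF _ _ _ comult_p] IH
      by (simp add: ract_one)
    ultimately have "rcoact \<Gamma> (lact \<Gamma> p (w k a) - ract \<Gamma> (w k a) p)
        = (lact \<Gamma> p (w k a) - ract \<Gamma> (w k a) p) \<otimes> g"
      by (simp add: linear_on_diff[OF rcoact_linear subspace_forms] pure_tensor_simps)
    then show ?case
      by (simp add: inv 1 linear_on_diff[OF rcoact_linear subspace_forms]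
          linear_on_scale[OF rcoact_linear] IH pure_tensor_simps)
  qed
qed

lemma w_right_invariant: "w k a \<in> right_invariant_forms \<Gamma>"
  by (simp add: right_invariant_forms_def rcoact_w del: w.simps)

end

section \<open>The shape of a finite dimensional calculus\<close>

lemma independent_family:
  fixes x :: "'i \<Rightarrow> 'a::complex_vector"
  assumes K: "finite K" and c: "\<forall>c. (\<Sum>s\<in>K. c s *\<^sub>C x s) = 0 \<longrightarrow> (\<forall>s\<in>K. c s = 0)"
  shows "inj_on x K" and "complex_vector.independent (x ` K)"
proof -
  show inj: "inj_on x K"
  proof (rule inj_onI, rule ccontr)
    fix s t assume st: "s \<in> K" "t \<in> K" "x s = x t" "s \<noteq> t"
    let ?c = "\<lambda>r. if r = s then 1 else if r = t then -1 else (0 :: complex)"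
    have "(\<Sum>r\<in>K. ?c r *\<^sub>C x r) = (\<Sum>r\<in>{s, t}. ?c r *\<^sub>C x r)"
      using K st by (intro sum.mono_neutral_right) auto
    also have "\<dots> = 0" using st by simp
    finally have "\<forall>r\<in>K. ?c r = 0" using spec[OF c, of ?c] by simp
    from bspec[OF this st(1)] show False by simp
  qed
  show "complex_vector.independent (x ` K)"
  proof
    assume "complex_vector.dependent (x ` K)"
    then obtain u v where u: "v \<in> x ` K" "u v \<noteq> 0" "(\<Sum>v\<in>x ` K. u v *\<^sub>C v) = 0"
      using complex_vector.dependent_finite[of "x ` K"] K by auto
    then have "(\<Sum>s\<in>K. u (x s) *\<^sub>C x s) = 0" by (simp add: sum.reindex[OF inj])
    with spec[OF c, of "\<lambda>s. u (x s)"] u show False by auto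
  qed
qed

text \<open>\<open>P\<close> describes the complement of a Young diagram with columns of height
  \<open>d k\<close>. By \<open>u\<close> the heights decrease, by \<open>e\<close> never by more
  than one, so \<open>d\<close> is recovered from the set \<open>I\<close> of places where it drops:
  \<open>d k\<close> counts the drops after \<open>k\<close>. In terms of partitions,
  \<open>I\<close> consists of the parts of the conjugate of \<open>d\<close>, which are distinct
  because of \<open>e\<close>.\<close>

lemma staircase_set:
  fixes P :: "nat \<Rightarrow> nat \<Rightarrow> bool"
  assumes r: "\<And>k a. k \<noteq> 0 \<or> a \<noteq> 0 \<Longrightarrow> P k a \<Longrightarrow> P k (Suc a)"
    and u: "\<And>k a. k \<noteq> 0 \<or> a \<noteq> 0 \<Longrightarrow> P k a \<Longrightarrow> P (Suc k) a"
    and e: "\<And>k a. P (Suc k) a \<Longrightarrow> P k (Suc a)"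
    and K: "P K 0" "K \<noteq> 0"
  shows "\<exists>I. finite I \<and> I \<noteq> {} \<and> I \<subseteq> {1..}
    \<and> (\<forall>k a. k \<noteq> 0 \<or> a \<noteq> 0 \<longrightarrow> (P k a \<longleftrightarrow> card {n\<in>I. k < n} \<le> a))"
proof -
  \<comment> \<open>For \<open>k = 0\<close> only \<open>a > 0\<close> competes, since nothing is
    known about \<open>P 0 0\<close>. This makes \<open>d 0\<close> positive and \<open>I\<close>
    non-empty.\<close>
  define d where "d k = (LEAST a. (k \<noteq> 0 \<or> a \<noteq> 0) \<and> P k a)" for k
  \<comment> \<open>Following the antidiagonal from \<open>(K, 0)\<close>, rule \<open>e\<close>
    meets every column before \<open>K\<close>, so all columns are finite.\<close>
  have down: "j \<le> K \<Longrightarrow> P (K - j) j" for j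
  proof (induction j)
    case (Suc j)
    then show ?case using e[of "K - Suc j" j] by (simp add: Suc_diff_Suc)
  qed (simp add: K)
  have up: "P (K + j) 0" for j
    by (induction j) (use K u in auto)
  have ex: "\<exists>a. (k \<noteq> 0 \<or> a \<noteq> 0) \<and> P k a" for k
  proof (cases "k < K")
    case True
    then show ?thesis using down[of "K - k"] by (intro exI[of _ "K - k"]) simp
  next
    case False
    then show ?thesis using up[of "k - K"] K by (intro exI[of _ 0]) simp
  qed
  have d: "(k \<noteq> 0 \<or> d k \<noteq> 0) \<and> P k (d k)" for k
    unfolding d_def by (rule LeastI_ex[OF ex])
  have Pd: "P k a \<longleftrightarrow> d k \<le> a" if ka: "k \<noteq> 0 \<or> a \<noteq> 0" for k a
  proof
    assume "P k a"
    with ka show "d k \<le> a" unfolding d_def by (intro Least_le) simp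
  next
    assume "d k \<le> a"
    then show "P k a"
    proof (induction rule: dec_induct)
      case base
      show ?case using d by simp
    next
      case (step n)
      then show ?case using d[of k] r[of k n] by auto
    qed
  qed
  have d0: "d k = 0" if "K \<le> k" for k
    using up[of "k - K"] Pd[of k 0] K that by simp
  have dS: "d (Suc k) \<le> d k" for k
    using d[of k] u[of k "d k"] Pd[of "Suc k" "d k"] by simp
  have dE: "d k \<le> Suc (d (Suc k))" for k
    using d[of "Suc k"] e[of k "d (Suc k)"] Pd[of k "Suc (d (Suc k))"] by simp
  define I where "I = {n. 1 \<le> n \<and> d n < d (n - 1)}"
  have "I \<subseteq> {..K}"
  proof
    fix n assume "n \<in> I"
    then have "d (n - 1) \<noteq> 0" by (simp add: I_def)
    then show "n \<in> {..K}" using d0[of "n - 1"] by (cases "K \<le> n - 1") auto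
  qed
  then have fin: "finite I" using finite_subset by blast
  have card: "d k = card {n\<in>I. k < n}" for k
  proof (induction "K - k" arbitrary: k)
    case 0
    then have "{n\<in>I. k < n} = {}" using \<open>I \<subseteq> {..K}\<close> by auto
    moreover have "d k = 0" using 0 d0 by simp
    ultimately show ?case by (simp only: card.empty)
  next
    case (Suc j)
    then have IH: "d (Suc k) = card {n\<in>I. Suc k < n}" by simp
    show ?case
    proof (cases "Suc k \<in> I")
      case True
      then have "{n\<in>I. k < n} = insert (Suc k) {n\<in>I. Suc k < n}" by auto
      then have "card {n\<in>I. k < n} = Suc (d (Suc k))" using fin IH by simp
      with True show ?thesis using dE[of k] by (simp add: I_def)
    next
      case False
      then have "{n\<in>I. k < n} = {n\<in>I. Suc k < n}" by (auto simp: less_Suc_eq) (metis Suc_lessI)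
      with False show ?thesis using dS[of k] IH by (simp add: I_def)
    qed
  qed
  have "I \<noteq> {}" using card[of 0] d[of 0] by auto
  moreover have "I \<subseteq> {1..}" by (auto simp: I_def)
  moreover have "P k a \<longleftrightarrow> card {n\<in>I. k < n} \<le> a" if "k \<noteq> 0 \<or> a \<noteq> 0" for k a
    unfolding card[symmetric] by (rule Pd[OF that])
  ultimately show ?thesis using fin by blast
qed

context planck_calculus
begin

text \<open>Apply the left coaction to the relation and pair the left factors with the functional
  dual to \<open>pf i * ginv ^ k\<close>. Only the summands of degree \<open>k\<close>
  survive.\<close>

lemma w_coefficient:
  assumes A: "finite A" "(0, 0) \<notin> A" and zero: "(\<Sum>s\<in>A. c s *\<^sub>C w (fst s) (snd s)) = 0"
  shows "(\<Sum>s\<in>A. if fst s = k \<and> i \<le> k then (c s * of_nat (k choose i)) *\<^sub>C w (k - i) (snd s + i) else 0) = 0"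
proof -
  obtain \<phi> :: "'h \<Rightarrow> complex"
    where "lin \<phi> \<and> (\<forall>j l. \<phi> (pf j * ginv ^ l) = (if j = i \<and> l = k then 1 else 0))"
    using coefficient_functional[of i k] ..
  then have \<phi>: "lin \<phi>" "\<And>j l. \<phi> (pf j * ginv ^ l) = (if j = i \<and> l = k then 1 else 0)"
    by simp_all
  have b: "bilin (\<lambda>x v. \<phi> x *\<^sub>C (v :: 'v))" by (intro bilinI lin_scaleC lin_id lin_scaleC_left \<phi>)
  note R = lin_simps[OF lin_tlift[OF b]]
  have "tlift (\<lambda>x v. \<phi> x *\<^sub>C v) (lcoact \<Gamma> (w l a))
      = (if l = k \<and> i \<le> k then of_nat (k choose i) *\<^sub>C w (k - i) (a + i) else 0)"
    if "(l, a) \<in> A" for l a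
  proof -
    have "l \<noteq> 0 \<or> a \<noteq> 0" using that A(2) by (cases l; cases a) auto
    then have "tlift (\<lambda>x v. \<phi> x *\<^sub>C v) (lcoact \<Gamma> (w l a))
        = (\<Sum>j\<le>l. of_nat (l choose j) *\<^sub>C (\<phi> (pf j * ginv ^ l) *\<^sub>C w (l - j) (a + j)))"
      by (simp only: lcoact_w R tlift_pure[OF b])
    also have "\<dots> = (\<Sum>j\<le>l. if j = i then (if l = k then of_nat (l choose j) *\<^sub>C w (l - j) (a + j) else 0) else 0)"
      unfolding \<phi>(2) by (intro sum.cong refl) simp
    also have "\<dots> = (if l = k \<and> i \<le> k then of_nat (k choose i) *\<^sub>C w (k - i) (a + i) else 0)"
      by (simp add: sum.delta del: w.simps)
    finally show ?thesis .
  qed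
  then have "(\<Sum>s\<in>A. c s *\<^sub>C tlift (\<lambda>x v. \<phi> x *\<^sub>C v) (lcoact \<Gamma> (w (fst s) (snd s))))
      = (\<Sum>s\<in>A. if fst s = k \<and> i \<le> k then (c s * of_nat (k choose i)) *\<^sub>C w (k - i) (snd s + i) else 0)"
    by (intro sum.cong) (auto simp: scaleC_scaleC simp del: w.simps)
  moreover have "(\<Sum>s\<in>A. c s *\<^sub>C tlift (\<lambda>x v. \<phi> x *\<^sub>C v) (lcoact \<Gamma> (w (fst s) (snd s)))) = 0"
    using arg_cong[OF zero, of "\<lambda>\<omega>. tlift (\<lambda>x v. \<phi> x *\<^sub>C v) (lcoact \<Gamma> \<omega>)"]
    by (simp add: linear_on_sum[OF lcoact_linear subspace_forms] linear_on_scale[OF lcoact_linear]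
        linear_on_zero[OF lcoact_linear] R del: w.simps)
  ultimately show ?thesis by simp
qed

text \<open>Up to a non-zero factor the passage from \<open>w k a\<close> to
  \<open>w (k - i) (a + i)\<close> is the \<open>i\<close>-th power of the lowering operator, which
  the coaction provides for every linear relation.\<close>

lemma w_coefficient_same:
  assumes "finite A" "k \<noteq> 0 \<or> 0 \<notin> A" "(\<Sum>a\<in>A. c a *\<^sub>C w k a) = 0" "i \<le> k"
  shows "(\<Sum>a\<in>A. c a *\<^sub>C w (k - i) (a + i)) = 0"
proof -
  have inj: "inj_on (Pair k) A" by (rule inj_onI) simp
  have "(\<Sum>s\<in>Pair k ` A. (c \<circ> snd) s *\<^sub>C w (fst s) (snd s)) = 0"
    using assms by (simp add: sum.reindex[OF inj] del: w.simps)
  from w_coefficient[OF _ _ this, of k i]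
  have "(\<Sum>a\<in>A. (c a * of_nat (k choose i)) *\<^sub>C w (k - i) (a + i)) = 0"
    using assms by (auto simp: sum.reindex[OF inj] simp del: w.simps)
  then have "of_nat (k choose i) *\<^sub>C (\<Sum>a\<in>A. c a *\<^sub>C w (k - i) (a + i)) = 0"
    by (simp add: complex_vector.scale_sum_right scaleC_scaleC mult.commute del: w.simps)
  then show ?thesis using assms(4) by (simp del: w.simps)
qed

text \<open>For \<open>k > 0\<close> the shift is lowering followed by raising: the coefficient at
  \<open>i = 1\<close> leads to \<open>w (k - 1) (Suc a)\<close>, and the commutator with
  \<open>p\<close> leads back up to \<open>w k (Suc a)\<close>. For \<open>k = 0\<close> it is
  conjugation by \<open>g\<close> minus the identity.\<close>

lemma w_shift:
  assumes A: "finite A" "k \<noteq> 0 \<or> 0 \<notin> A" and zero: "(\<Sum>a\<in>A. c a *\<^sub>C w k a) = 0"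
  shows "(\<Sum>a\<in>A. c a *\<^sub>C w k (Suc a)) = 0"
proof (cases k)
  case 0
  have "c a *\<^sub>C w k (Suc a) = ract \<Gamma> (lact \<Gamma> g (c a *\<^sub>C w k a)) ginv - c a *\<^sub>C w k a" if "a \<in> A" for a
    using that A 0 by (cases a) (auto simp: lact_simps ract_simps complex_vector.scale_right_diff_distrib)
  then have "(\<Sum>a\<in>A. c a *\<^sub>C w k (Suc a))
      = ract \<Gamma> (lact \<Gamma> g (\<Sum>a\<in>A. c a *\<^sub>C w k a)) ginv - (\<Sum>a\<in>A. c a *\<^sub>C w k a)"
    by (simp add: lact_sum ract_sum sum_subtractf del: w.simps)
  then show ?thesis by (simp add: zero lact_simps ract_simps del: w.simps)
next
  case (Suc k')
  let ?v = "\<Sum>a\<in>A. c a *\<^sub>C w k' (Suc a)"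
  have "?v = 0" using w_coefficient_same[OF A zero, of 1] Suc by (simp del: w.simps)
  moreover have "(\<Sum>a\<in>A. c a *\<^sub>C w k (Suc a))
      = ract \<Gamma> (lact \<Gamma> p ?v - ract \<Gamma> ?v p) ginv - (of_nat k' * lam) *\<^sub>C ?v"
    unfolding Suc w.simps(2)
    by (simp add: lact_sum ract_sum sum_subtractf lact_simps ract_simps complex_vector.scale_sum_right
        complex_vector.scale_right_diff_distrib scaleC_scaleC mult.commute mult.left_commute del: w.simps)
  ultimately show ?thesis by (simp add: lact_simps ract_simps del: w.simps)
qed

lemma w_zero_right: "k \<noteq> 0 \<or> a \<noteq> 0 \<Longrightarrow> w k a = 0 \<Longrightarrow> w k (Suc a) = 0"
  using w_shift[of "{a}" k "\<lambda>_. 1"] by (simp del: w.simps)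

lemma w_zero_up: "k \<noteq> 0 \<or> a \<noteq> 0 \<Longrightarrow> w k a = 0 \<Longrightarrow> w (Suc k) a = 0"
  by (auto simp: lact_simps ract_simps)

lemma w_zero_antidiagonal: "w (Suc k) a = 0 \<Longrightarrow> w k (Suc a) = 0"
  using w_coefficient_same[of "{a}" "Suc k" "\<lambda>_. 1" 1] by (simp del: w.simps)

text \<open>At \<open>i = 0\<close> the coaction has the coefficient \<open>ginv ^ k\<close> in
  degree \<open>k\<close>, so different degrees are told apart.\<close>

lemma w_weights_independent:
  assumes A: "finite A" "(0, 0) \<notin> A" and zero: "(\<Sum>s\<in>A. c s *\<^sub>C w (fst s) (snd s)) = 0"
  shows "(\<Sum>a | (k, a) \<in> A. c (k, a) *\<^sub>C w k a) = 0"
proof -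
  have "(\<Sum>s\<in>A. if fst s = k then c s *\<^sub>C w k (snd s) else 0) = 0"
    using w_coefficient[OF A zero, of k 0] by (simp del: w.simps cong: if_cong)
  then have "(\<Sum>s\<in>{s \<in> A. fst s = k}. c s *\<^sub>C w k (snd s)) = 0"
    using A by (simp add: sum.inter_filter del: w.simps)
  moreover have "{s \<in> A. fst s = k} = Pair k ` {a. (k, a) \<in> A}" by auto
  ultimately show ?thesis by (simp add: sum.reindex inj_on_def del: w.simps)
qed

text \<open>Non-zero vectors \<open>w k 0\<close> of different degrees are independent and right
  invariant, so there cannot be more of them than the spanning set has elements. This is where
  finite dimension enters the classification.\<close>

lemma w_eventually_zero:
  assumes "finite_dim_calculus \<Gamma>"
  shows "\<exists>k. k \<noteq> 0 \<and> w k 0 = 0"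
proof (rule ccontr)
  assume "\<not> (\<exists>k. k \<noteq> 0 \<and> w k 0 = 0)"
  then have nz: "k \<noteq> 0 \<Longrightarrow> w k 0 \<noteq> 0" for k by blast
  obtain B where B: "finite B" "complex_vector.span B = right_invariant_forms \<Gamma>"
    using assms by (auto simp: finite_dim_calculus_def)
  let ?K = "{1..Suc (card B)}"
  let ?A = "(\<lambda>k. (k, 0 :: nat)) ` ?K"
  have A: "finite ?A" "(0, 0) \<notin> ?A" by auto
  have c: "\<forall>c. (\<Sum>k\<in>?K. c k *\<^sub>C w k 0) = 0 \<longrightarrow> (\<forall>k\<in>?K. c k = 0)"
  proof (intro allI impI ballI)
    fix c k assume that: "(\<Sum>k\<in>?K. c k *\<^sub>C w k 0) = 0" "k \<in> ?K"
    have inj: "inj_on (\<lambda>k. (k, 0 :: nat)) ?K" by (rule inj_onI) simp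
    have "(\<Sum>s\<in>?A. (c \<circ> fst) s *\<^sub>C w (fst s) (snd s)) = 0"
      using that(1) by (simp only: sum.reindex[OF inj] comp_def fst_conv snd_conv)
    note w_weights_independent[OF A this, of k]
    moreover have "{a. (k, a) \<in> ?A} = {0}" using that(2) by auto
    ultimately have "c k *\<^sub>C w k 0 = 0" by (simp del: w.simps)
    then show "c k = 0" using nz[of k] that(2) by (simp del: w.simps)
  qed
  have ind: "inj_on (\<lambda>k. w k 0) ?K" "complex_vector.independent ((\<lambda>k. w k 0) ` ?K)"
    by (rule independent_family(1)[OF finite_atLeastAtMost c]
        independent_family(2)[OF finite_atLeastAtMost c])+
  have "(\<lambda>k. w k 0) ` ?K \<subseteq> complex_vector.span B"
    unfolding B(2) by (rule image_subsetI) (rule w_right_invariant)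
  from complex_vector.independent_span_bound[OF B(1) ind(2) this]
  show False unfolding card_image[OF ind(1)] by simp
qed

lemma w_zero_pattern:
  assumes "finite_dim_calculus \<Gamma>"
  shows "\<exists>I. finite I \<and> I \<noteq> {} \<and> I \<subseteq> {1..}
    \<and> (\<forall>k a. k \<noteq> 0 \<or> a \<noteq> 0 \<longrightarrow> (w k a = 0 \<longleftrightarrow> card {n\<in>I. k < n} \<le> a))"
proof -
  obtain K where K: "K \<noteq> 0" "w K 0 = 0" using w_eventually_zero[OF assms] by blast
  show ?thesis
  proof (rule staircase_set[where P = "\<lambda>k a. w k a = 0" and K = K])
    show "w k (Suc a) = 0" if "k \<noteq> 0 \<or> a \<noteq> 0" "w k a = 0" for k a
      using that by (rule w_zero_right)
    show "w (Suc k) a = 0" if "k \<noteq> 0 \<or> a \<noteq> 0" "w k a = 0" for k a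
      using that by (rule w_zero_up)
    show "w k (Suc a) = 0" if "w (Suc k) a = 0" for k a
      using that by (rule w_zero_antidiagonal)
  qed (rule K)+
qed

lemma w_independent:
  assumes A: "finite A" "(0, 0) \<notin> A"
    and d: "\<And>k a. (k, a) \<in> A \<Longrightarrow> a < d k"
    and zero: "\<And>k a. k \<noteq> 0 \<or> a \<noteq> 0 \<Longrightarrow> w k a = 0 \<longleftrightarrow> d k \<le> a"
  shows "inj_on (\<lambda>s. w (fst s) (snd s)) A"
    and "complex_vector.independent ((\<lambda>s. w (fst s) (snd s)) ` A)"
proof -
  have c: "\<forall>c. (\<Sum>s\<in>A. c s *\<^sub>C w (fst s) (snd s)) = 0 \<longrightarrow> (\<forall>s\<in>A. c s = 0)"
  proof (intro allI impI ballI, rule ccontr)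
    fix c s assume sum0: "(\<Sum>s\<in>A. c s *\<^sub>C w (fst s) (snd s)) = 0" and s: "s \<in> A"
      and cs: "c s \<noteq> 0"
    define k where "k = fst s"
    define M where "M = {a. (k, a) \<in> A}"
    have M: "finite M" "k \<noteq> 0 \<or> 0 \<notin> M"
    proof -
      have "M = Pair k -` A" by (simp add: M_def vimage_def)
      then show "finite M" by (simp add: finite_vimageI[OF A(1)] inj_on_def)
      show "k \<noteq> 0 \<or> 0 \<notin> M" using A(2) by (cases k) (simp_all add: M_def)
    qed
    have 0: "(\<Sum>a\<in>M. c (k, a) *\<^sub>C w k a) = 0"
      unfolding M_def by (rule w_weights_independent[OF A sum0])
    have shift: "(\<Sum>a\<in>M. c (k, a) *\<^sub>C w k (a + n)) = 0" for n
    proof (induction n)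
      case (Suc n)
      have inj: "inj_on (\<lambda>a. a + n) M" by (rule inj_onI) simp
      have sum: "(\<Sum>b\<in>(\<lambda>a. a + n) ` M. c (k, b - n) *\<^sub>C w k b) = 0"
        using Suc by (simp add: sum.reindex[OF inj] del: w.simps)
      have "finite ((\<lambda>a. a + n) ` M)" "k \<noteq> 0 \<or> 0 \<notin> (\<lambda>a. a + n) ` M" using M by auto
      from w_shift[OF this sum] show ?case by (simp add: sum.reindex[OF inj] del: w.simps)
    qed (use 0 in simp)
    define a where "a = (LEAST a. a \<in> M \<and> c (k, a) \<noteq> 0)"
    have "\<exists>a. a \<in> M \<and> c (k, a) \<noteq> 0"
      using s cs by (intro exI[of _ "snd s"]) (simp add: M_def k_def)
    from LeastI_ex[OF this] have a: "a \<in> M" "c (k, a) \<noteq> 0" by (simp_all add: a_def)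
    have least: "b \<in> M \<Longrightarrow> c (k, b) \<noteq> 0 \<Longrightarrow> a \<le> b" for b
      unfolding a_def by (rule Least_le) simp
    have ad: "a < d k" using a(1) d by (simp add: M_def)
    \<comment> \<open>Shifting the relation by \<open>n\<close> moves its lowest term to the last
      non-zero place \<open>d k - 1\<close> and all others beyond it, so that a single non-zero
      vector is left.\<close>
    define n where "n = d k - 1 - a"
    have "(\<Sum>b\<in>M. c (k, b) *\<^sub>C w k (b + n)) = (\<Sum>b\<in>{a}. c (k, b) *\<^sub>C w k (b + n))"
    proof (rule sum.mono_neutral_right[OF M(1)])
      show "\<forall>b\<in>M - {a}. c (k, b) *\<^sub>C w k (b + n) = 0"
      proof
        fix b assume b: "b \<in> M - {a}"
        show "c (k, b) *\<^sub>C w k (b + n) = 0"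
        proof (cases "c (k, b) = 0")
          case False
          then have "d k \<le> b + n" "b \<noteq> 0" using least[of b] b ad by (auto simp: n_def)
          then show ?thesis using zero[of k "b + n"] by (simp del: w.simps)
        qed simp
      qed
    qed (use a in simp)
    then have "w k (a + n) = 0" using shift[of n] a by (simp del: w.simps)
    moreover have "k \<noteq> 0 \<or> a + n \<noteq> 0" using a(1) M(2) by (cases a) auto
    ultimately show False using zero[of k "a + n"] ad by (simp add: n_def del: w.simps)
  qed
  show "inj_on (\<lambda>s. w (fst s) (snd s)) A"
    and "complex_vector.independent ((\<lambda>s. w (fst s) (snd s)) ` A)"
    by (rule independent_family(1)[OF A(1) c] independent_family(2)[OF A(1) c])+
qed

end

section \<open>Calculi with globally defined structure maps\<close>

abbreviation tmult :: "('a::complex_vector \<Rightarrow> 'c::complex_vector \<Rightarrow> 'e::complex_vector)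
    \<Rightarrow> ('b::complex_vector \<Rightarrow> 'd::complex_vector \<Rightarrow> 'f::complex_vector)
    \<Rightarrow> ('a, 'b) tensor \<Rightarrow> ('c, 'd) tensor \<Rightarrow> ('e, 'f) tensor"
  where "tmult \<equiv> tensor_mult UNIV UNIV UNIV UNIV"

lemma bilin_lin: "bilin B \<Longrightarrow> lin (B x)" "bilin B \<Longrightarrow> lin (\<lambda>x. B x y)"
  by (simp_all add: bilinear_on_def)

lemma bilin_tmult:
  assumes m: "bilin m" and m': "bilin m'"
  shows "bilin (tmult m m')" and "tmult m m' (x \<otimes> y) t = tlift (\<lambda>x' y'. m x x' \<otimes> m' y y') t"
    and "tmult m m' (x \<otimes> y) (x' \<otimes> y') = m x x' \<otimes> m' y y'"
proof -
  have c: "lin (\<lambda>x'. m x x' \<otimes> m' y y')" "lin (\<lambda>y'. m x x' \<otimes> m' y y')"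
    "lin (\<lambda>x. m x x' \<otimes> m' y y')" "lin (\<lambda>y. m x x' \<otimes> m' y y')" for x y x' y'
    by (rule lin_tensor_left lin_tensor_right; rule bilin_lin[OF m] bilin_lin[OF m'])+
  have i: "bilin (\<lambda>x' y'. m x x' \<otimes> m' y y')" for x y by (intro bilinI c)
  have o: "bilin (\<lambda>x y. tlift (\<lambda>x' y'. m x x' \<otimes> m' y y') t)" for t
    by (intro bilinI lin_tlift_param c)
  show "bilin (tmult m m')"
  proof (rule bilinI)
    show "lin (tmult m m' s)" for s
      unfolding tensor_mult_def by (intro lin_tlift_param lin_tlift[OF i] c)
    show "lin (\<lambda>s. tmult m m' s t)" for t
      unfolding tensor_mult_def by (rule lin_tlift[OF o])
  qed
  show 1: "tmult m m' (x \<otimes> y) t = tlift (\<lambda>x' y'. m x x' \<otimes> m' y y') t" for t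
    unfolding tensor_mult_def by (rule tlift_pure[OF o])
  show "tmult m m' (x \<otimes> y) (x' \<otimes> y') = m x x' \<otimes> m' y y'"
    unfolding 1 by (rule tlift_pure[OF i])
qed

text \<open>Everything is linear in \<open>s\<close>, \<open>t\<close> and \<open>u\<close>, so pure
  tensors suffice. Allowing different operations lets the lemma cover the associativity of an action
  as well as the compatibility of a left with a right action.\<close>

lemma tmult_assoc:
  assumes b: "bilin m1" "bilin m1'" "bilin m2" "bilin m2'" "bilin m3" "bilin m3'" "bilin m4" "bilin m4'"
    and a: "\<And>x y z. m1 x (m2 y z) = m3 (m4 x y) z" "\<And>x y z. m1' x (m2' y z) = m3' (m4' x y) z"
  shows "tmult m1 m1' s (tmult m2 m2' t u) = tmult m3 m3' (tmult m4 m4' s t) u"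
proof -
  note bt = bilin_tmult(1)[OF b(1,2)] bilin_tmult(1)[OF b(3,4)] bilin_tmult(1)[OF b(5,6)]
    bilin_tmult(1)[OF b(7,8)]
  note pure = bilin_tmult(3)[OF b(1,2)] bilin_tmult(3)[OF b(3,4)] bilin_tmult(3)[OF b(5,6)]
    bilin_tmult(3)[OF b(7,8)]
  show ?thesis
  proof (rule lin_tensor_eq[where t = s])
    fix x x'
    show "tmult m1 m1' (x \<otimes> x') (tmult m2 m2' t u) = tmult m3 m3' (tmult m4 m4' (x \<otimes> x') t) u"
    proof (rule lin_tensor_eq[where t = t])
      fix y y'
      show "tmult m1 m1' (x \<otimes> x') (tmult m2 m2' (y \<otimes> y') u)
          = tmult m3 m3' (tmult m4 m4' (x \<otimes> x') (y \<otimes> y')) u"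
      proof (rule lin_tensor_eq[where t = u])
        fix z z'
        show "tmult m1 m1' (x \<otimes> x') (tmult m2 m2' (y \<otimes> y') (z \<otimes> z'))
            = tmult m3 m3' (tmult m4 m4' (x \<otimes> x') (y \<otimes> y')) (z \<otimes> z')"
          by (simp only: pure a)
      qed (rule lin_compose[OF bilin_lin(1)[OF bt(1)] bilin_lin(1)[OF bt(2)]]
          bilin_lin(1)[OF bt(3)])+
    qed (rule lin_compose[OF bilin_lin(1)[OF bt(1)] bilin_lin(2)[OF bt(2)]]
        lin_compose[OF bilin_lin(2)[OF bt(3)] bilin_lin(1)[OF bt(4)]])+
  qed (rule bilin_lin(2)[OF bt(1)] lin_compose[OF bilin_lin(2)[OF bt(3)] bilin_lin(2)[OF bt(4)]])+
qed

lemma bilin_assoc: "bilin (\<lambda>x y. x \<otimes> (y \<otimes> z))" "bilin (\<lambda>t z. tlift (\<lambda>x y. x \<otimes> (y \<otimes> z)) t)"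
  by (intro lin_intros)+

abbreviation tmap where "tmap \<equiv> tensor_map UNIV UNIV"
abbreviation tassoc where "tassoc \<equiv> tensor_assoc UNIV UNIV UNIV"

text \<open>For structure maps that are linear on the whole type the tensor operations relative to
  the forms agree with the absolute ones, and the axioms can be verified in Sweedler calculus. The
  equations themselves are asked for on the forms only, because the coactions of the model obey them
  only there.\<close>

lemma (in hopf_algebra) total_calculus:
  fixes F :: "'v::complex_vector set" and L :: "'h \<Rightarrow> 'v \<Rightarrow> 'v" and R :: "'v \<Rightarrow> 'h \<Rightarrow> 'v"
    and \<beta> :: "'v \<Rightarrow> ('h, 'v) tensor" and \<gamma> :: "'v \<Rightarrow> ('v, 'h) tensor" and D :: "'h \<Rightarrow> 'v"
  assumes F: "complex_vector.subspace F"
    and L: "bilin L" "\<And>h \<omega>. \<omega> \<in> F \<Longrightarrow> L h \<omega> \<in> F" "\<And>\<omega>. \<omega> \<in> F \<Longrightarrow> L 1 \<omega> = \<omega>"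
      "\<And>h k \<omega>. \<omega> \<in> F \<Longrightarrow> L (h * k) \<omega> = L h (L k \<omega>)"
    and R: "bilin R" "\<And>h \<omega>. \<omega> \<in> F \<Longrightarrow> R \<omega> h \<in> F" "\<And>\<omega>. \<omega> \<in> F \<Longrightarrow> R \<omega> 1 = \<omega>"
      "\<And>h k \<omega>. \<omega> \<in> F \<Longrightarrow> R \<omega> (h * k) = R (R \<omega> h) k"
    and LR: "\<And>h k \<omega>. \<omega> \<in> F \<Longrightarrow> L h (R \<omega> k) = R (L h \<omega>) k"
    and \<beta>: "lin \<beta>" "\<And>\<omega>. \<omega> \<in> F \<Longrightarrow> \<beta> \<omega> \<in> tensor_space UNIV F"
      "\<And>\<omega>. \<omega> \<in> F \<Longrightarrow> tassoc (tmap \<Delta> id (\<beta> \<omega>)) = tmap id \<beta> (\<beta> \<omega>)"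
      "\<And>\<omega>. \<omega> \<in> F \<Longrightarrow> tlift (\<lambda>h \<eta>. \<epsilon> h *\<^sub>C \<eta>) (\<beta> \<omega>) = \<omega>"
    and \<gamma>: "lin \<gamma>" "\<And>\<omega>. \<omega> \<in> F \<Longrightarrow> \<gamma> \<omega> \<in> tensor_space F UNIV"
      "\<And>\<omega>. \<omega> \<in> F \<Longrightarrow> tassoc (tmap \<gamma> id (\<gamma> \<omega>)) = tmap id \<Delta> (\<gamma> \<omega>)"
      "\<And>\<omega>. \<omega> \<in> F \<Longrightarrow> tlift (\<lambda>\<eta> h. \<epsilon> h *\<^sub>C \<eta>) (\<gamma> \<omega>) = \<omega>"
    and \<beta>\<gamma>: "\<And>\<omega>. \<omega> \<in> F \<Longrightarrow> tassoc (tmap \<beta> id (\<gamma> \<omega>)) = tmap id \<gamma> (\<beta> \<omega>)"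
    and \<beta>L: "\<And>h \<omega>. \<omega> \<in> F \<Longrightarrow> \<beta> (L h \<omega>) = tmult (*) L (\<Delta> h) (\<beta> \<omega>)"
    and \<beta>R: "\<And>h \<omega>. \<omega> \<in> F \<Longrightarrow> \<beta> (R \<omega> h) = tmult (*) R (\<beta> \<omega>) (\<Delta> h)"
    and \<gamma>L: "\<And>h \<omega>. \<omega> \<in> F \<Longrightarrow> \<gamma> (L h \<omega>) = tmult L (*) (\<Delta> h) (\<gamma> \<omega>)"
    and \<gamma>R: "\<And>h \<omega>. \<omega> \<in> F \<Longrightarrow> \<gamma> (R \<omega> h) = tmult R (*) (\<gamma> \<omega>) (\<Delta> h)"
    and D: "lin D" "\<And>h. D h \<in> F" "\<And>h. \<beta> (D h) = tmap id D (\<Delta> h)" "\<And>h. \<gamma> (D h) = tmap D id (\<Delta> h)"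
      "\<And>h k. D (h * k) = R (D h) k + L h (D k)" "F = complex_vector.span {L h (D k) | h k. True}"
  shows "bicovariant_calculus \<Delta> \<epsilon> S \<lparr>forms = F, lact = L, ract = R, lcoact = \<beta>, rcoact = \<gamma>, diff = D\<rparr>"
proof -
  have bil: "bilin ((*) :: 'h \<Rightarrow> 'h \<Rightarrow> 'h)" by (intro lin_intros)
  have right: "tensor_lift UNIV F B t = tlift B t" if "bilin B" "t \<in> tensor_space UNIV F"
    for B :: "'a::complex_vector \<Rightarrow> 'v \<Rightarrow> 'b::complex_vector" and t
    by (rule tensor_lift_cong) (use that F in auto)
  have left: "tensor_lift F UNIV B t = tlift B t" if "bilin B" "t \<in> tensor_space F UNIV"
    for B :: "'v \<Rightarrow> 'a::complex_vector \<Rightarrow> 'b::complex_vector" and t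
    by (rule tensor_lift_cong) (use that F in auto)
  have bmap: "bilin (\<lambda>x y. f x \<otimes> k y)" if "lin f" "lin k"
    for f :: "'a::complex_vector \<Rightarrow> 'b::complex_vector" and k :: "'c::complex_vector \<Rightarrow> 'd::complex_vector"
    by (intro bilinI lin_tensor_left lin_tensor_right that)
  have map_right: "tensor_map UNIV F f k t = tmap f k t" if "lin f" "lin k" "t \<in> tensor_space UNIV F"
    for f :: "'a::complex_vector \<Rightarrow> 'b::complex_vector" and k :: "'v \<Rightarrow> 'd::complex_vector" and t
    unfolding tensor_map_def by (rule right[OF bmap[OF that(1,2)] that(3)])
  have map_left: "tensor_map F UNIV f k t = tmap f k t" if "lin f" "lin k" "t \<in> tensor_space F UNIV"
    for f :: "'v \<Rightarrow> 'b::complex_vector" and k :: "'a::complex_vector \<Rightarrow> 'd::complex_vector" and t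
    unfolding tensor_map_def by (rule left[OF bmap[OF that(1,2)] that(3)])
  have map_closed: "tmap f k t \<in> tensor_space X' Y'"
    if "complex_vector.subspace X" "complex_vector.subspace Y" "lin f" "lin k" "t \<in> tensor_space X Y"
      "\<And>x. x \<in> X \<Longrightarrow> f x \<in> X'" "\<And>y. y \<in> Y \<Longrightarrow> k y \<in> Y'"
    for f :: "'a::complex_vector \<Rightarrow> 'b::complex_vector" and k :: "'c::complex_vector \<Rightarrow> 'd::complex_vector"
      and X Y X' Y' t
    using that(5,1)
  proof (induction rule: tensor_space_induct)
    case zero
    then show ?case
      by (simp add: lin_zero[OF lin_tensor_map[OF that(3,4)]] complex_vector.subspace_0)
  next
    case (add x y s)
    then show ?case
      by (simp add: lin_add[OF lin_tensor_map[OF that(3,4)]] tensor_map_pure[OF that(3,4)]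
          complex_vector.subspace_add pure_in_tensor_space that)
  qed
  note b3 = bilin_assoc(1) and ba = bilin_assoc(2)
  have assoc1: "tensor_assoc UNIV UNIV F t = tassoc t" if "t \<in> tensor_space UNIV F"
    for t :: "(('a::complex_vector, 'b::complex_vector) tensor, 'v) tensor"
    unfolding tensor_assoc_def tensor_space_UNIV by (rule right[OF ba that])
  have assoc2: "tensor_assoc F UNIV UNIV t = tassoc t" if "t \<in> tensor_space (tensor_space F UNIV) UNIV"
    for t :: "(('v, 'b::complex_vector) tensor, 'c::complex_vector) tensor"
    unfolding tensor_assoc_def tensor_space_UNIV
    by (rule tensor_lift_cong) (use that F ba in \<open>simp_all add: left[OF b3]\<close>)
  have assoc3: "tensor_assoc UNIV F UNIV t = tassoc t" if "t \<in> tensor_space (tensor_space UNIV F) UNIV"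
    for t :: "(('a::complex_vector, 'v) tensor, 'c::complex_vector) tensor"
    unfolding tensor_assoc_def tensor_space_UNIV
    by (rule tensor_lift_cong) (use that F ba in \<open>simp_all add: right[OF b3]\<close>)
  have mi: "bilin (\<lambda>x' y'. m x x' \<otimes> m' y y')" if "bilin m" "bilin m'"
    for m :: "'a::complex_vector \<Rightarrow> 'b::complex_vector \<Rightarrow> 'c::complex_vector"
      and m' :: "'d::complex_vector \<Rightarrow> 'e::complex_vector \<Rightarrow> 'f::complex_vector" and x y
    by (rule bmap[OF bilin_lin(1)[OF that(1)] bilin_lin(1)[OF that(2)]])
  have mo: "bilin (\<lambda>x y. tlift (\<lambda>x' y'. m x x' \<otimes> m' y y') t)" if "bilin m" "bilin m'"
    for m :: "'a::complex_vector \<Rightarrow> 'b::complex_vector \<Rightarrow> 'c::complex_vector"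
      and m' :: "'d::complex_vector \<Rightarrow> 'e::complex_vector \<Rightarrow> 'f::complex_vector" and t
    using tensor_mult_outer[OF subspace_UNIV subspace_UNIV subspace_UNIV subspace_UNIV that] by simp
  have mult1: "tensor_mult UNIV UNIV UNIV F (*) L s t = tmult (*) L s t" if "t \<in> tensor_space UNIV F"
    for s :: "('h, 'h) tensor" and t
    unfolding tensor_mult_def using right[OF mi[OF bil L(1)] that] by simp
  have mult2: "tensor_mult UNIV UNIV F UNIV L (*) s t = tmult L (*) s t" if "t \<in> tensor_space F UNIV"
    for s :: "('h, 'h) tensor" and t
    unfolding tensor_mult_def using left[OF mi[OF L(1) bil] that] by simp
  have mult3: "tensor_mult UNIV F UNIV UNIV (*) R t s = tmult (*) R t s" if "t \<in> tensor_space UNIV F"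
    for s :: "('h, 'h) tensor" and t
    unfolding tensor_mult_def using right[OF mo[OF bil R(1)] that] by simp
  have mult4: "tensor_mult F UNIV UNIV UNIV R (*) t s = tmult R (*) t s" if "t \<in> tensor_space F UNIV"
    for s :: "('h, 'h) tensor" and t
    unfolding tensor_mult_def using left[OF mo[OF R(1) bil] that] by simp
  have e1: "bilin (\<lambda>h \<eta>. \<epsilon> h *\<^sub>C (\<eta> :: 'v))" and e2: "bilin (\<lambda>\<eta> h. \<epsilon> h *\<^sub>C (\<eta> :: 'v))"
    by (intro hopf_lin)+
  show ?thesis
  proof (unfold_locales, unfold calculus.simps)
    fix \<omega> h k
    show "complex_vector.subspace F" by (rule F)
    show "bilinear_on UNIV F L" by (rule bilinear_on_subset[OF L(1)]) simp_all
    show "bilinear_on F UNIV R" by (rule bilinear_on_subset[OF R(1)]) simp_all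
    show "linear_on F \<beta>" "linear_on F \<gamma>"
      by (rule linear_on_subset[OF \<beta>(1)] linear_on_subset[OF \<gamma>(1)]; simp)+
    show "linear_on UNIV D" by (rule D(1))
    show "D h \<in> F" "\<beta> (D h) = tmap id D (\<Delta> h)" "\<gamma> (D h) = tmap D id (\<Delta> h)"
      "D (h * k) = R (D h) k + L h (D k)" "F = complex_vector.span {L h (D k) | h k. True}"
      by (rule D)+
    assume \<omega>: "\<omega> \<in> F"
    show "L h \<omega> \<in> F" "L 1 \<omega> = \<omega>" "L (h * k) \<omega> = L h (L k \<omega>)" "R \<omega> h \<in> F" "R \<omega> 1 = \<omega>"
      "R \<omega> (h * k) = R (R \<omega> h) k" "L h (R \<omega> k) = R (L h \<omega>) k"
      "\<beta> \<omega> \<in> tensor_space UNIV F" "\<gamma> \<omega> \<in> tensor_space F UNIV"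
      using \<omega> by (simp_all add: L R LR \<beta>(2) \<gamma>(2))
    note t = \<beta>(2)[OF \<omega>] \<gamma>(2)[OF \<omega>]
    show "tensor_assoc UNIV UNIV F (tensor_map UNIV F \<Delta> id (\<beta> \<omega>)) = tensor_map UNIV F id \<beta> (\<beta> \<omega>)"
      unfolding map_right[OF linear_comult lin_id' t(1)] map_right[OF lin_id' \<beta>(1) t(1)]
      by (subst assoc1) (simp_all add: \<beta>(3)[OF \<omega>] map_closed[OF subspace_UNIV F linear_comult lin_id' t(1)])
    show "tensor_lift UNIV F (\<lambda>h \<eta>. \<epsilon> h *\<^sub>C \<eta>) (\<beta> \<omega>) = \<omega>"
      unfolding right[OF e1 t(1)] by (rule \<beta>(4)[OF \<omega>])
    show "tensor_assoc F UNIV UNIV (tensor_map F UNIV \<gamma> id (\<gamma> \<omega>)) = tensor_map F UNIV id \<Delta> (\<gamma> \<omega>)"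
      unfolding map_left[OF \<gamma>(1) lin_id' t(2)] map_left[OF lin_id' linear_comult t(2)]
      by (subst assoc2) (simp_all add: \<gamma>(3)[OF \<omega>] \<gamma>(2) map_closed[OF F subspace_UNIV \<gamma>(1) lin_id' t(2)])
    show "tensor_lift F UNIV (\<lambda>\<eta> h. \<epsilon> h *\<^sub>C \<eta>) (\<gamma> \<omega>) = \<omega>"
      unfolding left[OF e2 t(2)] by (rule \<gamma>(4)[OF \<omega>])
    show "tensor_assoc UNIV F UNIV (tensor_map F UNIV \<beta> id (\<gamma> \<omega>)) = tensor_map UNIV F id \<gamma> (\<beta> \<omega>)"
      unfolding map_left[OF \<beta>(1) lin_id' t(2)] map_right[OF lin_id' \<gamma>(1) t(1)]
      by (subst assoc3) (simp_all add: \<beta>\<gamma>[OF \<omega>] \<beta>(2) map_closed[OF F subspace_UNIV \<beta>(1) lin_id' t(2)])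
    show "\<beta> (L h \<omega>) = tensor_mult UNIV UNIV UNIV F (*) L (\<Delta> h) (\<beta> \<omega>)"
      unfolding mult1[OF t(1)] by (rule \<beta>L[OF \<omega>])
    show "\<beta> (R \<omega> h) = tensor_mult UNIV F UNIV UNIV (*) R (\<beta> \<omega>) (\<Delta> h)"
      unfolding mult3[OF t(1)] by (rule \<beta>R[OF \<omega>])
    show "\<gamma> (L h \<omega>) = tensor_mult UNIV UNIV F UNIV L (*) (\<Delta> h) (\<gamma> \<omega>)"
      unfolding mult2[OF t(2)] by (rule \<gamma>L[OF \<omega>])
    show "\<gamma> (R \<omega> h) = tensor_mult F UNIV UNIV UNIV R (*) (\<gamma> \<omega>) (\<Delta> h)"
      unfolding mult4[OF t(2)] by (rule \<gamma>R[OF \<omega>])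
  qed
qed

section \<open>The model calculi\<close>

lemma lin_funpow:
  fixes N :: "'a::complex_vector \<Rightarrow> 'a"
  assumes "lin N" shows "lin (N ^^ m)"
proof (induction m)
  case (Suc m)
  from lin_compose[OF assms this] show ?case by (simp add: comp_def)
qed (simp add: lin_id'[unfolded id_def] id_def)

lemma funpow_zero:
  fixes N :: "'a::complex_vector \<Rightarrow> 'a"
  assumes "lin N" "N v = 0" shows "(N ^^ Suc m) v = 0"
  by (simp add: funpow_Suc_right assms(2) lin_zero[OF lin_funpow[OF assms(1)]] del: funpow.simps)

text \<open>The Neumann series, an inverse of \<open>1 - N\<close> once \<open>N ^^ n\<close> is
  zero.\<close>

definition geometric :: "nat \<Rightarrow> ('a \<Rightarrow> 'a) \<Rightarrow> 'a \<Rightarrow> 'a::complex_vector"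
  where "geometric n N v = (\<Sum>m<n. (N ^^ m) v)"

lemma lin_geometric: "lin (N :: 'a \<Rightarrow> 'a::complex_vector) \<Longrightarrow> lin (geometric n N)"
  unfolding geometric_def by (intro lin_sum_fun lin_funpow)

lemma geometric_inverse:
  fixes N :: "'a::complex_vector \<Rightarrow> 'a"
  assumes N: "lin N" and nil: "\<And>v. (N ^^ n) v = 0"
  shows "geometric n N (v - N v) = v" and "geometric n N v - N (geometric n N v) = v"
proof -
  have *: "geometric n N v - N (geometric n N v) = v"
  proof -
    have "N (geometric n N v) = (\<Sum>m<n. (N ^^ Suc m) v)"
      unfolding geometric_def by (simp add: lin_sum[OF N])
    then have "geometric n N v - N (geometric n N v) = (\<Sum>m<n. (N ^^ m) v - (N ^^ Suc m) v)"
      by (simp add: geometric_def sum_subtractf)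
    also have "\<dots> = (N ^^ 0) v - (N ^^ n) v" by (rule sum_lessThan_telescope')
    finally show ?thesis by (simp add: nil)
  qed
  then show "geometric n N v - N (geometric n N v) = v" .
  have "geometric n N (N v) = N (geometric n N v)"
    unfolding geometric_def lin_sum[OF N] by (simp add: funpow_swap1)
  then show "geometric n N (v - N v) = v"
    using * by (simp add: lin_diff[OF lin_geometric[OF N]])
qed

locale planck_model = planck_hopf_algebra hbar G p g ginv \<Delta> \<epsilon> S
  for hbar G :: complex and p g ginv :: "'h::complex_algebra_1"
    and \<Delta> :: "'h \<Rightarrow> ('h, 'h) tensor" and \<epsilon> :: "'h \<Rightarrow> complex" and S :: "'h \<Rightarrow> 'h" +
  fixes I :: "nat set"
  assumes finite_I: "finite I" and I_nonempty: "I \<noteq> {}" and I_pos: "I \<subseteq> {1..}"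
begin

definition height :: "nat \<Rightarrow> nat" where "height k = card {n\<in>I. k < n}"

lemma height_mono: "height (Suc k) \<le> height k"
  unfolding height_def by (intro card_mono) (auto simp: finite_I)

lemma height_step: "height k \<le> Suc (height (Suc k))"
proof -
  have "{n\<in>I. k < n} \<subseteq> insert (Suc k) {n\<in>I. Suc k < n}" by auto
  then have "height k \<le> card (insert (Suc k) {n\<in>I. Suc k < n})"
    unfolding height_def by (intro card_mono) (auto simp: finite_I)
  also have "\<dots> \<le> Suc (height (Suc k))" unfolding height_def by (rule card_insert_le_m1) auto
  finally show ?thesis .
qed

lemma height_le: "height k \<le> card I"
  unfolding height_def by (intro card_mono) (auto simp: finite_I)

lemma height_0: "height 0 = card I"
proof -
  have "{n\<in>I. 0 < n} = I" using I_pos by auto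
  then show ?thesis by (simp add: height_def)
qed

lemma height_0_pos: "0 < height 0"
  using finite_I I_nonempty by (simp add: height_0 card_gt_0_iff)

text \<open>Being zero outside the diagram is built in, so that the formulas for the operators need
  no case distinction at its boundary. Indexing through \<open>prod_encode\<close> puts the models
  of all sets \<open>I\<close> into one type.\<close>

definition b :: "nat \<Rightarrow> nat \<Rightarrow> (nat \<Rightarrow>\<^sub>0 complex)"
  where "b k a = (if a < height k then Poly_Mapping.single (prod_encode (k, a)) 1 else 0)"

lemma b_zero: "height k \<le> a \<Longrightarrow> b k a = 0"
  by (simp add: b_def)

text \<open>The basis vectors outside the diagram are sent to zero, so that nilpotency and the
  algebra relations hold on the whole type.\<close>

definition diagram_map :: "(nat \<Rightarrow> nat \<Rightarrow> (nat \<Rightarrow>\<^sub>0 complex)) \<Rightarrow> (nat \<Rightarrow>\<^sub>0 complex) \<Rightarrow> (nat \<Rightarrow>\<^sub>0 complex)"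
  where "diagram_map X = free_extend (\<lambda>n. case prod_decode n of (k, a) \<Rightarrow> if a < height k then X k a else 0)"

lemma lin_diagram_map: "lin (diagram_map X)"
  unfolding diagram_map_def by (rule lin_free_extend)

lemma diagram_map_b: "(height k \<le> a \<Longrightarrow> X k a = 0) \<Longrightarrow> diagram_map X (b k a) = X k a"
  by (auto simp: diagram_map_def b_def free_extend_single lin_zero[OF lin_free_extend])

lemma diagram_map_outside:
  "prod_decode n = (k, a) \<Longrightarrow> height k \<le> a \<Longrightarrow> diagram_map X (Poly_Mapping.single n 1) = 0"
  by (simp add: diagram_map_def free_extend_single)

lemma basis_eq:
  assumes "lin u" "lin v" "\<And>k a. u (b k a) = v (b k a)"
    and "\<And>n k a. prod_decode n = (k, a) \<Longrightarrow> height k \<le> a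
      \<Longrightarrow> u (Poly_Mapping.single n 1) = v (Poly_Mapping.single n 1)"
  shows "u f = v f"
proof (rule lin_free_eq[OF assms(1,2)])
  fix n
  obtain k a where n: "prod_decode n = (k, a)" by (cases "prod_decode n")
  then have e: "prod_encode (k, a) = n" by (metis prod_decode_inverse)
  show "u (Poly_Mapping.single n 1) = v (Poly_Mapping.single n 1)"
  proof (cases "a < height k")
    case True
    then show ?thesis using assms(3)[of k a] by (simp add: b_def e)
  qed (use assms(4)[OF n] in simp)
qed

text \<open>With \<open>b k a\<close> in the role of \<open>w k a\<close>, the generators \<open>g\<close>, \<open>ginv\<close> and \<open>p\<close> act on the
  invariant forms by \<open>(1 + up) (1 - lam low)\<inverse>\<close>, by its inverse and by \<open>pact\<close>.\<close>

definition up where "up = diagram_map (\<lambda>k a. b k (Suc a))"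
definition low where "low = diagram_map (\<lambda>k a. of_nat k *\<^sub>C b (k - 1) (Suc a))"
definition pact where "pact = diagram_map (\<lambda>k a. b (Suc k) a + (of_nat k * lam) *\<^sub>C b k a)"
definition depth where "depth = Suc (card I)"
definition gact where "gact v = (let s = geometric depth (\<lambda>v. lam *\<^sub>C low v) v in s + up s)"
definition hact where "hact v = (let s = geometric depth (\<lambda>v. - up v) v in s - lam *\<^sub>C low s)"

lemma up_b: "up (b k a) = b k (Suc a)"
  unfolding up_def by (rule diagram_map_b) (simp add: b_zero)

text \<open>By \<open>height_step\<close> a place above column \<open>k\<close> is moved above
  column \<open>k - 1\<close>, so the formula stays valid where \<open>b k a\<close> is zero; for
  \<open>k = 0\<close> the coefficient vanishes.\<close>

lemma low_b: "low (b k a) = of_nat k *\<^sub>C b (k - 1) (Suc a)"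
proof (unfold low_def, rule diagram_map_b)
  assume "height k \<le> a"
  then show "of_nat k *\<^sub>C b (k - 1) (Suc a) = 0"
    using height_step[of "k - 1"] by (cases k) (simp_all add: b_zero)
qed

lemma pact_b: "pact (b k a) = b (Suc k) a + (of_nat k * lam) *\<^sub>C b k a"
proof (unfold pact_def, rule diagram_map_b)
  assume "height k \<le> a"
  then show "b (Suc k) a + (of_nat k * lam) *\<^sub>C b k a = 0"
    using height_mono[of k] by (simp add: b_zero)
qed

lemma lin_up: "lin up" and lin_low: "lin low" and lin_pact: "lin pact"
  by (simp_all add: up_def low_def pact_def lin_diagram_map)

lemma lin_neg_up: "lin (\<lambda>v. - up v)" and lin_lam_low: "lin (\<lambda>v. lam *\<^sub>C low v)"
  by (intro lin_uminus lin_up lin_scaleC lin_low)+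

text \<open>Each application raises \<open>a\<close> by one and no column is higher than
  \<open>card I\<close>. The same holds for \<open>low\<close>, which also raises \<open>a\<close>.
  Vectors outside the diagram die at the first application, which the successor in
  \<open>depth\<close> provides.\<close>

lemma neg_up_nilpotent: "((\<lambda>v. - up v) ^^ depth) v = 0"
proof -
  have "\<exists>c. ((\<lambda>v. - up v) ^^ m) (b k a) = c *\<^sub>C b k (a + m)" for k a m
  proof (induction m)
    case 0
    then show ?case by (intro exI[of _ 1]) simp
  next
    case (Suc m)
    then obtain c where "((\<lambda>v. - up v) ^^ m) (b k a) = c *\<^sub>C b k (a + m)" by blast
    then show ?case by (intro exI[of _ "- c"]) (simp add: lin_scale[OF lin_up] up_b)
  qed
  from this[of depth] have 1: "((\<lambda>v. - up v) ^^ depth) (b k a) = 0" for k a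
    using height_le[of k] by (metis b_zero depth_def le_SucI scaleC_zero_simps(2) trans_le_add2)
  show ?thesis
  proof (rule basis_eq[where u = "(\<lambda>v. - up v) ^^ depth" and v = "\<lambda>v. 0" and f = v])
    show "((\<lambda>v. - up v) ^^ depth) (Poly_Mapping.single n 1) = 0"
      if "prod_decode n = (k, a)" "height k \<le> a" for n k a
      unfolding depth_def
      by (rule funpow_zero[OF lin_neg_up]) (simp add: up_def diagram_map_outside[OF that])
  qed (simp_all add: 1 lin_funpow lin_neg_up lin_const0)
qed

lemma lam_low_nilpotent: "((\<lambda>v. lam *\<^sub>C low v) ^^ depth) v = 0"
proof -
  have "\<exists>c k'. ((\<lambda>v. lam *\<^sub>C low v) ^^ m) (b k a) = c *\<^sub>C b k' (a + m)" for k a m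
  proof (induction m)
    case 0
    then show ?case by (intro exI[of _ 1] exI[of _ k]) simp
  next
    case (Suc m)
    then obtain c k' where "((\<lambda>v. lam *\<^sub>C low v) ^^ m) (b k a) = c *\<^sub>C b k' (a + m)" by blast
    then show ?case
      by (intro exI[of _ "lam * (c * of_nat k')"] exI[of _ "k' - 1"])
        (simp add: lin_scale[OF lin_low] low_b scaleC_scaleC)
  qed
  then have 1: "((\<lambda>v. lam *\<^sub>C low v) ^^ depth) (b k a) = 0" for k a
    using height_le by (metis b_zero depth_def le_SucI scaleC_zero_simps(2) trans_le_add2)
  show ?thesis
  proof (rule basis_eq[where u = "(\<lambda>v. lam *\<^sub>C low v) ^^ depth" and v = "\<lambda>v. 0" and f = v])
    show "((\<lambda>v. lam *\<^sub>C low v) ^^ depth) (Poly_Mapping.single n 1) = 0"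
      if "prod_decode n = (k, a)" "height k \<le> a" for n k a
      unfolding depth_def
      by (rule funpow_zero[OF lin_lam_low]) (simp add: low_def diagram_map_outside[OF that])
  qed (simp_all add: 1 lin_funpow lin_lam_low lin_const0)
qed

lemmas geometric_low = geometric_inverse[OF lin_lam_low lam_low_nilpotent]
lemmas geometric_up = geometric_inverse[OF lin_neg_up neg_up_nilpotent]

lemma lin_gact: "lin gact"
  unfolding gact_def Let_def
  by (intro lin_plus lin_compose[OF lin_up] lin_geometric lin_lam_low)

lemma lin_hact: "lin hact"
  unfolding hact_def Let_def
  by (intro lin_subtract lin_scaleC lin_compose[OF lin_low] lin_geometric lin_neg_up)

lemma gact_diff: "gact (v - lam *\<^sub>C low v) = v + up v"
  by (simp add: gact_def geometric_low)

lemma hact_sum: "hact (v + up v) = v - lam *\<^sub>C low v"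
  using geometric_up(1)[of v] by (simp add: hact_def)

lemma gact_hact: "gact (hact v) = v"
  using gact_diff[of "geometric depth (\<lambda>v. - up v) v"] geometric_up(2)[of v]
  by (simp add: hact_def Let_def)

lemma hact_gact: "hact (gact v) = v"
  using hact_sum[of "geometric depth (\<lambda>v. lam *\<^sub>C low v) v"] geometric_low(2)[of v]
  by (simp add: gact_def Let_def)

lemma gact_b: "gact (b k a) = (of_nat k * lam) *\<^sub>C gact (b (k - 1) (Suc a)) + (b k a + b k (Suc a))"
proof -
  have "gact (b k a - lam *\<^sub>C low (b k a)) = b k a + b k (Suc a)"
    by (simp add: gact_diff up_b)
  then show ?thesis
    by (simp add: low_b lin_simps[OF lin_gact] scaleC_scaleC algebra_simps)
qed

lemma hact_b: "hact (b k a + b k (Suc a)) = b k a - (of_nat k * lam) *\<^sub>C b (k - 1) (Suc a)"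
  using hact_sum[of "b k a"] by (simp add: up_b low_b scaleC_scaleC mult.commute)

text \<open>On \<open>b k a + b k (Suc a)\<close> the operator \<open>hact\<close> is explicit by
  \<open>hact_b\<close>, and there the relation is a computation. Downward induction on
  \<open>a\<close> from the top of the column then passes to \<open>b k a\<close> itself.\<close>

lemma pact_hact: "pact (hact v) - hact (pact v) = lam *\<^sub>C (v - hact v)"
proof (rule basis_eq[where f = v])
  show "lin (\<lambda>v. pact (hact v) - hact (pact v))" "lin (\<lambda>v. lam *\<^sub>C (v - hact v))"
    by (intro lin_subtract lin_scaleC lin_id lin_hact lin_compose[OF lin_pact] lin_compose[OF lin_hact]
        lin_pact)+
  note l = lin_simps[OF lin_hact] lin_simps[OF lin_pact]
  have sum: "pact (hact (b k a + b k (Suc a))) - hact (pact (b k a + b k (Suc a)))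
      = lam *\<^sub>C (b k a + b k (Suc a) - hact (b k a + b k (Suc a)))" for k a
  proof -
    let ?z = "\<lambda>k. b k a + b k (Suc a)"
    have "pact (?z k) = ?z (Suc k) + (of_nat k * lam) *\<^sub>C ?z k"
      by (simp add: l pact_b scaleC_simps)
    then have "hact (pact (?z k)) = hact (?z (Suc k)) + (of_nat k * lam) *\<^sub>C hact (?z k)"
      by (simp only: lin_add[OF lin_hact, of "?z (Suc k)"] lin_scale[OF lin_hact])
    then have e1: "hact (pact (?z k)) = b (Suc k) a - (of_nat (Suc k) * lam) *\<^sub>C b k (Suc a)
        + (of_nat k * lam) *\<^sub>C (b k a - (of_nat k * lam) *\<^sub>C b (k - 1) (Suc a))"
      unfolding hact_b by simp
    have e2: "pact (hact (?z k)) = b (Suc k) a + (of_nat k * lam) *\<^sub>C b k a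
      - (of_nat k * lam) *\<^sub>C (b k (Suc a) + (of_nat (k - 1) * lam) *\<^sub>C b (k - 1) (Suc a))"
      unfolding hact_b by (cases k) (simp_all add: l pact_b del: of_nat_Suc)
    show ?thesis
      unfolding e1 e2 unfolding hact_b by (cases k) (simp_all add: scaleC_simps algebra_simps)
  qed
  show "pact (hact (b k a)) - hact (pact (b k a)) = lam *\<^sub>C (b k a - hact (b k a))" for k a
  proof (induction "height k - a" arbitrary: a)
    case 0
    then show ?case by (simp add: b_zero l)
  next
    case (Suc j)
    then have "pact (hact (b k (Suc a))) - hact (pact (b k (Suc a)))
        = lam *\<^sub>C (b k (Suc a) - hact (b k (Suc a)))" by simp
    with sum[of k a] show ?case by (simp add: l scaleC_simps algebra_simps)
  qed
  show "pact (hact (Poly_Mapping.single n 1)) - hact (pact (Poly_Mapping.single n 1))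
      = lam *\<^sub>C (Poly_Mapping.single n 1 - hact (Poly_Mapping.single n 1))"
    if "prod_decode n = (k, a)" "height k \<le> a" for n k a
  proof -
    let ?s = "Poly_Mapping.single n (1 :: complex)"
    have z: "up ?s = 0" "low ?s = 0" "pact ?s = 0"
      using diagram_map_outside[OF that] by (simp_all add: up_def low_def pact_def)
    have "hact (?s + up ?s) = ?s - lam *\<^sub>C low ?s" by (rule hact_sum)
    then have "hact ?s = ?s" by (simp add: z)
    then show ?thesis by (simp add: z lin_zero[OF lin_hact])
  qed
qed

end

section \<open>Finitely supported families as a tensor product\<close>

lemma lin_single: "lin (\<lambda>x. Poly_Mapping.single n (x :: 'a::complex_vector))"
  by (rule linI) (simp_all add: single_add single_scaleC)

text \<open>The counterpart of \<open>free_extend\<close> for coefficients in an arbitrary space: a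
  linear map given by its components.\<close>

definition coordinate_sum :: "('k \<Rightarrow> 'a::complex_vector \<Rightarrow> 'b::complex_vector) \<Rightarrow> ('k \<Rightarrow>\<^sub>0 'a) \<Rightarrow> 'b"
  where "coordinate_sum B f = (\<Sum>n\<in>Poly_Mapping.keys f. B n (Poly_Mapping.lookup f n))"

lemma coordinate_sum_superset:
  assumes "\<And>n. lin (B n)" "finite K" "Poly_Mapping.keys f \<subseteq> K"
  shows "coordinate_sum B f = (\<Sum>n\<in>K. B n (Poly_Mapping.lookup f n))"
  unfolding coordinate_sum_def using assms
  by (intro sum.mono_neutral_left) (auto simp: in_keys_iff lin_zero)

lemma lin_coordinate_sum:
  fixes B :: "'k \<Rightarrow> 'a::complex_vector \<Rightarrow> 'b::complex_vector"
  assumes B: "\<And>n. lin (B n)" shows "lin (coordinate_sum B)"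
proof (rule linI)
  fix f f' :: "'k \<Rightarrow>\<^sub>0 'a" and c
  let ?K = "Poly_Mapping.keys f \<union> Poly_Mapping.keys f'"
  have "coordinate_sum B (f + f') = (\<Sum>n\<in>?K. B n (Poly_Mapping.lookup (f + f') n))"
    by (rule coordinate_sum_superset) (simp_all add: B Poly_Mapping.keys_add)
  also have "\<dots> = coordinate_sum B f + coordinate_sum B f'"
    using coordinate_sum_superset[of B ?K f, OF B] coordinate_sum_superset[of B ?K f', OF B]
    by (simp add: lookup_add lin_add[OF B] sum.distrib)
  finally show "coordinate_sum B (f + f') = coordinate_sum B f + coordinate_sum B f'" .
  have "coordinate_sum B (c *\<^sub>C f) = (\<Sum>n\<in>Poly_Mapping.keys f. B n (Poly_Mapping.lookup (c *\<^sub>C f) n))"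
    by (rule coordinate_sum_superset) (auto simp: B in_keys_iff lookup_scaleC)
  then show "coordinate_sum B (c *\<^sub>C f) = c *\<^sub>C coordinate_sum B f"
    by (simp add: coordinate_sum_def lookup_scaleC lin_scale[OF B] complex_vector.scale_sum_right)
qed

lemma coordinate_sum_single: "lin (B n) \<Longrightarrow> coordinate_sum B (Poly_Mapping.single n x) = B n x"
  by (auto simp: coordinate_sum_def lin_zero)

text \<open>\<open>tens c x\<close> is \<open>c \<otimes> x\<close> under the identification of \<open>(nat \<Rightarrow>\<^sub>0 complex) \<otimes> 'h\<close>
  with \<open>nat \<Rightarrow>\<^sub>0 'h\<close>.\<close>

definition tens :: "(nat \<Rightarrow>\<^sub>0 complex) \<Rightarrow> 'h::complex_vector \<Rightarrow> (nat \<Rightarrow>\<^sub>0 'h)"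
  where "tens c x = free_extend (\<lambda>n. Poly_Mapping.single n x) c"

lemma lin_tens_left: "lin (\<lambda>c. tens c x)" and lin_tens_right: "lin (tens c)"
  unfolding tens_def by (rule lin_free_extend lin_free_extend_param[OF lin_single])+

lemmas tens_simps = lin_simps[OF lin_tens_left] lin_simps[OF lin_tens_right]

lemma tens_single: "tens (Poly_Mapping.single n 1) x = Poly_Mapping.single n x"
  by (simp add: tens_def free_extend_single)

lemma tens_eq:
  assumes "lin u" "lin v" "\<And>c x. u (tens c x) = v (tens c x)" shows "u f = v f"
proof (induction f rule: poly_mapping_induct)
  case (add n x f)
  then show ?case
    using assms(3)[of "Poly_Mapping.single n 1" x]
    by (simp add: lin_add[OF assms(1)] lin_add[OF assms(2)] tens_single)
qed (simp add: lin_zero[OF assms(1)] lin_zero[OF assms(2)])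

lemma coordinate_sum_tens:
  assumes B: "\<And>n. lin (B n)" and C: "\<And>x. lin (\<lambda>c. C c x)"
    and eq: "\<And>n x. C (Poly_Mapping.single n 1) x = B n x"
  shows "coordinate_sum B (tens c x) = C c x"
  by (rule lin_free_eq[where f = c])
    (simp_all add: lin_compose[OF lin_coordinate_sum[OF B] lin_tens_left] C tens_single
      coordinate_sum_single[OF B] eq)

definition act_tens :: "((nat \<Rightarrow>\<^sub>0 complex) \<Rightarrow> (nat \<Rightarrow>\<^sub>0 complex)) \<Rightarrow> 'h \<Rightarrow> (nat \<Rightarrow>\<^sub>0 'h) \<Rightarrow> (nat \<Rightarrow>\<^sub>0 'h::complex_algebra_1)"
  where "act_tens T x = coordinate_sum (\<lambda>n y. tens (T (Poly_Mapping.single n 1)) (x * y))"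

lemma lin_act_tens_aux: "lin (\<lambda>y. tens c (x * (y :: 'h::complex_algebra_1)))"
  by (rule lin_compose[OF lin_tens_right lin_mult_left[OF lin_id]])

lemma lin_act_tens: "lin (act_tens T x)"
  unfolding act_tens_def by (rule lin_coordinate_sum[OF lin_act_tens_aux])

lemma act_tens: "lin T \<Longrightarrow> act_tens T x (tens c y) = tens (T c) (x * y)"
  unfolding act_tens_def
  by (rule coordinate_sum_tens[OF lin_act_tens_aux]) (rule lin_compose[OF lin_tens_left], assumption, rule refl)

definition right_tens :: "(nat \<Rightarrow>\<^sub>0 'h) \<Rightarrow> 'h::complex_algebra_1 \<Rightarrow> (nat \<Rightarrow>\<^sub>0 'h)"
  where "right_tens f x = coordinate_sum (\<lambda>n y. Poly_Mapping.single n (y * x)) f"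

lemma lin_right_tens_aux: "lin (\<lambda>y. Poly_Mapping.single n (y * (x :: 'h::complex_algebra_1)))"
  by (rule lin_compose[OF lin_single lin_mult_right[OF lin_id]])

lemma right_tens: "right_tens (tens c y) x = tens c (y * x)"
  unfolding right_tens_def
  by (rule coordinate_sum_tens[OF lin_right_tens_aux]) (simp_all add: lin_tens_left tens_single)

lemma lin_right_tens: "lin (\<lambda>f. right_tens f x)"
  unfolding right_tens_def by (rule lin_coordinate_sum[OF lin_right_tens_aux])

lemma lin_right_tens_param: "lin (right_tens (f :: nat \<Rightarrow>\<^sub>0 'h::complex_algebra_1))"
  unfolding right_tens_def coordinate_sum_def
  by (intro lin_sum_fun lin_compose[OF lin_single] lin_mult_left lin_id)

lemma right_tens_mult: "right_tens f (x * y) = right_tens (right_tens f x) y"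
  by (rule tens_eq[where f = f]) (simp_all add: lin_right_tens lin_compose[OF lin_right_tens lin_right_tens]
      right_tens mult.assoc)

lemma right_tens_one: "right_tens f 1 = f"
  by (rule tens_eq[where f = f]) (simp_all add: lin_right_tens lin_id right_tens)

lemma lin_span_closed:
  assumes "lin f" "\<And>x. x \<in> B \<Longrightarrow> f x \<in> Y" "complex_vector.subspace Y" "x \<in> complex_vector.span B"
  shows "f x \<in> Y"
  using assms(4)
  by (induction rule: complex_vector.span_induct_alt)
    (simp_all add: lin_simps[OF assms(1)] assms(2) complex_vector.subspace_0[OF assms(3)]
      complex_vector.subspace_add[OF assms(3)] complex_vector.subspace_scale[OF assms(3)])

lemma lin_eq_span:
  assumes "lin f" "lin h" "\<And>x. x \<in> B \<Longrightarrow> f x = h x" "x \<in> complex_vector.span B"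
  shows "f x = h x"
  by (rule linear_on_eq_span[OF assms(1,2) subspace_UNIV subset_UNIV assms(3,4)])

lemma (in planck_hopf_algebra) comult_pf_ginv: "\<Delta> (pf i * ginv ^ k)
    = (\<Sum>l\<le>i. of_nat (i choose l) *\<^sub>C ((pf l * ginv ^ k) \<otimes> (pf (i - l) * g ^ l * ginv ^ k)))"
proof -
  have b: "bilin (\<lambda>a b. (a * ginv ^ k) \<otimes> (b * ginv ^ k))"
    and b': "bilin (\<lambda>c d. (a * c) \<otimes> (b * d))" for a b :: 'h by (intro lin_intros)+
  have "\<Delta> (pf i * ginv ^ k) = tlift (\<otimes>) (\<Delta> (pf i * ginv ^ k))" by (simp add: tlift_tensor)
  also have "\<dots> = tlift (\<lambda>a b. tlift (\<lambda>c d. (a * c) \<otimes> (b * d)) (\<Delta> (ginv ^ k))) (\<Delta> (pf i))"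
    by (rule sweedler_mult[OF bilin_pure_tensor])
  also have "\<dots> = (\<Sum>l\<le>i. of_nat (i choose l) *\<^sub>C ((pf l * ginv ^ k) \<otimes> (pf (i - l) * g ^ l * ginv ^ k)))"
    unfolding comult_ginv_power tlift_pure[OF b'] comult_pf
    by (simp only: lin_sum[OF lin_tlift[OF b]] lin_scale[OF lin_tlift[OF b]] tlift_pure[OF b])
  finally show ?thesis .
qed

section \<open>The bimodule of the model\<close>

context planck_model
begin

text \<open>The algebra acts on the tensor product of the invariant forms with itself through its
  coproduct, so the two summands for \<open>p\<close> are those of
  \<open>\<Delta> p\<close>.\<close>

definition lgen :: "planck_gen \<Rightarrow> (nat \<Rightarrow>\<^sub>0 'h) \<Rightarrow> (nat \<Rightarrow>\<^sub>0 'h)" where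
  "lgen = case_planck_gen (\<lambda>f. act_tens pact g f + act_tens (\<lambda>c. c) p f) (act_tens gact g)
    (act_tens hact ginv)"

lemma lgen_tens:
  "lgen Gen_p (tens c x) = tens (pact c) (g * x) + tens c (p * x)"
  "lgen Gen_g (tens c x) = tens (gact c) (g * x)"
  "lgen Gen_ginv (tens c x) = tens (hact c) (ginv * x)"
  by (simp_all add: lgen_def act_tens lin_pact lin_gact lin_hact lin_id)

lemma lin_lgen: "lin (lgen s)"
  by (cases s) (simp_all add: lgen_def lin_plus lin_act_tens)

lemma lgen_inverse: "lgen Gen_g (lgen Gen_ginv f) = f" "lgen Gen_ginv (lgen Gen_g f) = f"
  by (rule tens_eq[where f = f]; simp add: lin_compose[OF lin_lgen lin_lgen] lin_id lgen_tens
      gact_hact hact_gact g_ginv_assoc ginv_g_assoc)+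

lemma lgen_p_ginv: "lgen Gen_p (lgen Gen_ginv f)
    = lgen Gen_ginv (lgen Gen_p f) + lam *\<^sub>C (f - lgen Gen_ginv f)"
proof (rule tens_eq[where f = f])
  show "lin (\<lambda>f. lgen Gen_p (lgen Gen_ginv f))"
    "lin (\<lambda>f. lgen Gen_ginv (lgen Gen_p f) + lam *\<^sub>C (f - lgen Gen_ginv f))"
    by (intro lin_plus lin_scaleC lin_subtract lin_id lin_compose[OF lin_lgen lin_lgen] lin_lgen)+
  fix c and x :: 'h
  have 1: "pact (hact c) = hact (pact c) + lam *\<^sub>C (c - hact c)"
    using pact_hact[of c] by (simp add: algebra_simps)
  have 2: "p * (ginv * x) = ginv * (p * x) + lam *\<^sub>C (x - ginv * x)"
    by (simp add: mult.assoc[symmetric] p_ginv distrib_right mult_scaleC_left left_diff_distrib)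
  show "lgen Gen_p (lgen Gen_ginv (tens c x))
      = lgen Gen_ginv (lgen Gen_p (tens c x)) + lam *\<^sub>C (tens c x - lgen Gen_ginv (tens c x))"
    by (simp add: lgen_tens lin_add[OF lin_lgen] 1 2 g_ginv_assoc ginv_g_assoc tens_simps scaleC_simps)
qed

text \<open>The defining relation follows from \<open>lgen_p_ginv\<close> by inserting the action of
  \<open>g\<close> on the right and then applying it on the left.\<close>

lemma lgen_rel: assumes "r \<in> rels" shows "word_act lgen r f = 0"
proof -
  have "lgen Gen_p (lgen Gen_g f) = lgen Gen_g (lgen Gen_ginv (lgen Gen_p (lgen Gen_g f)))"
    by (simp add: lgen_inverse)
  also have "lgen Gen_ginv (lgen Gen_p (lgen Gen_g f))
      = lgen Gen_p f - lam *\<^sub>C (lgen Gen_g f - f)"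
    using lgen_p_ginv[of "lgen Gen_g f"] by (simp add: lgen_inverse algebra_simps)
  finally have "lgen Gen_p (lgen Gen_g f) - lgen Gen_g (lgen Gen_p f)
      - (lam *\<^sub>C lgen Gen_g f - lam *\<^sub>C lgen Gen_g (lgen Gen_g f)) = 0"
    by (simp add: lin_simps[OF lin_lgen] scaleC_simps)
  with assms show ?thesis
    unfolding planck_relations_def
    by (auto simp: lin_diff[OF lin_word_act_param] word_act_single lam_def lgen_inverse)
qed

definition lmul :: "'h \<Rightarrow> (nat \<Rightarrow>\<^sub>0 'h) \<Rightarrow> (nat \<Rightarrow>\<^sub>0 'h)" where "lmul = presented_act gens lgen"

lemma lmul: "lin (lmul h)" "lin (\<lambda>h. lmul h f)" "lmul (h * k) f = lmul h (lmul k f)" "lmul 1 f = f"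
  unfolding lmul_def
  by (rule lin_presented_act[OF presentation lin_lgen lgen_rel]
      lin_presented_act_param[OF presentation lin_lgen lgen_rel]
      presented_act_mult[OF presentation lin_lgen lgen_rel]
      presented_act_one[OF presentation lin_lgen lgen_rel] | assumption)+

lemma lmul_gen:
  "lmul p (tens c x) = tens (pact c) (g * x) + tens c (p * x)"
  "lmul g (tens c x) = tens (gact c) (g * x)"
  "lmul ginv (tens c x) = tens (hact c) (ginv * x)"
proof -
  have "lmul (gens s) f = lgen s f" for s f
    unfolding lmul_def by (rule presented_act_gen[OF presentation lin_lgen lgen_rel])
  from this[of Gen_p] this[of Gen_g] this[of Gen_ginv]
  show "lmul p (tens c x) = tens (pact c) (g * x) + tens c (p * x)"
    "lmul g (tens c x) = tens (gact c) (g * x)" "lmul ginv (tens c x) = tens (hact c) (ginv * x)"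
    by (simp_all add: lgen_tens)
qed

lemma lmul_right: "lmul h (right_tens f x) = right_tens (lmul h f) x"
proof (induction h arbitrary: f rule: planck_induct)
  note l = lin_compose[OF lmul(1) lin_right_tens] lin_compose[OF lin_right_tens lmul(1)]
  {
    case p
    show ?case by (rule tens_eq[where f = f])
        (simp_all add: l right_tens lmul_gen lin_add[OF lin_right_tens] mult.assoc)
  next
    case g
    show ?case by (rule tens_eq[where f = f]) (simp_all add: l right_tens lmul_gen mult.assoc)
  next
    case ginv
    show ?case by (rule tens_eq[where f = f]) (simp_all add: l right_tens lmul_gen mult.assoc)
  next
    case (add h k)
    then show ?case by (simp add: lin_add[OF lmul(2)] lin_add[OF lin_right_tens])
  next
    case (scale c h)
    then show ?case by (simp add: lin_scale[OF lmul(2)] lin_scale[OF lin_right_tens])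
  }
qed (simp_all add: lmul)

lemma bilin_lmul: "bilin lmul" and bilin_right_tens: "bilin right_tens"
  by (intro bilinI lmul lin_right_tens lin_right_tens_param)+

text \<open>The forms of the model calculus are \<open>span_tens False\<close>; with \<open>b 0 0\<close>, which
  makes the differential inner, they extend to the bimodule \<open>span_tens True\<close>.\<close>

definition span_b :: "bool \<Rightarrow> (nat \<Rightarrow>\<^sub>0 complex) set"
  where "span_b z = complex_vector.span {b k a | k a. z \<or> k \<noteq> 0 \<or> a \<noteq> 0}"

definition span_tens :: "bool \<Rightarrow> (nat \<Rightarrow>\<^sub>0 'h) set"
  where "span_tens z = complex_vector.span {tens (b k a) x | k a x. z \<or> k \<noteq> 0 \<or> a \<noteq> 0}"

lemma subspace_span_tens [simp]: "complex_vector.subspace (span_tens z)"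
  and subspace_span_b [simp]: "complex_vector.subspace (span_b z)"
  by (simp_all add: span_tens_def span_b_def)

lemma b_in_span: "z \<or> k \<noteq> 0 \<or> a \<noteq> 0 \<Longrightarrow> b k a \<in> span_b z"
  unfolding span_b_def by (rule complex_vector.span_base) blast

lemma tens_b_in_span: "z \<or> k \<noteq> 0 \<or> a \<noteq> 0 \<Longrightarrow> tens (b k a) x \<in> span_tens z"
  unfolding span_tens_def by (rule complex_vector.span_base) blast

lemma span_b_closed:
  assumes "lin f" "\<And>k a. z \<or> k \<noteq> 0 \<or> a \<noteq> 0 \<Longrightarrow> f (b k a) \<in> Y" "complex_vector.subspace Y"
    and "c \<in> span_b z"
  shows "f c \<in> Y"
  by (rule lin_span_closed[OF assms(1) _ assms(3) assms(4)[unfolded span_b_def]])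
    (use assms(2) in auto)

lemma span_tens_closed:
  assumes "lin f" "\<And>k a x. z \<or> k \<noteq> 0 \<or> a \<noteq> 0 \<Longrightarrow> f (tens (b k a) x) \<in> Y" "complex_vector.subspace Y"
    and "v \<in> span_tens z"
  shows "f v \<in> Y"
  by (rule lin_span_closed[OF assms(1) _ assms(3) assms(4)[unfolded span_tens_def]])
    (use assms(2) in auto)

lemma span_tens_eq:
  assumes "lin f" "lin f'" "\<And>k a x. z \<or> k \<noteq> 0 \<or> a \<noteq> 0 \<Longrightarrow> f (tens (b k a) x) = f' (tens (b k a) x)"
    and "v \<in> span_tens z"
  shows "f v = f' v"
  by (rule lin_eq_span[OF assms(1,2) _ assms(4)[unfolded span_tens_def]]) (use assms(3) in auto)

lemma tens_in_span: "c \<in> span_b z \<Longrightarrow> tens c x \<in> span_tens z"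
  by (rule span_b_closed[OF lin_tens_left tens_b_in_span subspace_span_tens])

lemma span_tens_mono: "span_tens z \<subseteq> span_tens True"
  unfolding span_tens_def by (rule complex_vector.span_mono) blast

lemma pact_in_span: "c \<in> span_b z \<Longrightarrow> pact c \<in> span_b z"
  by (rule span_b_closed[OF lin_pact _ subspace_span_b])
    (simp_all add: pact_b complex_vector.subspace_add complex_vector.subspace_scale b_in_span)

text \<open>The vector \<open>b 0 0\<close> is never produced from the others: every correction term
  in \<open>gact_b\<close> has second index \<open>Suc a\<close>. The same holds for
  \<open>hact_b\<close>, so the forms are a submodule.\<close>

lemma gact_b_in_span: "z \<or> k \<noteq> 0 \<or> a \<noteq> 0 \<Longrightarrow> gact (b k a) \<in> span_b z"
proof (induction k arbitrary: a)
  case 0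
  then show ?case
    by (subst gact_b) (simp add: complex_vector.subspace_add b_in_span)
next
  case (Suc k)
  show ?case
    using Suc.IH[of "Suc a"]
    by (subst gact_b) (simp add: complex_vector.subspace_add complex_vector.subspace_scale b_in_span
        del: of_nat_Suc)
qed

lemma hact_b_in_span: "z \<or> k \<noteq> 0 \<or> a \<noteq> 0 \<Longrightarrow> hact (b k a) \<in> span_b z"
proof (induction "height k - a" arbitrary: a)
  case 0
  then show ?case by (simp add: b_zero lin_zero[OF lin_hact] complex_vector.subspace_0)
next
  case (Suc j)
  have "hact (b k a) = b k a - (of_nat k * lam) *\<^sub>C b (k - 1) (Suc a) - hact (b k (Suc a))"
    using hact_b[of k a] by (simp add: lin_add[OF lin_hact] algebra_simps)
  moreover have "hact (b k (Suc a)) \<in> span_b z" using Suc by simp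
  ultimately show ?case
    using Suc.prems by (simp add: complex_vector.subspace_diff complex_vector.subspace_scale b_in_span)
qed

lemma gact_in_span: "c \<in> span_b z \<Longrightarrow> gact c \<in> span_b z"
  and hact_in_span: "c \<in> span_b z \<Longrightarrow> hact c \<in> span_b z"
  by (rule span_b_closed[OF lin_gact gact_b_in_span subspace_span_b]
      span_b_closed[OF lin_hact hact_b_in_span subspace_span_b]; assumption)+

lemma lmul_in_span: "f \<in> span_tens z \<Longrightarrow> lmul h f \<in> span_tens z"
proof (induction h arbitrary: f rule: planck_induct)
  case p
  show ?case
    by (rule span_tens_closed[OF lmul(1) _ subspace_span_tens p])
      (simp add: lmul_gen complex_vector.subspace_add tens_in_span pact_in_span b_in_span)
next
  case g
  show ?case
    by (rule span_tens_closed[OF lmul(1) _ subspace_span_tens g])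
      (simp add: lmul_gen tens_in_span gact_in_span b_in_span)
next
  case ginv
  show ?case
    by (rule span_tens_closed[OF lmul(1) _ subspace_span_tens ginv])
      (simp add: lmul_gen tens_in_span hact_in_span b_in_span)
qed (simp_all add: lmul lin_add[OF lmul(2)] lin_scale[OF lmul(2)] complex_vector.subspace_add
    complex_vector.subspace_scale)

lemma right_in_span: "f \<in> span_tens z \<Longrightarrow> right_tens f x \<in> span_tens z"
  by (rule span_tens_closed[OF lin_right_tens _ subspace_span_tens]) (simp_all add: right_tens tens_b_in_span)

end

text \<open>By \<open>(k choose i) (i choose l) = (k choose l) (k - l choose i - l)\<close> both
  sides are the same sum over the pairs \<open>(l, m)\<close> with \<open>l + m \<le> k\<close>.
  This is the combinatorial content of \<open>lco_coassoc\<close>.\<close>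

lemma triangle_sum_shift:
  fixes T :: "nat \<Rightarrow> nat \<Rightarrow> 'a::complex_vector"
  shows "(\<Sum>i\<le>k. of_nat (k choose i) *\<^sub>C (\<Sum>l\<le>i. of_nat (i choose l) *\<^sub>C T l (i - l)))
    = (\<Sum>l\<le>k. of_nat (k choose l) *\<^sub>C (\<Sum>m\<le>k - l. of_nat ((k - l) choose m) *\<^sub>C T l m))"
proof -
  define G where "G l m = (of_nat (k choose l) * of_nat ((k - l) choose m)) *\<^sub>C T l m" for l m
  have "(\<Sum>i\<le>k. of_nat (k choose i) *\<^sub>C (\<Sum>l\<le>i. of_nat (i choose l) *\<^sub>C T l (i - l)))
      = (\<Sum>i\<le>k. \<Sum>l\<le>i. G l (i - l))"
  proof (intro sum.cong refl)
    fix i assume i: "i \<in> {..k}"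
    have "of_nat (k choose i) * of_nat (i choose l) = (of_nat (k choose l) * of_nat ((k - l) choose (i - l)) :: complex)"
      if "l \<le> i" for l
      using choose_mult[OF that, of k] i by (metis atMost_iff of_nat_mult)
    then show "of_nat (k choose i) *\<^sub>C (\<Sum>l\<le>i. of_nat (i choose l) *\<^sub>C T l (i - l)) = (\<Sum>l\<le>i. G l (i - l))"
      by (simp add: G_def complex_vector.scale_sum_right scaleC_scaleC)
  qed
  also have "\<dots> = (\<Sum>(l, m)\<in>{(l, m). l + m \<le> k}. G l m)"
    by (rule sum.triangle_reindex_eq[symmetric])
  also have "{(l, m). l + m \<le> k} = Sigma {..k} (\<lambda>l. {..k - l})" by auto
  also have "(\<Sum>(l, m)\<in>Sigma {..k} (\<lambda>l. {..k - l}). G l m) = (\<Sum>l\<le>k. \<Sum>m\<le>k - l. G l m)"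
    by (rule sum.Sigma[symmetric]) auto
  finally show ?thesis by (simp add: G_def complex_vector.scale_sum_right scaleC_scaleC)
qed

lemma tassoc_pure: "tassoc (s \<otimes> z) = tlift (\<lambda>x y. x \<otimes> (y \<otimes> z)) s"
  unfolding tensor_assoc_UNIV by (rule tlift_pure[OF bilin_assoc(2)])

lemma lin_tassoc: "lin tassoc"
  unfolding tensor_assoc_UNIV by (rule lin_tlift[OF bilin_assoc(2)])

section \<open>The coactions of the model and their compatibility with the actions\<close>

context planck_model
begin

lemma lin_tens': "lin f \<Longrightarrow> lin (\<lambda>x. tens c (f x))"
  by (rule lin_compose[OF lin_tens_right])

lemmas model_lin = hopf_lin lin_tens'

text \<open>The element \<open>u \<otimes> (c \<otimes> 1)\<close> multiplied from the right by
  \<open>\<Delta> x\<close>.\<close>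

definition lterm :: "'h \<Rightarrow> (nat \<Rightarrow>\<^sub>0 complex) \<Rightarrow> 'h \<Rightarrow> ('h, nat \<Rightarrow>\<^sub>0 'h) tensor"
  where "lterm u c x = tlift (\<lambda>y z. (u * y) \<otimes> tens c z) (\<Delta> x)"

lemma bilin_lterm: "bilin (\<lambda>y z. (u * y) \<otimes> tens c (z :: 'h))" for u :: 'h by (intro model_lin)

lemma lin_lterm: "lin (lterm u c)"
  unfolding lterm_def by (intro model_lin)

lemma lterm_one: "lterm u c 1 = u \<otimes> tens c 1"
  by (simp add: lterm_def sweedler_one[OF bilin_lterm])

text \<open>On \<open>b k a \<otimes> 1\<close> this is the formula that \<open>lcoact_w\<close>
  forces; the rest is dictated by compatibility with right multiplication.\<close>

definition lco_basis :: "nat \<Rightarrow> 'h \<Rightarrow> ('h, nat \<Rightarrow>\<^sub>0 'h) tensor"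
  where "lco_basis n x = (case prod_decode n of (k, a) \<Rightarrow> if a < height k
    then \<Sum>i\<le>k. of_nat (k choose i) *\<^sub>C lterm (pf i * ginv ^ k) (b (k - i) (a + i)) x else 0)"

definition lco :: "(nat \<Rightarrow>\<^sub>0 'h) \<Rightarrow> ('h, nat \<Rightarrow>\<^sub>0 'h) tensor"
  where "lco = coordinate_sum lco_basis"

definition rco :: "(nat \<Rightarrow>\<^sub>0 'h) \<Rightarrow> (nat \<Rightarrow>\<^sub>0 'h, 'h) tensor"
  where "rco = coordinate_sum (\<lambda>n x. tlift (\<lambda>y z. Poly_Mapping.single n y \<otimes> z) (\<Delta> x))"

lemma lin_lco_basis: "lin (lco_basis n)"
proof -
  obtain k a where n: "prod_decode n = (k, a)" by (cases "prod_decode n")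
  show ?thesis
    unfolding lco_basis_def n prod.case
    by (cases "a < height k") (simp_all add: lin_sum_fun lin_scaleC lin_lterm lin_const0)
qed

lemma lin_lco: "lin lco" unfolding lco_def by (rule lin_coordinate_sum[OF lin_lco_basis])

lemma lin_rco_aux: "lin (\<lambda>x :: 'h. tlift (\<lambda>y z. Poly_Mapping.single n y \<otimes> z) (\<Delta> x))"
  by (intro model_lin lin_single)

lemma lin_rco: "lin rco"
  unfolding rco_def by (rule lin_coordinate_sum[OF lin_rco_aux])

lemma rco_tens: "rco (tens c x) = tlift (\<lambda>y z. tens c y \<otimes> z) (\<Delta> x)"
  unfolding rco_def
  by (rule coordinate_sum_tens[OF lin_rco_aux])
    (simp_all add: tens_single lin_tlift_param lin_tensor_left lin_tensor_right lin_id lin_tens_left lin_tens_right)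

text \<open>Repeated \<open>height_step\<close>. It makes every term of the coaction formula vanish
  where \<open>b k a\<close> does, so \<open>lco_tens\<close> needs no condition on
  \<open>a\<close>.\<close>

lemma height_shift: "height k \<le> a \<Longrightarrow> i \<le> k \<Longrightarrow> height (k - i) \<le> a + i"
proof (induction i)
  case (Suc i)
  then show ?case using height_step[of "k - Suc i"] by (simp add: Suc_diff_Suc)
qed simp

lemma lco_tens: "lco (tens (b k a) x)
    = (\<Sum>i\<le>k. of_nat (k choose i) *\<^sub>C lterm (pf i * ginv ^ k) (b (k - i) (a + i)) x)"
proof (cases "a < height k")
  case True
  then show ?thesis
    by (simp add: b_def[of k a] tens_single lco_def coordinate_sum_single[of lco_basis, OF lin_lco_basis] lco_basis_def)
next
  case False
  have "lterm u 0 x = 0" for u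
  proof -
    have "(\<lambda>y z :: 'h. (u * y) \<otimes> tens 0 z) = (\<lambda>y z. 0)"
      by (simp add: tens_simps pure_tensor_simps)
    then show ?thesis
      using lin_tlift_push[OF lin_scaleC[OF lin_id, of 0] bilin_lterm, of u 0 "\<Delta> x"]
      by (simp add: lterm_def)
  qed
  with False show ?thesis
    by (simp add: height_shift b_zero tens_simps lin_zero[OF lin_lco])
qed

lemma bilin_star: "bilin ((*) :: 'h \<Rightarrow> 'h \<Rightarrow> 'h)" by (intro lin_intros)

text \<open>Members 1 to 3 belong to the left coaction and left action, 4 to 6 to the left coaction
  and right action, 7 to 9 to the right coaction and left action, 10 to 12 to the right coaction and
  right action.\<close>

lemmas tm = bilin_tmult[OF bilin_star bilin_lmul] bilin_tmult[OF bilin_star bilin_right_tens]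
  bilin_tmult[OF bilin_lmul bilin_star] bilin_tmult[OF bilin_right_tens bilin_star]

lemmas ml_lin = lin_simps[OF bilin_lin(1)[OF tm(1)]] lin_simps[OF bilin_lin(2)[OF tm(1)]]
  and mr_lin = lin_simps[OF bilin_lin(1)[OF tm(4)]] lin_simps[OF bilin_lin(2)[OF tm(4)]]
  and nl_lin = lin_simps[OF bilin_lin(1)[OF tm(7)]] lin_simps[OF bilin_lin(2)[OF tm(7)]]

lemma lterm_mult: "lterm u c (y * x) = tmult (*) right_tens (lterm u c y) (\<Delta> x)"
  unfolding lterm_def sweedler_mult[OF bilin_lterm] lin_tlift_push[OF bilin_lin(2)[OF tm(4)] bilin_lterm]
  by (simp add: tm(5) right_tens mult.assoc)

lemma lco_right: "f \<in> span_tens True \<Longrightarrow> lco (right_tens f x) = tmult (*) right_tens (lco f) (\<Delta> x)"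
  by (rule span_tens_eq[OF lin_compose[OF lin_lco lin_right_tens] lin_compose[OF bilin_lin(2)[OF tm(4)] lin_lco]])
    (simp_all add: right_tens lco_tens lterm_mult mr_lin)

lemma rco_right: "rco (right_tens f x) = tmult right_tens (*) (rco f) (\<Delta> x)"
proof (rule tens_eq[OF lin_compose[OF lin_rco lin_right_tens] lin_compose[OF bilin_lin(2)[OF tm(10)] lin_rco]])
  fix c and y :: 'h
  have b: "bilin (\<lambda>y z. tens c y \<otimes> (z :: 'h))" by (intro bilinI lin_tensor_left lin_tensor_right lin_id lin_tens_right)
  show "rco (right_tens (tens c y) x) = tmult right_tens (*) (rco (tens c y)) (\<Delta> x)"
    unfolding right_tens rco_tens sweedler_mult[OF b] lin_tlift_push[OF bilin_lin(2)[OF tm(10)] b]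
    by (simp add: tm(11) right_tens)
qed

lemma lmul_b_one:
  "lmul p (tens (b k a) 1) = right_tens (tens (b (Suc k) a) 1) g
    + (of_nat k * lam) *\<^sub>C right_tens (tens (b k a) 1) g + right_tens (tens (b k a) 1) p"
  "lmul g (tens (b k a) 1) = (of_nat k * lam) *\<^sub>C lmul g (tens (b (k - 1) (Suc a)) 1)
    + (right_tens (tens (b k a) 1) g + right_tens (tens (b k (Suc a)) 1) g)"
  by (simp_all only: lmul_gen right_tens pact_b tens_simps mult_1_left mult_1_right)
    (subst gact_b, simp only: tens_simps)

lemma lco_b_one: "lco (tens (b k a) 1)
    = (\<Sum>i\<le>k. of_nat (k choose i) *\<^sub>C ((pf i * ginv ^ k) \<otimes> tens (b (k - i) (a + i)) 1))"
  by (simp add: lco_tens lterm_one)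

text \<open>\<open>tens (b k a) y\<close> is a right multiple of \<open>tens (b k a) 1\<close>, and
  left and right actions commute. So the compatibility with left multiplication by \<open>x\<close>
  only has to be checked on the invariant generators.\<close>

lemma lco_left_one:
  assumes "\<And>k a. lco (lmul x (tens (b k a) 1)) = tmult (*) lmul (\<Delta> x) (lco (tens (b k a) 1))"
    and "f \<in> span_tens True"
  shows "lco (lmul x f) = tmult (*) lmul (\<Delta> x) (lco f)"
proof (rule span_tens_eq[OF lin_compose[OF lin_lco lmul(1)] lin_compose[OF bilin_lin(1)[OF tm(1)] lin_lco] _ assms(2)])
  fix k a and y :: 'h
  let ?w = "tens (b k a) (1 :: 'h)"
  have w: "?w \<in> span_tens True" by (rule tens_b_in_span) simp
  have y: "tens (b k a) y = right_tens ?w y" by (simp add: right_tens)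
  have "lco (lmul x (right_tens ?w y)) = tmult (*) right_tens (lco (lmul x ?w)) (\<Delta> y)"
    by (simp add: lmul_right lco_right lmul_in_span w)
  also have "\<dots> = tmult (*) lmul (\<Delta> x) (tmult (*) right_tens (lco ?w) (\<Delta> y))"
    unfolding assms(1)
    by (rule tmult_assoc[symmetric]) (simp_all add: bilin_star bilin_lmul bilin_right_tens mult.assoc lmul_right)
  also have "\<dots> = tmult (*) lmul (\<Delta> x) (lco (right_tens ?w y))"
    by (simp add: lco_right w)
  finally show "lco (lmul x (tens (b k a) y)) = tmult (*) lmul (\<Delta> x) (lco (tens (b k a) y))"
    unfolding y .
qed

lemma lco_left_p: "f \<in> span_tens True \<Longrightarrow> lco (lmul p f) = tmult (*) lmul (\<Delta> p) (lco f)"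
proof (rule lco_left_one)
  fix k a
  let ?W = "\<lambda>k a. tens (b k a) (1 :: 'h)"
  have W: "?W k a \<in> span_tens True" for k a by (rule tens_b_in_span) simp
  have "lco (lmul p (?W k a)) = tmult (*) right_tens (lco (?W (Suc k) a)) (\<Delta> g)
      + (of_nat k * lam) *\<^sub>C tmult (*) right_tens (lco (?W k a)) (\<Delta> g)
      + tmult (*) right_tens (lco (?W k a)) (\<Delta> p)"
    unfolding lmul_b_one(1) by (simp only: lin_simps[OF lin_lco] lco_right[OF W])
  also have "\<dots> = (\<Sum>i\<le>Suc k. of_nat (Suc k choose i) *\<^sub>C ((pf i * ginv ^ Suc k * g)
        \<otimes> right_tens (?W (Suc k - i) (a + i)) g))
      + (of_nat k * lam) *\<^sub>C (\<Sum>i\<le>k. of_nat (k choose i) *\<^sub>C ((pf i * ginv ^ k * g)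
        \<otimes> right_tens (?W (k - i) (a + i)) g))
      + (\<Sum>i\<le>k. of_nat (k choose i) *\<^sub>C ((pf i * ginv ^ k * p) \<otimes> right_tens (?W (k - i) (a + i)) g
        + (pf i * ginv ^ k) \<otimes> right_tens (?W (k - i) (a + i)) p))"
    unfolding lco_b_one comult_g comult_p
    by (simp only: mr_lin tm(6) mult_1_right sum.distrib scaleC_add_right)
  also have "\<dots> = (\<Sum>i\<le>k. of_nat (k choose i) *\<^sub>C ((p * (pf i * ginv ^ k)) \<otimes> lmul g (?W (k - i) (a + i))
      + (pf i * ginv ^ k) \<otimes> lmul p (?W (k - i) (a + i))))"
  proof (rule coaction_p_identity[symmetric])
    fix i assume "i \<le> k"
    show "lmul g (?W (k - i) (a + i)) = (of_nat (k - i) * lam) *\<^sub>C lmul g (?W (k - Suc i) (a + Suc i))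
        + (right_tens (?W (k - i) (a + i)) g + right_tens (?W (Suc k - Suc i) (a + Suc i)) g)"
      by (subst lmul_b_one(2)) simp
    show "lmul p (?W (k - i) (a + i)) = right_tens (?W (Suc k - i) (a + i)) g
        + (of_nat (k - i) * lam) *\<^sub>C right_tens (?W (k - i) (a + i)) g + right_tens (?W (k - i) (a + i)) p"
      using \<open>i \<le> k\<close> by (simp add: lmul_b_one(1) Suc_diff_le)
  qed
  also have "\<dots> = tmult (*) lmul (\<Delta> p) (lco (?W k a))"
    unfolding lco_b_one comult_p
    by (simp only: ml_lin tm(3) mult_1_left sum.distrib scaleC_add_right)
  finally show "lco (lmul p (?W k a)) = tmult (*) lmul (\<Delta> p) (lco (?W k a))" .
qed

lemma lco_left_g: "f \<in> span_tens True \<Longrightarrow> lco (lmul g f) = tmult (*) lmul (\<Delta> g) (lco f)"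
proof (rule lco_left_one)
  let ?W = "\<lambda>k a. tens (b k a) (1 :: 'h)"
  have W: "?W k a \<in> span_tens True" for k a by (rule tens_b_in_span) simp
  \<comment> \<open>On \<open>(1 - lam low)\<close> of a basis vector, \<open>g\<close> acts without
    recursion and \<open>coaction_g_identity\<close> applies. The induction on \<open>k\<close>
    below then removes the lowered term.\<close>
  have y: "lco (lmul g (?W k a - (of_nat k * lam) *\<^sub>C ?W (k - 1) (Suc a)))
      = tmult (*) lmul (\<Delta> g) (lco (?W k a - (of_nat k * lam) *\<^sub>C ?W (k - 1) (Suc a)))" for k a
  proof -
    have "lmul g (?W k a - (of_nat k * lam) *\<^sub>C ?W (k - 1) (Suc a))
        = right_tens (?W k a) g + right_tens (?W k (Suc a)) g"
      by (simp add: lin_simps[OF lmul(1)]) (subst lmul_b_one(2), simp)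
    then have "lco (lmul g (?W k a - (of_nat k * lam) *\<^sub>C ?W (k - 1) (Suc a)))
        = (\<Sum>i\<le>k. of_nat (k choose i) *\<^sub>C ((pf i * ginv ^ k * g)
          \<otimes> (right_tens (?W (k - i) (a + i)) g + right_tens (?W (k - i) (Suc a + i)) g)))"
      by (simp only: lin_simps[OF lin_lco] lco_right[OF W] lco_b_one comult_g mr_lin tm(6)
          sum.distrib[symmetric] scaleC_add_right[symmetric] pure_tensor_simps)
    also have "\<dots> = (\<Sum>i\<le>k. of_nat (k choose i) *\<^sub>C ((g * (pf i * ginv ^ k)) \<otimes> lmul g (?W (k - i) (a + i))))
        - (of_nat k * lam) *\<^sub>C (\<Sum>i\<le>k - 1. of_nat (k - 1 choose i) *\<^sub>C
          ((g * (pf i * ginv ^ (k - 1))) \<otimes> lmul g (?W (k - Suc i) (a + Suc i))))"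
    proof (rule coaction_g_identity[symmetric])
      fix i
      show "lmul g (?W (k - i) (a + i)) = (of_nat (k - i) * lam) *\<^sub>C lmul g (?W (k - Suc i) (a + Suc i))
        + (right_tens (?W (k - i) (a + i)) g + right_tens (?W (k - i) (Suc a + i)) g)"
        by (subst lmul_b_one(2)) simp
    qed
    also have "\<dots> = tmult (*) lmul (\<Delta> g) (lco (?W k a - (of_nat k * lam) *\<^sub>C ?W (k - 1) (Suc a)))"
      unfolding comult_g lin_simps[OF lin_lco] lco_b_one by (simp only: ml_lin tm(3)) simp
    finally show ?thesis .
  qed
  show "lco (lmul g (?W k a)) = tmult (*) lmul (\<Delta> g) (lco (?W k a))" for k a
  proof (induction k arbitrary: a)
    case 0
    then show ?case using y[of 0 a] by simp
  next
    case (Suc k)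
    then show ?case
      using y[of "Suc k" a]
      by (simp only: lin_simps[OF lmul(1)] lin_simps[OF lin_lco] ml_lin diff_Suc_1) simp
  qed
qed

lemma lco_left: "f \<in> span_tens True \<Longrightarrow> lco (lmul x f) = tmult (*) lmul (\<Delta> x) (lco f)"
proof (induction x arbitrary: f rule: planck_induct)
  have unit: "tmult (*) lmul (1 \<otimes> 1) t = t" for t :: "('h, nat \<Rightarrow>\<^sub>0 'h) tensor"
    unfolding tm(2) by (simp add: lmul(4) tlift_tensor)
  {
    case one
    show ?case by (simp add: comult_one lmul(4) unit)
  next
    case p
    then show ?case by (rule lco_left_p)
  next
    case g
    then show ?case by (rule lco_left_g)
  next
    \<comment> \<open>Since \<open>\<Delta> ginv\<close> inverts \<open>\<Delta> g\<close>, this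
      case is the one for \<open>g\<close> applied to \<open>lmul ginv f\<close> and solved.\<close>
    case ginv
    have "lmul g (lmul ginv f) = f" unfolding lmul(3)[symmetric] g_ginv lmul(4) ..
    then have "lco f = tmult (*) lmul (\<Delta> g) (lco (lmul ginv f))"
      using lco_left_g[OF lmul_in_span[OF ginv, of ginv]] by simp
    then have "tmult (*) lmul (\<Delta> ginv) (lco f)
        = tmult (*) lmul (ginv \<otimes> ginv) (tmult (*) lmul (g \<otimes> g) (lco (lmul ginv f)))"
      by (simp add: comult_g comult_ginv)
    also have "\<dots> = tmult (*) lmul (tmult (*) (*) (ginv \<otimes> ginv) (g \<otimes> g)) (lco (lmul ginv f))"
      by (rule tmult_assoc) (simp_all add: bilin_star bilin_lmul lmul(3) mult.assoc)
    also have "\<dots> = lco (lmul ginv f)"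
      by (simp add: bilin_tmult(3)[OF bilin_star bilin_star] ginv_g unit)
    finally show ?case by simp
  next
    case (mult x y)
    have "tmult (*) lmul (\<Delta> (x * y)) (lco f) = tmult (*) lmul (\<Delta> x) (tmult (*) lmul (\<Delta> y) (lco f))"
      unfolding comult_mult
      by (rule tmult_assoc[symmetric]) (simp_all add: bilin_star bilin_lmul lmul(3) mult.assoc)
    with mult show ?case by (simp add: lmul(3) lmul_in_span)
  next
    case (add x y)
    then show ?case by (simp add: lin_add[OF lmul(2)] lin_add[OF lin_lco] lin_add[OF linear_comult] ml_lin)
  next
    case (scale c x)
    then show ?case by (simp add: lin_scale[OF lmul(2)] lin_scale[OF lin_lco] lin_scale[OF linear_comult] ml_lin)
  }
qed

lemma rco_one: "rco (tens c 1) = tens c 1 \<otimes> 1"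
proof -
  have b: "bilin (\<lambda>y z. tens c y \<otimes> (z :: 'h))" by (intro bilinI lin_tensor_left lin_tensor_right lin_id lin_tens_right)
  show ?thesis by (simp add: rco_tens sweedler_one[OF b])
qed

lemma rco_left_one:
  assumes "\<And>c. rco (lmul x (tens c 1)) = tmult lmul (*) (\<Delta> x) (tens c 1 \<otimes> 1)"
  shows "rco (lmul x f) = tmult lmul (*) (\<Delta> x) (rco f)"
proof (rule tens_eq[OF lin_compose[OF lin_rco lmul(1)] lin_compose[OF bilin_lin(1)[OF tm(7)] lin_rco]])
  fix c and y :: 'h
  let ?w = "tens c (1 :: 'h)"
  have y: "tens c y = right_tens ?w y" by (simp add: right_tens)
  have "rco (lmul x (right_tens ?w y)) = tmult right_tens (*) (rco (lmul x ?w)) (\<Delta> y)"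
    by (simp add: lmul_right rco_right)
  also have "\<dots> = tmult lmul (*) (\<Delta> x) (tmult right_tens (*) (rco ?w) (\<Delta> y))"
    unfolding assms rco_one
    by (rule tmult_assoc[symmetric]) (simp_all add: bilin_star bilin_lmul bilin_right_tens mult.assoc lmul_right)
  also have "\<dots> = tmult lmul (*) (\<Delta> x) (rco (right_tens ?w y))"
    by (simp add: rco_right)
  finally show "rco (lmul x (tens c y)) = tmult lmul (*) (\<Delta> x) (rco (tens c y))"
    unfolding y .
qed

lemma rco_grouplike: assumes "\<Delta> x = x \<otimes> x" shows "rco (tens c x) = tens c x \<otimes> x"
  unfolding rco_tens assms
  by (rule tlift_pure) (intro bilinI lin_tensor_left lin_tensor_right lin_id lin_tens_right)

lemma rco_p: "rco (tens c p) = tens c p \<otimes> g + tens c 1 \<otimes> p"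
proof -
  have b: "bilin (\<lambda>y z. tens c y \<otimes> (z :: 'h))" by (intro bilinI lin_tensor_left lin_tensor_right lin_id lin_tens_right)
  show ?thesis by (simp add: rco_tens comult_p lin_add[OF lin_tlift[OF b]] tlift_pure[OF b])
qed

lemma rco_left: "rco (lmul x f) = tmult lmul (*) (\<Delta> x) (rco f)"
proof (induction x arbitrary: f rule: planck_induct)
  case one
  show ?case by (simp add: comult_one lmul(4) tm(8) tlift_tensor)
next
  case p
  show ?case
    by (rule rco_left_one)
      (simp add: comult_p nl_lin tm(9) lmul_gen lmul(4) lin_add[OF lin_rco] rco_p rco_grouplike[OF comult_g]
        pure_tensor_simps)
next
  case g
  show ?case by (rule rco_left_one) (simp add: comult_g tm(9) lmul_gen rco_grouplike[OF comult_g])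
next
  case ginv
  show ?case by (rule rco_left_one) (simp add: comult_ginv tm(9) lmul_gen rco_grouplike[OF comult_ginv])
next
  case (mult x y)
  have "tmult lmul (*) (\<Delta> (x * y)) (rco f) = tmult lmul (*) (\<Delta> x) (tmult lmul (*) (\<Delta> y) (rco f))"
    unfolding comult_mult
    by (rule tmult_assoc[symmetric]) (simp_all add: bilin_star bilin_lmul lmul(3) mult.assoc)
  with mult show ?case by (simp add: lmul(3))
next
  case (add x y)
  then show ?case by (simp add: lin_add[OF lmul(2)] lin_add[OF lin_rco] lin_add[OF linear_comult] nl_lin)
next
  case (scale c x)
  then show ?case by (simp add: lin_scale[OF lmul(2)] lin_scale[OF lin_rco] lin_scale[OF linear_comult] nl_lin)
qed

end

section \<open>Counits, coassociativity and commutation of the coactions\<close>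

lemma tlift_diff_fun:
  assumes B: "bilin B" and C: "bilin C"
  shows "tlift (\<lambda>x y. B x y - C x y) t = tlift B t - tlift C t"
proof -
  have p: "bilin (\<lambda>x y. B x y - C x y)"
    by (intro bilinI lin_subtract bilin_lin[OF B] bilin_lin[OF C])
  show ?thesis
    by (rule lin_tensor_eq[where t = t, OF lin_tlift[OF p] lin_subtract[OF lin_tlift[OF B] lin_tlift[OF C]]])
      (simp add: tlift_pure[OF p] tlift_pure[OF B] tlift_pure[OF C])
qed

lemma tlift_sum_fun:
  assumes B: "\<And>i. i \<in> A \<Longrightarrow> bilin (B i)"
  shows "tlift (\<lambda>x y. \<Sum>i\<in>A. c i *\<^sub>C B i x y) t = (\<Sum>i\<in>A. c i *\<^sub>C tlift (B i) t)"
proof -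
  have p: "bilin (\<lambda>x y. \<Sum>i\<in>A. c i *\<^sub>C B i x y)"
    by (intro bilinI lin_sum_fun lin_scaleC bilin_lin[OF B])
  have q: "lin (\<lambda>t. \<Sum>i\<in>A. c i *\<^sub>C tlift (B i) t)"
    by (intro lin_sum_fun lin_scaleC lin_tlift[OF B])
  show ?thesis
    by (rule lin_tensor_eq[where t = t, OF lin_tlift[OF p] q])
      (simp add: tlift_pure[OF p] tlift_pure[OF B])
qed

lemma tmap_tlift:
  assumes "lin f" "lin k" "bilin B"
  shows "tmap f k (tlift B t) = tlift (\<lambda>x y. tmap f k (B x y)) t"
  by (rule lin_tlift_push[OF lin_tensor_map[OF assms(1,2)] assms(3)])

context planck_model
begin

lemma bilin_rterm: "bilin (\<lambda>y z. tens c y \<otimes> (z :: 'h))"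
  by (intro bilinI lin_tensor_left lin_tensor_right lin_id lin_tens_right)

lemma lco_counit:
  assumes "f \<in> span_tens True" shows "tlift (\<lambda>h \<eta>. \<epsilon> h *\<^sub>C \<eta>) (lco f) = f"
proof -
  have e: "bilin (\<lambda>h \<eta>. \<epsilon> h *\<^sub>C (\<eta> :: nat \<Rightarrow>\<^sub>0 'h))" by (intro hopf_lin)
  have l: "tlift (\<lambda>h \<eta>. \<epsilon> h *\<^sub>C \<eta>) (lterm u c x) = \<epsilon> u *\<^sub>C tens c x" for u c x
  proof -
    have b: "bilin (\<lambda>a z. \<epsilon> a *\<^sub>C tens c (z :: 'h))" by (intro model_lin)
    have "tlift (\<lambda>h \<eta>. \<epsilon> h *\<^sub>C \<eta>) (lterm u c x) = tlift (\<lambda>y z. \<epsilon> u *\<^sub>C (\<epsilon> y *\<^sub>C tens c z)) (\<Delta> x)"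
      unfolding lterm_def lin_tlift_push[OF lin_tlift[OF e] bilin_lterm]
      by (simp add: tlift_pure[OF e] counit_mult scaleC_scaleC)
    also have "\<dots> = \<epsilon> u *\<^sub>C tlift (\<lambda>y z. \<epsilon> y *\<^sub>C tens c z) (\<Delta> x)"
      by (rule lin_tlift_push[OF lin_scaleC[OF lin_id] b, symmetric])
    finally show ?thesis by (simp add: sweedler_counit_left lin_tens_right)
  qed
  show ?thesis
  proof (rule span_tens_eq[OF lin_compose[OF lin_tlift[OF e] lin_lco] lin_id _ assms])
    fix k a x
    have "tlift (\<lambda>h \<eta>. \<epsilon> h *\<^sub>C \<eta>) (lco (tens (b k a) x))
        = (\<Sum>i\<le>k. if i = 0 then tens (b k a) x else 0)"
      unfolding lco_tens lin_simps[OF lin_tlift[OF e]] l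
      by (intro sum.cong refl) (simp add: counit_mult counit_pf counit_ginv_power)
    then show "tlift (\<lambda>h \<eta>. \<epsilon> h *\<^sub>C \<eta>) (lco (tens (b k a) x)) = tens (b k a) x" by simp
  qed
qed

lemma rco_counit: "tlift (\<lambda>\<eta> h. \<epsilon> h *\<^sub>C \<eta>) (rco f) = f"
proof -
  have e: "bilin (\<lambda>\<eta> h. \<epsilon> h *\<^sub>C (\<eta> :: nat \<Rightarrow>\<^sub>0 'h))" by (intro hopf_lin)
  show ?thesis
  proof (rule tens_eq[where f = f, OF lin_compose[OF lin_tlift[OF e] lin_rco] lin_id])
    fix c and x :: 'h
    show "tlift (\<lambda>\<eta> h. \<epsilon> h *\<^sub>C \<eta>) (rco (tens c x)) = tens c x"
      unfolding rco_tens lin_tlift_push[OF lin_tlift[OF e] bilin_rterm] tlift_pure[OF e]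
      by (rule sweedler_counit_right[OF lin_tens_right])
  qed
qed

lemma rco_coassoc: "tassoc (tmap rco id (rco f)) = tmap id \<Delta> (rco f)"
proof -
  have l: "lin (\<lambda>f. tassoc (tmap rco id (rco f)))" "lin (\<lambda>f. tmap id \<Delta> (rco f))"
    by (rule lin_compose[OF lin_tassoc lin_compose[OF lin_tensor_map[OF lin_rco lin_id'] lin_rco]]
        lin_compose[OF lin_tensor_map[OF lin_id' linear_comult] lin_rco])+
  show ?thesis
  proof (rule tens_eq[where f = f, OF l])
    fix c and x :: 'h
    have A: "tassoc (rco (tens c y) \<otimes> z) = tlift (\<lambda>s t. tens c s \<otimes> (t \<otimes> z)) (\<Delta> y)" for y z :: 'h
      unfolding tassoc_pure rco_tens lin_tlift_push[OF lin_tlift[OF bilin_assoc(1)] bilin_rterm]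
      by (simp add: tlift_pure[OF bilin_assoc(1)])
    have B: "tens c y \<otimes> \<Delta> z = tlift (\<lambda>s t. tens c y \<otimes> (s \<otimes> t)) (\<Delta> z)" for y z :: 'h
      using lin_tlift_push[OF lin_pure_right[of "tens c y"] bilin_pure_tensor, of "\<Delta> z"]
      by (simp add: tlift_tensor)
    have "tassoc (tmap rco id (rco (tens c x))) = tlift (\<lambda>y z. tassoc (rco (tens c y) \<otimes> z)) (\<Delta> x)"
      unfolding rco_tens[of c x]
      by (simp add: lin_tlift_push[OF lin_compose[OF lin_tassoc lin_tensor_map[OF lin_rco lin_id']] bilin_rterm]
          tensor_map_pure[OF lin_rco lin_id'])
    also have "\<dots> = tlift (\<lambda>y z. tens c y \<otimes> \<Delta> z) (\<Delta> x)"
      unfolding A B by (rule sweedler_coassoc) (intro model_lin lin_compose[OF lin_tens_right])+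
    also have "\<dots> = tmap id \<Delta> (rco (tens c x))"
      unfolding rco_tens tmap_tlift[OF lin_id' linear_comult bilin_rterm]
      by (simp add: tensor_map_pure[OF lin_id' linear_comult])
    finally show "tassoc (tmap rco id (rco (tens c x))) = tmap id \<Delta> (rco (tens c x))" .
  qed
qed

text \<open>Both sides consist of terms \<open>(u * x\<^sub>1) \<otimes> (tens c x\<^sub>2 \<otimes>
  x\<^sub>3)\<close>; they differ only in which leg of \<open>\<Delta> x\<close> is split
  again.\<close>

lemma co_commute:
  assumes "f \<in> span_tens True" shows "tassoc (tmap lco id (rco f)) = tmap id rco (lco f)"
proof -
  have l: "lin (\<lambda>f. tassoc (tmap lco id (rco f)))" "lin (\<lambda>f. tmap id rco (lco f))"
    by (rule lin_compose[OF lin_tassoc lin_compose[OF lin_tensor_map[OF lin_lco lin_id'] lin_rco]]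
        lin_compose[OF lin_tensor_map[OF lin_id' lin_rco] lin_lco])+
  show ?thesis
  proof (rule span_tens_eq[OF l _ assms])
    fix k a x
    let ?u = "\<lambda>i. pf i * ginv ^ k" and ?c = "\<lambda>i. b (k - i) (a + i)"
    let ?n = "\<lambda>i. of_nat (k choose i)"
    have A: "tassoc (lterm u c y \<otimes> z) = tlift (\<lambda>s t. (u * s) \<otimes> (tens c t \<otimes> z)) (\<Delta> y)" for u c and y z :: 'h
      unfolding tassoc_pure lterm_def lin_tlift_push[OF lin_tlift[OF bilin_assoc(1)] bilin_lterm]
      by (simp add: tlift_pure[OF bilin_assoc(1)])
    have A': "tassoc (lco (tens (b k a) y) \<otimes> z)
        = (\<Sum>i\<le>k. ?n i *\<^sub>C tlift (\<lambda>s t. (?u i * s) \<otimes> (tens (?c i) t \<otimes> z)) (\<Delta> y))" for y z :: 'h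
      unfolding lco_tens pure_tensor_simps lin_simps[OF lin_tassoc] A ..
    have bA: "bilin (\<lambda>y z. tlift (\<lambda>s t. (u * s) \<otimes> (tens c t \<otimes> (z :: 'h))) (\<Delta> y))" for u :: 'h and c
      by (intro model_lin)
    have "tassoc (tmap lco id (rco (tens (b k a) x)))
        = tlift (\<lambda>y z. tassoc (lco (tens (b k a) y) \<otimes> z)) (\<Delta> x)"
      unfolding rco_tens
      by (simp add: lin_tlift_push[OF lin_compose[OF lin_tassoc lin_tensor_map[OF lin_lco lin_id']] bilin_rterm]
          tensor_map_pure[OF lin_lco lin_id'])
    also have "\<dots> = (\<Sum>i\<le>k. ?n i *\<^sub>C tlift (\<lambda>y z. tlift (\<lambda>s t. (?u i * s) \<otimes> (tens (?c i) t \<otimes> z)) (\<Delta> y)) (\<Delta> x))"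
      unfolding A' by (rule tlift_sum_fun[OF bA])
    also have "\<dots> = (\<Sum>i\<le>k. ?n i *\<^sub>C tlift (\<lambda>y z. (?u i * y) \<otimes> rco (tens (?c i) z)) (\<Delta> x))"
    proof (intro sum.cong refl arg_cong[where f = "\<lambda>v. _ *\<^sub>C v"])
      fix i
      have "(u * y) \<otimes> rco (tens c z) = tlift (\<lambda>s t. (u * y) \<otimes> (tens c s \<otimes> t)) (\<Delta> z)" for u y z :: 'h and c
        unfolding rco_tens by (rule lin_tlift_push[OF lin_pure_right bilin_rterm])
      moreover have "tlift (\<lambda>y z :: 'h. tlift (\<lambda>s t :: 'h. (u * s) \<otimes> (tens c t \<otimes> z)) (\<Delta> y)) (\<Delta> x)
          = tlift (\<lambda>y z. tlift (\<lambda>s t. (u * y) \<otimes> (tens c s \<otimes> t)) (\<Delta> z)) (\<Delta> x)" for u c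
        by (rule sweedler_coassoc) (intro model_lin)+
      ultimately show "tlift (\<lambda>y z. tlift (\<lambda>s t. (?u i * s) \<otimes> (tens (?c i) t \<otimes> z)) (\<Delta> y)) (\<Delta> x)
          = tlift (\<lambda>y z. (?u i * y) \<otimes> rco (tens (?c i) z)) (\<Delta> x)" by simp
    qed
    also have "\<dots> = tmap id rco (lco (tens (b k a) x))"
      unfolding lco_tens lin_simps[OF lin_tensor_map[OF lin_id' lin_rco]] lterm_def
        tmap_tlift[OF lin_id' lin_rco bilin_lterm]
      by (simp add: tensor_map_pure[OF lin_id' lin_rco])
    finally show "tassoc (tmap lco id (rco (tens (b k a) x))) = tmap id rco (lco (tens (b k a) x))" .
  qed
qed

lemma lco_coassoc:
  assumes "f \<in> span_tens True" shows "tassoc (tmap \<Delta> id (lco f)) = tmap id lco (lco f)"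
proof -
  have l: "lin (\<lambda>f. tassoc (tmap \<Delta> id (lco f)))" "lin (\<lambda>f. tmap id lco (lco f))"
    by (rule lin_compose[OF lin_tassoc lin_compose[OF lin_tensor_map[OF linear_comult lin_id'] lin_lco]]
        lin_compose[OF lin_tensor_map[OF lin_id' lin_lco] lin_lco])+
  show ?thesis
  proof (rule span_tens_eq[OF l _ assms])
    fix k a x
    \<comment> \<open>Both sides are combinations of the terms \<open>T l m\<close>, where
      \<open>pf l\<close> stands in the first and \<open>pf m\<close> in the second leg. They list
      the pairs \<open>(l, m)\<close> in different orders, which \<open>triangle_sum_shift\<close>
      reconciles.\<close>
    define T where "T l m = tlift (\<lambda>y z. tlift (\<lambda>s t. ((pf l * ginv ^ k) * y) \<otimes>
      (((pf m * ginv ^ (k - l)) * s) \<otimes> tens (b (k - l - m) (a + l + m)) t)) (\<Delta> z)) (\<Delta> x)" for l m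
    have A: "tassoc (\<Delta> ((pf i * ginv ^ k) * y) \<otimes> z) = (\<Sum>l\<le>i. of_nat (i choose l) *\<^sub>C
        tlift (\<lambda>s t. ((pf l * ginv ^ k) * s) \<otimes> (((pf (i - l) * ginv ^ (k - l)) * t) \<otimes> z)) (\<Delta> y))"
      if "i \<le> k" for i y and z :: "nat \<Rightarrow>\<^sub>0 'h"
    proof -
      \<comment> \<open>The power \<open>g ^ l\<close> from the coproduct of a rising factorial
        lowers the degree in the second leg from \<open>k\<close> to \<open>k - l\<close>, as the
        coaction of \<open>b (k - l) (a + l)\<close> requires.\<close>
      have gk: "g ^ l * ginv ^ k = ginv ^ (k - l)" if "l \<le> k" for l
        using that
      proof (induction l)
        case (Suc l)
        have "g ^ Suc l * ginv ^ k = g * (g ^ l * ginv ^ k)" by (simp add: mult.assoc)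
        also have "\<dots> = g * (ginv * ginv ^ (k - Suc l))"
          using Suc by (simp add: power_Suc[symmetric] Suc_diff_Suc del: power_Suc)
        finally show ?case by (simp add: g_ginv_assoc)
      qed simp
      have b1: "bilin (\<lambda>v v'. tlift (\<lambda>s t. (v * s) \<otimes> ((v' * t) \<otimes> z)) (\<Delta> y))"
        by (intro lin_intros)
      have "tassoc (\<Delta> ((pf i * ginv ^ k) * y) \<otimes> z)
          = tlift (\<lambda>v v'. tlift (\<lambda>s t. (v * s) \<otimes> ((v' * t) \<otimes> z)) (\<Delta> y)) (\<Delta> (pf i * ginv ^ k))"
        unfolding tassoc_pure by (rule sweedler_mult[OF bilin_assoc(1)])
      also have "\<dots> = (\<Sum>l\<le>i. of_nat (i choose l) *\<^sub>C
          tlift (\<lambda>s t. ((pf l * ginv ^ k) * s) \<otimes> (((pf (i - l) * g ^ l * ginv ^ k) * t) \<otimes> z)) (\<Delta> y))"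
        unfolding comult_pf_ginv lin_simps[OF lin_tlift[OF b1]] tlift_pure[OF b1] ..
      also have "\<dots> = (\<Sum>l\<le>i. of_nat (i choose l) *\<^sub>C
          tlift (\<lambda>s t. ((pf l * ginv ^ k) * s) \<otimes> (((pf (i - l) * ginv ^ (k - l)) * t) \<otimes> z)) (\<Delta> y))"
        using that by (intro sum.cong refl) (simp add: mult.assoc[of "pf _" "g ^ _"] gk)
      finally show ?thesis .
    qed
    have "tassoc (tmap \<Delta> id (lco (tens (b k a) x)))
        = (\<Sum>i\<le>k. of_nat (k choose i) *\<^sub>C tlift (\<lambda>y z. tassoc (\<Delta> ((pf i * ginv ^ k) * y)
            \<otimes> tens (b (k - i) (a + i)) z)) (\<Delta> x))"
      unfolding lco_tens lterm_def
        lin_simps[OF lin_compose[OF lin_tassoc lin_tensor_map[OF linear_comult lin_id']]]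
        lin_tlift_push[OF lin_compose[OF lin_tassoc lin_tensor_map[OF linear_comult lin_id']] bilin_lterm]
      by (simp add: tensor_map_pure[OF linear_comult lin_id'])
    also have "\<dots> = (\<Sum>i\<le>k. of_nat (k choose i) *\<^sub>C (\<Sum>l\<le>i. of_nat (i choose l) *\<^sub>C T l (i - l)))"
    proof (intro sum.cong refl arg_cong[where f = "\<lambda>v. _ *\<^sub>C v"])
      fix i assume "i \<in> {..k}"
      then have i: "i \<le> k" by simp
      let ?G = "\<lambda>l y z. tlift (\<lambda>s t. ((pf l * ginv ^ k) * s) \<otimes> (((pf (i - l) * ginv ^ (k - l)) * t)
            \<otimes> tens (b (k - i) (a + i)) z)) (\<Delta> y)"
      have bG: "bilin (?G l)" for l by (intro model_lin)
      have "tlift (\<lambda>y z. tassoc (\<Delta> ((pf i * ginv ^ k) * y) \<otimes> tens (b (k - i) (a + i)) z)) (\<Delta> x)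
          = (\<Sum>l\<le>i. of_nat (i choose l) *\<^sub>C tlift (?G l) (\<Delta> x))"
        unfolding A[OF i] by (rule tlift_sum_fun[OF bG])
      also have "\<dots> = (\<Sum>l\<le>i. of_nat (i choose l) *\<^sub>C T l (i - l))"
      proof (intro sum.cong refl arg_cong[where f = "\<lambda>v. _ *\<^sub>C v"])
        fix l assume "l \<in> {..i}"
        then have kl: "k - l - (i - l) = k - i" "a + l + (i - l) = a + i" using i by auto
        show "tlift (?G l) (\<Delta> x) = T l (i - l)"
          unfolding T_def kl by (rule sweedler_coassoc) (intro model_lin)+
      qed
      finally show "tlift (\<lambda>y z. tassoc (\<Delta> ((pf i * ginv ^ k) * y) \<otimes> tens (b (k - i) (a + i)) z)) (\<Delta> x)
          = (\<Sum>l\<le>i. of_nat (i choose l) *\<^sub>C T l (i - l))" .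
    qed
    also have "\<dots> = (\<Sum>l\<le>k. of_nat (k choose l) *\<^sub>C (\<Sum>m\<le>k - l. of_nat ((k - l) choose m) *\<^sub>C T l m))"
      by (rule triangle_sum_shift)
    also have "\<dots> = (\<Sum>l\<le>k. of_nat (k choose l) *\<^sub>C tlift (\<lambda>y z. ((pf l * ginv ^ k) * y)
        \<otimes> lco (tens (b (k - l) (a + l)) z)) (\<Delta> x))"
    proof (intro sum.cong refl arg_cong[where f = "\<lambda>v. _ *\<^sub>C v"])
      fix l
      let ?H = "\<lambda>m y z. tlift (\<lambda>s t. ((pf l * ginv ^ k) * y) \<otimes>
        (((pf m * ginv ^ (k - l)) * s) \<otimes> tens (b (k - l - m) (a + l + m)) t)) (\<Delta> z)"
      have bH: "bilin (?H m)" for m by (intro model_lin)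
      have "((pf l * ginv ^ k) * y) \<otimes> lco (tens (b (k - l) (a + l)) z)
          = (\<Sum>m\<le>k - l. of_nat ((k - l) choose m) *\<^sub>C ?H m y z)" for y z
        unfolding lco_tens lterm_def pure_tensor_simps lin_tlift_push[OF lin_pure_right bilin_lterm] ..
      then show "(\<Sum>m\<le>k - l. of_nat ((k - l) choose m) *\<^sub>C T l m)
          = tlift (\<lambda>y z. ((pf l * ginv ^ k) * y) \<otimes> lco (tens (b (k - l) (a + l)) z)) (\<Delta> x)"
        by (simp only: T_def tlift_sum_fun[OF bH])
    qed
    also have "\<dots> = tmap id lco (lco (tens (b k a) x))"
      unfolding lco_tens[of k a x] lin_simps[OF lin_tensor_map[OF lin_id' lin_lco]] lterm_def
        tmap_tlift[OF lin_id' lin_lco bilin_lterm]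
      by (simp add: tensor_map_pure[OF lin_id' lin_lco])
    finally show "tassoc (tmap \<Delta> id (lco (tens (b k a) x))) = tmap id lco (lco (tens (b k a) x))" .
  qed
qed

lemma lco_closed: "f \<in> span_tens False \<Longrightarrow> lco f \<in> tensor_space UNIV (span_tens False)"
proof (rule span_tens_closed[OF lin_lco _ subspace_tensor_space])
  fix k a :: nat and x :: 'h assume ka: "False \<or> k \<noteq> 0 \<or> a \<noteq> 0"
  have "lterm u (b (k - i) (a + i)) x \<in> tensor_space UNIV (span_tens False)" if "i \<le> k" for u i
    unfolding lterm_def
    by (rule tensor_lift_in_subspace[OF subspace_UNIV subspace_UNIV bilin_lterm subspace_tensor_space])
      (use ka that in \<open>auto intro!: pure_in_tensor_space tens_b_in_span\<close>)
  then show "lco (tens (b k a) x) \<in> tensor_space UNIV (span_tens False)"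
    unfolding lco_tens
    by (intro complex_vector.subspace_sum[OF subspace_tensor_space]
        complex_vector.subspace_scale[OF subspace_tensor_space]) simp
qed

lemma rco_closed: "f \<in> span_tens False \<Longrightarrow> rco f \<in> tensor_space (span_tens False) UNIV"
proof (rule span_tens_closed[OF lin_rco _ subspace_tensor_space])
  fix k a :: nat and x :: 'h assume ka: "False \<or> k \<noteq> 0 \<or> a \<noteq> 0"
  show "rco (tens (b k a) x) \<in> tensor_space (span_tens False) UNIV"
    unfolding rco_tens
    by (rule tensor_lift_in_subspace[OF subspace_UNIV subspace_UNIV bilin_rterm subspace_tensor_space])
      (use ka in \<open>auto intro!: pure_in_tensor_space tens_b_in_span\<close>)
qed

section \<open>The differential as commutator with an invariant vector\<close>

definition vacuum :: "nat \<Rightarrow>\<^sub>0 'h" where "vacuum = tens (b 0 0) 1"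

definition dmap :: "'h \<Rightarrow> (nat \<Rightarrow>\<^sub>0 'h)" where "dmap h = lmul h vacuum - right_tens vacuum h"

lemma vacuum_in_span: "vacuum \<in> span_tens True"
  by (simp add: vacuum_def tens_b_in_span)

lemma lin_dmap: "lin dmap"
  unfolding dmap_def by (rule lin_subtract[OF lmul(2) lin_right_tens_param])

lemma dmap_mult: "dmap (h * k) = right_tens (dmap h) k + lmul h (dmap k)"
  by (simp add: dmap_def lmul(3) right_tens_mult lin_diff[OF lin_right_tens] lin_diff[OF lmul(1)] lmul_right)

lemma dmap_g: "dmap g = tens (b 0 1) g"
  using gact_b[of 0 0] by (simp add: dmap_def vacuum_def lmul_gen right_tens tens_simps)

lemma dmap_p: "dmap p = tens (b 1 0) g"
  by (simp add: dmap_def vacuum_def lmul_gen right_tens pact_b)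

lemma dmap_ginv: "dmap ginv = - tens (hact (b 0 1)) ginv"
proof -
  have "hact (b 0 0) = b 0 0 - hact (b 0 1)"
    using hact_b[of 0 0] by (simp add: lin_add[OF lin_hact] algebra_simps)
  then show ?thesis by (simp add: dmap_def vacuum_def lmul_gen right_tens tens_simps)
qed

text \<open>The vacuum is not a form of the model, so neither term of the commutator helps by
  itself. The product rule reduces the claim to the generators, where the two copies of
  \<open>b 0 0\<close> cancel.\<close>

lemma dmap_in_span: "dmap h \<in> span_tens False"
proof (induction h rule: planck_induct)
  case one
  show ?case by (simp add: dmap_def lmul(4) right_tens_one complex_vector.subspace_0)
next
  case ginv
  show ?case
    by (simp add: dmap_ginv complex_vector.subspace_neg tens_in_span hact_in_span b_in_span)
qed (simp_all add: dmap_g dmap_p tens_b_in_span dmap_mult lin_add[OF lin_dmap] lin_scale[OF lin_dmap]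
    complex_vector.subspace_add complex_vector.subspace_scale lmul_in_span right_in_span)

text \<open>The vacuum has coaction \<open>1 \<otimes> vacuum\<close>, and the coaction respects
  both actions, so each half of the commutator becomes a Sweedler sum over
  \<open>\<Delta> h\<close>.\<close>

lemma lco_dmap: "lco (dmap h) = tmap id dmap (\<Delta> h)"
proof -
  have lv: "lco vacuum = 1 \<otimes> vacuum"
    using lco_b_one[of 0 0] by (simp add: vacuum_def)
  have b: "bilin (\<lambda>x y. (x * 1 :: 'h) \<otimes> lmul y vacuum)" "bilin (\<lambda>x y. (1 * x :: 'h) \<otimes> right_tens vacuum y)"
    by (intro lin_intros lmul(2) lin_right_tens_param)+
  have o: "bilin (\<lambda>x' y'. (x * x') \<otimes> lmul y y')" for x y :: 'h by (intro lin_intros lmul(1))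
  have "tmult (*) lmul (\<Delta> h) (1 \<otimes> vacuum) = tlift (\<lambda>x y. (x * 1) \<otimes> lmul y vacuum) (\<Delta> h)"
    unfolding tensor_mult_def by (simp add: tlift_pure[OF o])
  then have "lco (dmap h) = tlift (\<lambda>x y. (x * 1) \<otimes> lmul y vacuum) (\<Delta> h)
      - tlift (\<lambda>x y. (1 * x) \<otimes> right_tens vacuum y) (\<Delta> h)"
    unfolding dmap_def lin_diff[OF lin_lco] lco_left[OF vacuum_in_span] lco_right[OF vacuum_in_span] lv
    by (simp add: tm(5))
  also have "\<dots> = tmap id dmap (\<Delta> h)"
    unfolding tlift_diff_fun[OF b, symmetric] tensor_map_def by (simp add: dmap_def pure_tensor_simps)
  finally show ?thesis .
qed

lemma rco_dmap: "rco (dmap h) = tmap dmap id (\<Delta> h)"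
proof -
  have rv: "rco vacuum = vacuum \<otimes> 1"
    by (simp add: vacuum_def rco_one)
  have b: "bilin (\<lambda>x y. lmul x vacuum \<otimes> (y * 1 :: 'h))" "bilin (\<lambda>x y. right_tens vacuum x \<otimes> (1 * y :: 'h))"
    by (intro lin_intros lmul(2) lin_right_tens_param)+
  have o: "bilin (\<lambda>x' y'. lmul x x' \<otimes> (y * y'))" for x y :: 'h by (intro lin_intros lmul(1))
  have "tmult lmul (*) (\<Delta> h) (vacuum \<otimes> 1) = tlift (\<lambda>x y. lmul x vacuum \<otimes> (y * 1)) (\<Delta> h)"
    unfolding tensor_mult_def by (simp add: tlift_pure[OF o])
  then have "rco (dmap h) = tlift (\<lambda>x y. lmul x vacuum \<otimes> (y * 1)) (\<Delta> h)
      - tlift (\<lambda>x y. right_tens vacuum x \<otimes> (1 * y)) (\<Delta> h)"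
    unfolding dmap_def lin_diff[OF lin_rco] rco_left rco_right rv
    by (simp add: tm(11))
  also have "\<dots> = tmap dmap id (\<Delta> h)"
    unfolding tlift_diff_fun[OF b, symmetric] tensor_map_def by (simp add: dmap_def pure_tensor_simps)
  finally show ?thesis .
qed

text \<open>The span \<open>?N\<close> is closed under right multiplication by the Leibniz rule,
  hence a bimodule. It contains \<open>dmap g\<close> and \<open>dmap p\<close>, and the recursion
  that defines \<open>w\<close> leads from these to every generator.\<close>

lemma span_tens_eq_span_dmap: "span_tens False = complex_vector.span {lmul h (dmap k) | h k. True}"
proof
  show "complex_vector.span {lmul h (dmap k) | h k. True} \<subseteq> span_tens False"
    by (rule complex_vector.span_minimal) (auto intro: lmul_in_span dmap_in_span)
  let ?N = "complex_vector.span {lmul h (dmap k) | h k. True}"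
  have N: "complex_vector.subspace ?N" by simp
  have d: "lmul h (dmap k) \<in> ?N" for h k by (rule complex_vector.span_base) blast
  have d1: "dmap k \<in> ?N" for k using d[of 1 k] by (simp add: lmul(4))
  have L: "lmul h f \<in> ?N" if "f \<in> ?N" for h f
  proof (rule lin_span_closed[OF lmul(1) _ N that])
    fix f assume "f \<in> {lmul h (dmap k) | h k. True}"
    then obtain h' k where f: "f = lmul h' (dmap k)" by blast
    show "lmul h f \<in> ?N" unfolding f lmul(3)[symmetric] by (rule d)
  qed
  have R: "right_tens f l \<in> ?N" if "f \<in> ?N" for l f
  proof (rule lin_span_closed[OF lin_right_tens _ N that])
    fix f assume "f \<in> {lmul h (dmap k) | h k. True}"
    then obtain h k where f: "f = lmul h (dmap k)" by blast
    have "right_tens f l = lmul h (dmap (k * l)) - lmul h (lmul k (dmap l))"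
      unfolding f lmul_right[symmetric] by (simp add: dmap_mult lin_add[OF lmul(1)])
    then show "right_tens f l \<in> ?N"
      using complex_vector.subspace_diff[OF N d[of h "k * l"] L[OF d[of k l], of h]] by simp
  qed
  have col: "tens (b 0 (Suc a)) 1 \<in> ?N" for a
  proof (induction a)
    case 0
    have "tens (b 0 (Suc 0)) 1 = right_tens (dmap g) ginv" by (simp add: dmap_g right_tens g_ginv)
    then show ?case using R[OF d1] by simp
  next
    case (Suc a)
    have "tens (b 0 (Suc (Suc a))) 1 = right_tens (lmul g (tens (b 0 (Suc a)) 1)) ginv - tens (b 0 (Suc a)) 1"
      using gact_b[of 0 "Suc a"] by (simp add: lmul_gen right_tens g_ginv tens_simps lin_add[OF lin_right_tens])
    then show ?case using complex_vector.subspace_diff[OF N R[OF L[OF Suc]] Suc] by simp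
  qed
  have all: "tens (b k a) 1 \<in> ?N" if "k \<noteq> 0 \<or> a \<noteq> 0" for k a
    using that
  proof (induction k arbitrary: a)
    case 0
    then show ?case using col by (cases a) auto
  next
    case (Suc k)
    show ?case
    proof (cases "k = 0 \<and> a = 0")
      case True
      have "tens (b 1 0) 1 = right_tens (dmap p) ginv" by (simp add: dmap_p right_tens g_ginv)
      then show ?thesis using R[OF d1, of p ginv] True by simp
    next
      case False
      let ?w = "tens (b k a) (1 :: 'h)"
      have w: "?w \<in> ?N" using Suc.IH False by blast
      have "tens (b (Suc k) a) 1 = right_tens (lmul p ?w - right_tens ?w p) ginv - (of_nat k * lam) *\<^sub>C ?w"
        by (simp add: lmul_b_one(1) lin_simps[OF lin_right_tens] right_tens mult.assoc g_ginv)
      then show ?thesis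
        using complex_vector.subspace_diff[OF N R[OF complex_vector.subspace_diff[OF N L[OF w, of p] R[OF w, of p]], of ginv]
            complex_vector.subspace_scale[OF N w, of "of_nat k * lam"]] by simp
    qed
  qed
  show "span_tens False \<subseteq> ?N"
    unfolding span_tens_def
  proof (rule complex_vector.span_minimal[OF _ N], rule subsetI)
    fix f :: "nat \<Rightarrow>\<^sub>0 'h" assume "f \<in> {tens (b k a) x | k a x. False \<or> k \<noteq> 0 \<or> a \<noteq> 0}"
    then obtain k a and x :: 'h where f: "f = tens (b k a) x" "k \<noteq> 0 \<or> a \<noteq> 0" by auto
    from R[OF all[OF f(2)], of x] show "f \<in> ?N" by (simp add: f(1) right_tens)
  qed
qed

definition model :: "('h, nat \<Rightarrow>\<^sub>0 'h) calculus"
  where "model = \<lparr>forms = span_tens False, lact = lmul, ract = right_tens, lcoact = lco, rcoact = rco, diff = dmap\<rparr>"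

lemma model_calculus: "bicovariant_calculus \<Delta> \<epsilon> S model"
proof -
  have T: "f \<in> span_tens True" if "f \<in> span_tens False" for f
    using that span_tens_mono by blast
  show ?thesis
    unfolding model_def
    by (rule total_calculus)
      (simp_all only: subspace_span_tens bilin_lmul lmul lmul_in_span bilin_right_tens right_in_span
        right_tens_one right_tens_mult lmul_right lin_lco lco_closed lco_coassoc lco_counit T lin_rco
        rco_closed rco_coassoc rco_counit co_commute lco_left lco_right rco_left rco_right lin_dmap
        dmap_in_span lco_dmap rco_dmap dmap_mult span_tens_eq_span_dmap[symmetric])
qed

end

section \<open>Isomorphisms of calculi\<close>

lemma tensor_map_inverse:
  assumes X: "complex_vector.subspace X" and Y: "complex_vector.subspace Y"
    and X': "complex_vector.subspace X'" and Y': "complex_vector.subspace Y'"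
    and f: "linear_on X f" "\<And>x. x \<in> X \<Longrightarrow> f x \<in> X'" and k: "linear_on Y k" "\<And>y. y \<in> Y \<Longrightarrow> k y \<in> Y'"
    and f': "linear_on X' f'" "\<And>x. x \<in> X \<Longrightarrow> f' (f x) = x" and k': "linear_on Y' k'" "\<And>y. y \<in> Y \<Longrightarrow> k' (k y) = y"
    and t: "t \<in> tensor_space X Y"
  shows "tensor_map X' Y' f' k' (tensor_map X Y f k t) = t"
proof -
  have b: "bilinear_on X Y (\<lambda>x y. f x \<otimes> k y)" "bilinear_on X' Y' (\<lambda>x y. f' x \<otimes> k' y)"
    using f(1) k(1) f'(1) k'(1) by (simp_all add: bilinear_on_def linear_on_def pure_tensor_simps)
  note l = tensor_lift_linear_on[OF X Y b(1)] tensor_lift_linear_on[OF X' Y' b(2)]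
  have "tensor_map X Y f k t \<in> tensor_space X' Y' \<and> tensor_map X' Y' f' k' (tensor_map X Y f k t) = t"
    using t X
  proof (induction rule: tensor_space_induct)
    case zero
    then show ?case
      unfolding tensor_map_def
      by (simp add: linear_on_zero[OF l(1)] linear_on_zero[OF l(2)] complex_vector.subspace_0)
  next
    case (add x y s)
    then show ?case
      unfolding tensor_map_def
      by (simp add: linear_on_add[OF l(1)] linear_on_add[OF l(2)] pure_in_tensor_space f k f'(2) k'(2)
          tensor_lift_pure[OF X Y b(1)] tensor_lift_pure[OF X' Y' b(2)] complex_vector.subspace_add)
  qed
  then show ?thesis ..
qed

lemma calculus_iso_sym:
  assumes \<Gamma>: "bicovariant_calculus \<Delta> \<epsilon> S \<Gamma>" and \<Gamma>': "bicovariant_calculus \<Delta> \<epsilon> S \<Gamma>'"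
    and iso: "calculus_iso \<Gamma> \<Gamma>'"
  shows "calculus_iso \<Gamma>' \<Gamma>"
proof -
  interpret A: bicovariant_calculus \<Delta> \<epsilon> S \<Gamma> by (fact \<Gamma>)
  interpret B: bicovariant_calculus \<Delta> \<epsilon> S \<Gamma>' by (fact \<Gamma>')
  obtain f where f: "bij_betw f (forms \<Gamma>) (forms \<Gamma>')" "linear_on (forms \<Gamma>) f"
    "\<And>h \<omega>. \<omega> \<in> forms \<Gamma> \<Longrightarrow> f (lact \<Gamma> h \<omega>) = lact \<Gamma>' h (f \<omega>)"
    "\<And>h \<omega>. \<omega> \<in> forms \<Gamma> \<Longrightarrow> f (ract \<Gamma> \<omega> h) = ract \<Gamma>' (f \<omega>) h"
    "\<And>\<omega>. \<omega> \<in> forms \<Gamma> \<Longrightarrow> lcoact \<Gamma>' (f \<omega>) = tensor_map UNIV (forms \<Gamma>) id f (lcoact \<Gamma> \<omega>)"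
    "\<And>\<omega>. \<omega> \<in> forms \<Gamma> \<Longrightarrow> rcoact \<Gamma>' (f \<omega>) = tensor_map (forms \<Gamma>) UNIV f id (rcoact \<Gamma> \<omega>)"
    "\<And>h. f (diff \<Gamma> h) = diff \<Gamma>' h"
    using iso unfolding calculus_iso_def by blast
  define k where "k = inv_into (forms \<Gamma>) f"
  have kf: "k (f \<omega>) = \<omega>" if "\<omega> \<in> forms \<Gamma>" for \<omega>
    unfolding k_def using f(1) that by (simp add: bij_betw_def)
  have fF: "f \<omega> \<in> forms \<Gamma>'" if "\<omega> \<in> forms \<Gamma>" for \<omega>
    using f(1) that by (auto simp: bij_betw_def)
  have ex: "\<exists>\<omega>\<in>forms \<Gamma>. \<eta> = f \<omega>" if "\<eta> \<in> forms \<Gamma>'" for \<eta>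
    using f(1) that by (auto simp: bij_betw_def)
  have k_lin: "linear_on (forms \<Gamma>') k"
    unfolding linear_on_def
  proof (intro conjI ballI allI)
    fix \<eta> \<eta>' c assume "\<eta> \<in> forms \<Gamma>'" 
    then obtain \<omega> where w: "\<omega> \<in> forms \<Gamma>" "\<eta> = f \<omega>" using ex by blast
    show "k (c *\<^sub>C \<eta>) = c *\<^sub>C k \<eta>"
      using kf[of "c *\<^sub>C \<omega>"] by (simp add: w kf linear_on_scale[OF f(2)])
    assume "\<eta>' \<in> forms \<Gamma>'" 
    then obtain \<omega>' where w': "\<omega>' \<in> forms \<Gamma>" "\<eta>' = f \<omega>'" using ex by blast
    show "k (\<eta> + \<eta>') = k \<eta> + k \<eta>'"
      using kf[of "\<omega> + \<omega>'"] by (simp add: w w' kf linear_on_add[OF f(2)])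
  qed
  show ?thesis
    unfolding calculus_iso_def
  proof (rule exI[of _ k], intro conjI allI ballI)
    show "bij_betw k (forms \<Gamma>') (forms \<Gamma>)"
      unfolding k_def by (rule bij_betw_inv_into[OF f(1)])
    show "linear_on (forms \<Gamma>') k" by (rule k_lin)
    show "k (diff \<Gamma>' h) = diff \<Gamma> h" for h
      using kf[of "diff \<Gamma> h"] by (simp add: f(7))
    fix \<eta> assume "\<eta> \<in> forms \<Gamma>'"
    then obtain \<omega> where w: "\<omega> \<in> forms \<Gamma>" "\<eta> = f \<omega>" using ex by blast
    show "k (lact \<Gamma>' h \<eta>) = lact \<Gamma> h (k \<eta>)" for h
      using kf[of "lact \<Gamma> h \<omega>"] by (simp add: w kf f(3))
    show "k (ract \<Gamma>' \<eta> h) = ract \<Gamma> (k \<eta>) h" for h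
      using kf[of "ract \<Gamma> \<omega> h"] by (simp add: w kf f(4))
    show "lcoact \<Gamma> (k \<eta>) = tensor_map UNIV (forms \<Gamma>') id k (lcoact \<Gamma>' \<eta>)"
      unfolding w(2) f(5)[OF w(1)] kf[OF w(1)]
      by (rule tensor_map_inverse[symmetric])
        (simp_all add: A.subspace_forms B.subspace_forms lin_id' f(2) fF k_lin kf A.lcoact_closed w)
    show "rcoact \<Gamma> (k \<eta>) = tensor_map (forms \<Gamma>') UNIV k id (rcoact \<Gamma>' \<eta>)"
      unfolding w(2) f(6)[OF w(1)] kf[OF w(1)]
      by (rule tensor_map_inverse[symmetric])
        (simp_all add: A.subspace_forms B.subspace_forms lin_id' f(2) fF k_lin kf A.rcoact_closed w)
  qed
qed

text \<open>\<open>w\<close> is made from the actions and the differential, so an isomorphism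
  carries the \<open>w\<close> of one calculus to that of the other. The zero pattern is thus an
  isomorphism invariant.\<close>

lemma planck_calculus_iso_zero:
  assumes "planck_calculus hbar G p g ginv \<Delta> \<epsilon> S \<Gamma>" "planck_calculus hbar G p g ginv \<Delta> \<epsilon> S \<Gamma>'"
    and iso: "calculus_iso \<Gamma> \<Gamma>'"
  shows "planck_calculus.w hbar G p g ginv \<Gamma> k a = 0 \<longleftrightarrow> planck_calculus.w hbar G p g ginv \<Gamma>' k a = 0"
proof -
  interpret A: planck_calculus hbar G p g ginv \<Delta> \<epsilon> S \<Gamma> by (fact assms)
  interpret B: planck_calculus hbar G p g ginv \<Delta> \<epsilon> S \<Gamma>' by (fact assms)
  obtain f where f: "bij_betw f (forms \<Gamma>) (forms \<Gamma>')" "linear_on (forms \<Gamma>) f"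
    "\<And>h \<omega>. \<omega> \<in> forms \<Gamma> \<Longrightarrow> f (lact \<Gamma> h \<omega>) = lact \<Gamma>' h (f \<omega>)"
    "\<And>h \<omega>. \<omega> \<in> forms \<Gamma> \<Longrightarrow> f (ract \<Gamma> \<omega> h) = ract \<Gamma>' (f \<omega>) h"
    "\<And>h. f (diff \<Gamma> h) = diff \<Gamma>' h"
    using iso unfolding calculus_iso_def by blast
  note f_simps = f(3-5) linear_on_zero[OF f(2)] linear_on_scale[OF f(2)]
    linear_on_diff[OF f(2) A.subspace_forms]
  have col: "f (A.wcol a) = B.wcol a" for a
    by (induction a) (simp_all add: f_simps)
  have "f (A.w k a) = B.w k a"
    by (induction k arbitrary: a) (simp_all add: f_simps col split: nat.split)
  moreover have "f (A.w k a) = 0 \<longleftrightarrow> A.w k a = 0"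
    using f(1) linear_on_zero[OF f(2)] A.w_form[of k a] A.forms_closed(1)
    by (metis bij_betw_imp_inj_on inj_on_def)
  ultimately show ?thesis by simp
qed

section \<open>Invariant forms of the model calculi\<close>

lemma lookup_tens: "Poly_Mapping.lookup (tens c x) n = Poly_Mapping.lookup c n *\<^sub>C x"
proof (rule lin_free_eq[where f = c])
  show "lin (\<lambda>c. Poly_Mapping.lookup (tens c x) n)" by (rule lin_compose[OF lin_lookup lin_tens_left])
  show "lin (\<lambda>c. Poly_Mapping.lookup c n *\<^sub>C x)" by (rule lin_scaleC_left[OF lin_lookup])
qed (simp add: tens_single lookup_single when_def)

sublocale planck_model \<subseteq> M: planck_calculus hbar G p g ginv \<Delta> \<epsilon> S model
  by (intro planck_calculus.intro planck_hopf_algebra_axioms model_calculus)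

context planck_model
begin

lemma model_sel [simp]: "forms model = span_tens False" "lact model = lmul" "ract model = right_tens"
  "lcoact model = lco" "rcoact model = rco" "diff model = dmap"
  by (simp_all add: model_def)

lemma M_w: "k \<noteq> 0 \<or> a \<noteq> 0 \<Longrightarrow> M.w k a = tens (b k a) 1"
proof (induction k arbitrary: a)
  case 0
  have "M.wcol c = tens (b 0 (Suc c)) 1" for c
  proof (induction c)
    case 0
    then show ?case by (simp add: dmap_g right_tens g_ginv)
  next
    case (Suc c)
    then show ?case
      using gact_b[of 0 "Suc c"] by (simp add: lmul_gen right_tens g_ginv tens_simps lin_add[OF lin_right_tens])
  qed
  with 0 show ?case by (cases a) simp_all
next
  case (Suc k)
  show ?case
  proof (cases "k = 0 \<and> a = 0")
    case True
    then show ?thesis by (simp add: dmap_p right_tens g_ginv)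
  next
    case False
    then have IH: "M.w k a = tens (b k a) 1" using Suc.IH by blast
    show ?thesis
      unfolding M.w.simps(2) if_not_P[OF False]
      by (simp add: IH lmul_b_one(1) lin_simps[OF lin_right_tens] right_tens mult.assoc g_ginv)
  qed
qed

lemma one_neq_zero: "(1 :: 'h) \<noteq> 0"
  using counit_one lin_zero[OF linear_counit] by auto

lemma M_w_zero: "k \<noteq> 0 \<or> a \<noteq> 0 \<Longrightarrow> M.w k a = 0 \<longleftrightarrow> height k \<le> a"
proof -
  have "Poly_Mapping.single n (1 :: 'h) \<noteq> 0" for n :: nat
    using one_neq_zero by (metis lookup_single_eq lookup_zero)
  then show "k \<noteq> 0 \<or> a \<noteq> 0 \<Longrightarrow> M.w k a = 0 \<longleftrightarrow> height k \<le> a"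
    by (simp add: M_w b_def tens_single tens_simps not_less del: M.w.simps)
qed

text \<open>The Young diagram without its corner, which belongs to the vacuum and not to a
  form.\<close>

definition diagram :: "(nat \<times> nat) set"
  where "diagram = {(k, a). a < height k \<and> (k \<noteq> 0 \<or> a \<noteq> 0)}"

lemma height_Max: "Max I \<le> k \<Longrightarrow> height k = 0"
  using finite_I by (auto simp: height_def dest: Max_ge)

lemma full_diagram: "insert (0, 0) diagram = Sigma {..<Max I} (\<lambda>k. {..<height k})"
proof -
  have "k < Max I" if "a < height k" for k a
    using height_Max[of k] that by (cases "Max I \<le> k") auto
  then show ?thesis using height_0_pos by (auto simp: diagram_def)
qed

lemma finite_diagram: "finite diagram"
proof -
  have "finite (insert (0, 0) diagram)" unfolding full_diagram by (intro finite_SigmaI) auto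
  then show ?thesis by simp
qed

lemma origin_diagram: "(0, 0) \<notin> diagram" by (simp add: diagram_def)

text \<open>Double counting: with the corner put back, the diagram has columns of length
  \<open>height k\<close> and rows whose lengths are the elements of \<open>I\<close>.\<close>

lemma card_diagram: "card diagram = (\<Sum>n\<in>I. n) - 1"
proof -
  have "card (insert (0, 0) diagram) = (\<Sum>k<Max I. height k)"
    unfolding full_diagram by (subst card_SigmaI) auto
  also have "\<dots> = (\<Sum>k<Max I. \<Sum>n\<in>I. if k < n then 1 else 0)"
    unfolding height_def using finite_I by (intro sum.cong refl) (simp add: sum.If_cases Int_def conj_commute)
  also have "\<dots> = (\<Sum>n\<in>I. \<Sum>k<Max I. if k < n then 1 else 0)" by (rule sum.swap)
  also have "\<dots> = (\<Sum>n\<in>I. n)"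
  proof (intro sum.cong refl)
    fix n assume "n \<in> I"
    then have "n \<le> Max I" using finite_I by simp
    then have "{..<Max I} \<inter> {k. k < n} = {..<n}" by auto
    then show "(\<Sum>k<Max I. if k < n then 1 else 0) = n" by (simp add: sum.If_cases)
  qed
  finally show ?thesis using finite_diagram origin_diagram by simp
qed

lemma w_diagram:
  "inj_on (\<lambda>s. M.w (fst s) (snd s)) diagram"
  "complex_vector.independent ((\<lambda>s. M.w (fst s) (snd s)) ` diagram)"
  by (rule M.w_independent[OF finite_diagram origin_diagram _ M_w_zero]; simp add: diagram_def)+

lemma lookup_outside:
  assumes "f \<in> span_tens False" "n \<notin> prod_encode ` diagram" shows "Poly_Mapping.lookup f n = 0"
proof (rule span_tens_eq[OF lin_lookup lin_const0 _ assms(1)])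
  fix k a :: nat and x :: 'h assume "False \<or> k \<noteq> 0 \<or> a \<noteq> 0"
  with assms(2) show "Poly_Mapping.lookup (tens (b k a) x) n = 0"
    by (auto simp: lookup_tens b_def lookup_single when_def diagram_def image_iff)
qed

lemma form_expansion:
  assumes "f \<in> span_tens False"
  shows "f = (\<Sum>s\<in>diagram. Poly_Mapping.single (prod_encode s) (Poly_Mapping.lookup f (prod_encode s)))"
proof (rule poly_mapping_eqI)
  fix n
  show "Poly_Mapping.lookup f n = Poly_Mapping.lookup
      (\<Sum>s\<in>diagram. Poly_Mapping.single (prod_encode s) (Poly_Mapping.lookup f (prod_encode s))) n"
  proof (cases "n \<in> prod_encode ` diagram")
    case True
    then obtain s where s: "s \<in> diagram" "n = prod_encode s" by blast
    then show ?thesis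
      by (simp add: lookup_sum lookup_single when_def inj_eq[OF inj_prod_encode] finite_diagram)
  next
    case False
    then have "prod_encode s \<noteq> n" if "s \<in> diagram" for s using that by blast
    then show ?thesis
      using lookup_outside[OF assms False] by (simp add: lookup_sum lookup_single when_def)
  qed
qed

lemma single_diagram: "(k, a) \<in> diagram \<Longrightarrow> Poly_Mapping.single (prod_encode (k, a)) x = tens (b k a) x"
  by (simp add: b_def tens_single diagram_def)

lemma right_invariant_model:
  "right_invariant_forms model = complex_vector.span ((\<lambda>s. M.w (fst s) (snd s)) ` diagram)"
proof
  show "complex_vector.span ((\<lambda>s. M.w (fst s) (snd s)) ` diagram) \<subseteq> right_invariant_forms model"
    by (rule complex_vector.span_minimal[OF _ M.right_invariant_subspace]) (use M.w_right_invariant in blast)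
  show "right_invariant_forms model \<subseteq> complex_vector.span ((\<lambda>s. M.w (fst s) (snd s)) ` diagram)"
  proof
    fix f assume "f \<in> right_invariant_forms model"
    then have f: "f \<in> span_tens False" "rco f = f \<otimes> 1" by (simp_all add: right_invariant_forms_def)
    \<comment> \<open>Applying the counit to the \<open>n\<close>-th coefficient in the left leg
      turns \<open>rco f\<close> into that coefficient and \<open>f \<otimes> 1\<close> into a
      scalar, so an invariant form has scalar coefficients.\<close>
    have coeff: "Poly_Mapping.lookup f n = \<epsilon> (Poly_Mapping.lookup f n) *\<^sub>C 1" for n
    proof -
      have e: "bilin (\<lambda>\<eta> h. \<epsilon> (Poly_Mapping.lookup \<eta> n) *\<^sub>C (h :: 'h))"
        by (intro bilinI lin_scaleC lin_id lin_scaleC_left lin_compose[OF linear_counit lin_lookup])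
      have "tlift (\<lambda>\<eta> h. \<epsilon> (Poly_Mapping.lookup \<eta> n) *\<^sub>C h) (rco f) = Poly_Mapping.lookup f n"
      proof (rule tens_eq[where f = f, OF lin_compose[OF lin_tlift[OF e] lin_rco] lin_lookup])
        fix c and x :: 'h
        have b: "bilin (\<lambda>y z. \<epsilon> y *\<^sub>C (z :: 'h))" by (intro hopf_lin)
        have "tlift (\<lambda>\<eta> h. \<epsilon> (Poly_Mapping.lookup \<eta> n) *\<^sub>C h) (rco (tens c x))
            = tlift (\<lambda>y z. Poly_Mapping.lookup c n *\<^sub>C (\<epsilon> y *\<^sub>C z)) (\<Delta> x)"
          unfolding rco_tens lin_tlift_push[OF lin_tlift[OF e] bilin_rterm] tlift_pure[OF e] lookup_tens
          by (simp add: lin_scale[OF linear_counit] scaleC_scaleC)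
        also have "\<dots> = Poly_Mapping.lookup c n *\<^sub>C tlift (\<lambda>y z. \<epsilon> y *\<^sub>C z) (\<Delta> x)"
          by (rule lin_tlift_push[OF lin_scaleC[OF lin_id] b, symmetric])
        finally show "tlift (\<lambda>\<eta> h. \<epsilon> (Poly_Mapping.lookup \<eta> n) *\<^sub>C h) (rco (tens c x))
            = Poly_Mapping.lookup (tens c x) n"
          by (simp add: counit_left lookup_tens)
      qed
      then show ?thesis unfolding f(2) tlift_pure[OF e] by simp
    qed
    have "Poly_Mapping.single (prod_encode s) (Poly_Mapping.lookup f (prod_encode s))
        \<in> complex_vector.span ((\<lambda>s. M.w (fst s) (snd s)) ` diagram)" if s: "s \<in> diagram" for s
    proof -
      obtain k a where ka: "s = (k, a)" by (cases s)
      with s have "k \<noteq> 0 \<or> a \<noteq> 0" by (simp add: diagram_def)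
      then have "Poly_Mapping.single (prod_encode s) (Poly_Mapping.lookup f (prod_encode s))
          = \<epsilon> (Poly_Mapping.lookup f (prod_encode s)) *\<^sub>C M.w (fst s) (snd s)"
        using s unfolding ka by (subst coeff) (simp add: single_diagram M_w tens_simps del: M.w.simps)
      then show ?thesis
        using s by (simp add: complex_vector.span_scale complex_vector.span_base del: M.w.simps)
    qed
    then show "f \<in> complex_vector.span ((\<lambda>s. M.w (fst s) (snd s)) ` diagram)"
      by (subst form_expansion[OF f(1)]) (rule complex_vector.span_sum)
  qed
qed

lemma model_finite_dim: "finite_dim_calculus model"
  unfolding finite_dim_calculus_def right_invariant_model using finite_diagram by blast

lemma model_dim: "calculus_dim model = (\<Sum>n\<in>I. n) - 1"
  unfolding calculus_dim_def right_invariant_model complex_vector.dim_span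
    complex_vector.dim_eq_card_independent[OF w_diagram(2)] card_image[OF w_diagram(1)]
  by (rule card_diagram)

end

section \<open>Comparison of an arbitrary calculus with a model\<close>

context planck_model
begin

text \<open>The isomorphism sends \<open>tens (b k a) x\<close> to
  \<open>ract \<Gamma> (w k a) x\<close>. It respects the left action because \<open>w\<close> obeys
  in every calculus the recursions \<open>g_w\<close> and \<open>p_w\<close> that define the model.
  It is injective because the non-zero \<open>w k a\<close> are independent and invariant, so that
  \<open>right_invariant_free\<close> applies, and onto because the differentials are in the
  image.\<close>

lemma model_iso:
  fixes \<Gamma> :: "('h, 'v::complex_vector) calculus"
  assumes \<Gamma>: "planck_calculus hbar G p g ginv \<Delta> \<epsilon> S \<Gamma>"
    and zero: "\<And>k a. k \<noteq> 0 \<or> a \<noteq> 0 \<Longrightarrow> planck_calculus.w hbar G p g ginv \<Gamma> k a = 0 \<longleftrightarrow> height k \<le> a"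
  shows "calculus_iso model \<Gamma>"
proof -
  interpret N: planck_calculus hbar G p g ginv \<Delta> \<epsilon> S \<Gamma> by (fact \<Gamma>)
  let ?F = "span_tens False"
  \<comment> \<open>At the index of (0, 0) this is the junk value 0, so the compatibility statements
    for the map built from \<open>v\<close> are restricted to
    \<open>span_tens False\<close>.\<close>
  define v where "v n = (case prod_decode n of (k, a) \<Rightarrow> N.w k a)" for n
  have vF [simp]: "v n \<in> N.F" for n
    unfolding v_def by (cases "prod_decode n") (simp del: N.w.simps)
  define \<phi> where "\<phi> = coordinate_sum (\<lambda>n x. ract \<Gamma> (v n) x)"
  have lv: "lin (ract \<Gamma> (v n))" for n by (rule N.lin_ract) simp
  have lin: "lin \<phi>" unfolding \<phi>_def by (rule lin_coordinate_sum[OF lv])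
  note \<phi>_simps = lin_simps[OF lin]
  have \<phi>_single: "\<phi> (Poly_Mapping.single n x) = ract \<Gamma> (v n) x" for n x
    unfolding \<phi>_def by (rule coordinate_sum_single) (rule lv)
  have \<phi>F [simp]: "\<phi> f \<in> N.F" for f
    unfolding \<phi>_def coordinate_sum_def by (rule N.forms_closed(9)) simp
  have \<phi>_b: "\<phi> (tens (b k a) x) = ract \<Gamma> (N.w k a) x" if "k \<noteq> 0 \<or> a \<noteq> 0" for k a x
  proof (cases "a < height k")
    case True
    then show ?thesis
      by (simp add: b_def tens_single \<phi>_single v_def del: N.w.simps)
  next
    case False
    then have "N.w k a = 0" using zero[OF that] by simp
    with False show ?thesis by (simp add: b_zero tens_simps \<phi>_simps N.ract_simps del: N.w.simps)
  qed
  have lin_r: "lin (\<lambda>f. ract \<Gamma> (\<phi> f) x)" and lin_l: "lin (\<lambda>f. lact \<Gamma> h (\<phi> f))" for x h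
    by (rule linI; simp add: \<phi>_simps N.ract_simps N.lact_simps)+
  have \<phi>_right: "\<phi> (right_tens f x) = ract \<Gamma> (\<phi> f) x" if "f \<in> ?F" for f x
    by (rule span_tens_eq[OF lin_compose[OF lin lin_right_tens] lin_r _ that])
      (simp add: right_tens \<phi>_b N.ract_mult del: N.w.simps)
  have b1F: "tens (b k a) 1 \<in> ?F" if "k \<noteq> 0 \<or> a \<noteq> 0" for k a
    by (rule tens_b_in_span) (use that in simp)
  have \<phi>_one: "\<phi> (tens (b k a) 1) = N.w k a" if "k \<noteq> 0 \<or> a \<noteq> 0" for k a
    using \<phi>_b[OF that] by (simp add: N.ract_one del: N.w.simps)
  have \<phi>_left_one: "\<phi> (lmul h f) = lact \<Gamma> h (\<phi> f)"
    if "\<And>k a. k \<noteq> 0 \<or> a \<noteq> 0 \<Longrightarrow> \<phi> (lmul h (tens (b k a) 1)) = lact \<Gamma> h (N.w k a)" "f \<in> ?F" for h f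
  proof (rule span_tens_eq[OF lin_compose[OF lin lmul(1)] lin_l _ that(2)])
    fix k a :: nat and x :: 'h assume "False \<or> k \<noteq> 0 \<or> a \<noteq> 0"
    then have ka: "k \<noteq> 0 \<or> a \<noteq> 0" by simp
    have "\<phi> (lmul h (right_tens (tens (b k a) 1) x)) = ract \<Gamma> (lact \<Gamma> h (N.w k a)) x"
      by (simp only: lmul_right \<phi>_right[OF lmul_in_span[OF b1F[OF ka]]] that(1)[OF ka])
    then show "\<phi> (lmul h (tens (b k a) x)) = lact \<Gamma> h (\<phi> (tens (b k a) x))"
      by (simp add: right_tens \<phi>_b[OF ka] N.lact_ract del: N.w.simps)
  qed
  have \<phi>_g: "\<phi> (lmul g f) = lact \<Gamma> g (\<phi> f)" if "f \<in> ?F" for f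
  proof (rule \<phi>_left_one[OF _ that])
    fix k a :: nat assume "k \<noteq> 0 \<or> a \<noteq> 0"
    then show "\<phi> (lmul g (tens (b k a) 1)) = lact \<Gamma> g (N.w k a)"
    proof (induction k arbitrary: a)
      case 0
      then show ?case
        unfolding N.g_w[OF 0] by (subst lmul_b_one(2)) (simp add: \<phi>_simps \<phi>_right b1F \<phi>_one del: N.w.simps)
    next
      case (Suc k)
      have "\<phi> (lmul g (tens (b k (Suc a)) 1)) = lact \<Gamma> g (N.w k (Suc a))" by (rule Suc.IH) simp
      then show ?case
        unfolding N.g_w[OF Suc.prems]
        by (subst lmul_b_one(2)) (simp add: \<phi>_simps \<phi>_right b1F \<phi>_one del: N.w.simps of_nat_Suc)
    qed
  qed
  have \<phi>_p: "\<phi> (lmul p f) = lact \<Gamma> p (\<phi> f)" if "f \<in> ?F" for f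
    by (rule \<phi>_left_one[OF _ that])
      (simp add: lmul_b_one(1) N.p_w \<phi>_simps \<phi>_right b1F \<phi>_one del: N.w.simps)
  have \<phi>_left: "\<phi> (lmul h f) = lact \<Gamma> h (\<phi> f)" if "f \<in> ?F" for h f
    using that
  proof (induction h arbitrary: f rule: planck_induct)
    case ginv
    have "lmul g (lmul ginv f) = f" unfolding lmul(3)[symmetric] g_ginv lmul(4) ..
    then have "lact \<Gamma> ginv (\<phi> f) = lact \<Gamma> ginv (lact \<Gamma> g (\<phi> (lmul ginv f)))"
      using \<phi>_g[OF lmul_in_span[OF ginv, of ginv]] by simp
    then show ?case by (simp add: N.lact_mult[symmetric] ginv_g N.lact_one)
  qed (simp_all add: lmul N.lact_one \<phi>_p \<phi>_g lmul_in_span N.lact_mult lin_add[OF lmul(2)]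
      lin_scale[OF lmul(2)] \<phi>_simps N.lact_simps)
  have \<phi>_diff: "\<phi> (dmap h) = diff \<Gamma> h" for h
  proof (induction h rule: planck_induct)
    case one
    show ?case
      using N.Leibniz[of 1 1] by (simp add: dmap_def lmul(4) right_tens_one \<phi>_simps N.ract_one N.lact_one)
  next
    case p
    show ?case by (simp add: dmap_p \<phi>_b)
  next
    case g
    show ?case by (simp add: dmap_g \<phi>_b)
  next
    \<comment> \<open>In both calculi the Leibniz rule for \<open>g * ginv = 1\<close> determines
      the differential of \<open>ginv\<close> from that of \<open>g\<close>.\<close>
    case ginv
    have 0: "dmap 1 = 0" "diff \<Gamma> 1 = 0"
      using N.Leibniz[of 1 1] by (simp_all add: dmap_def lmul(4) right_tens_one N.ract_one N.lact_one)
    have "lmul ginv (dmap (g * ginv)) = lmul ginv (right_tens (dmap g) ginv) + dmap ginv"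
      by (simp add: dmap_mult lin_add[OF lmul(1)] lmul(3)[symmetric] ginv_g lmul(4) del: lmul(3))
    then have "lmul ginv (right_tens (dmap g) ginv) + dmap ginv = 0"
      by (simp add: g_ginv 0 lin_zero[OF lmul(1)])
    from minus_unique[OF this] have d: "dmap ginv = - lmul ginv (right_tens (dmap g) ginv)" ..
    have "lact \<Gamma> ginv (diff \<Gamma> (g * ginv)) = lact \<Gamma> ginv (ract \<Gamma> (diff \<Gamma> g) ginv) + diff \<Gamma> ginv"
      by (simp add: N.Leibniz N.lact_simps N.lact_mult[symmetric] ginv_g N.lact_one)
    then have "lact \<Gamma> ginv (ract \<Gamma> (diff \<Gamma> g) ginv) + diff \<Gamma> ginv = 0"
      by (simp add: g_ginv 0 N.lact_simps)
    from minus_unique[OF this] have "diff \<Gamma> ginv = - lact \<Gamma> ginv (ract \<Gamma> (diff \<Gamma> g) ginv)" ..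
    moreover have "\<phi> (dmap g) = diff \<Gamma> g" by (simp add: dmap_g \<phi>_b)
    ultimately show ?case
      by (simp only: d \<phi>_simps \<phi>_left[OF right_in_span[OF dmap_in_span]] \<phi>_right[OF dmap_in_span])
  next
    case (mult h k)
    then show ?case
      by (simp add: dmap_mult N.Leibniz \<phi>_simps \<phi>_left dmap_in_span \<phi>_right)
  qed (simp_all add: lin_add[OF lin_dmap] lin_scale[OF lin_dmap] lin_add[OF N.diff_linear]
      lin_scale[OF N.diff_linear] \<phi>_simps)
  have inj: "f = 0" if f: "f \<in> ?F" "\<phi> f = 0" for f
  proof -
    have v_enc: "v (prod_encode s) = N.w (fst s) (snd s)" for s
      by (simp add: v_def case_prod_beta del: N.w.simps)
    note w = N.w_independent[OF finite_diagram origin_diagram _ zero]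
    have w: "inj_on (\<lambda>s. v (prod_encode s)) diagram"
      "complex_vector.independent ((\<lambda>s. v (prod_encode s)) ` diagram)"
      unfolding v_enc by (rule w; simp add: diagram_def)+
    have "(\<Sum>s\<in>diagram. ract \<Gamma> (v (prod_encode s)) (Poly_Mapping.lookup f (prod_encode s)))
        = \<phi> (\<Sum>s\<in>diagram. Poly_Mapping.single (prod_encode s) (Poly_Mapping.lookup f (prod_encode s)))"
      by (simp add: \<phi>_simps \<phi>_single)
    also have "\<dots> = 0" using f form_expansion[OF f(1)] by simp
    finally have "Poly_Mapping.lookup f (prod_encode s) = 0" if "s \<in> diagram" for s
      using N.right_invariant_free[OF finite_diagram w(1) _ w(2), of "\<lambda>s. Poly_Mapping.lookup f (prod_encode s)" s]
        that by (simp add: v_enc N.w_right_invariant del: N.w.simps)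
    then show "f = 0" using form_expansion[OF f(1)] by simp
  qed
  have surj: "\<exists>f\<in>?F. \<eta> = \<phi> f" if "\<eta> \<in> N.F" for \<eta>
    using that unfolding N.forms_span
  proof (induction rule: complex_vector.span_induct_alt)
    case base
    then show ?case by (rule bexI[of _ 0]) (simp_all add: \<phi>_simps complex_vector.subspace_0)
  next
    case (step c x y)
    then obtain h k f where x: "x = lact \<Gamma> h (diff \<Gamma> k)" and f: "f \<in> ?F" "y = \<phi> f" by blast
    have "x = \<phi> (lmul h (dmap k))" by (simp add: x \<phi>_left dmap_in_span \<phi>_diff)
    then have "c *\<^sub>C x + y = \<phi> (c *\<^sub>C lmul h (dmap k) + f)" by (simp add: \<phi>_simps f)
    moreover have "c *\<^sub>C lmul h (dmap k) + f \<in> ?F"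
      by (simp add: f complex_vector.subspace_add complex_vector.subspace_scale lmul_in_span dmap_in_span)
    ultimately show ?case by blast
  qed
  have bij: "bij_betw \<phi> ?F N.F"
    unfolding bij_betw_def
  proof
    show "inj_on \<phi> ?F"
    proof (rule inj_onI)
      fix f f' assume "f \<in> ?F" "f' \<in> ?F" "\<phi> f = \<phi> f'"
      then have "f - f' = 0" by (intro inj) (simp_all add: complex_vector.subspace_diff \<phi>_simps)
      then show "f = f'" by simp
    qed
    show "\<phi> ` ?F = N.F" using surj by auto
  qed
  have bl: "bilin (\<lambda>x y. x \<otimes> \<phi> y)" "bilin (\<lambda>x y. \<phi> x \<otimes> y)"
    by (intro bilinI lin_tensor_left lin_tensor_right lin_id lin)+
  have left: "lcoact \<Gamma> (\<phi> f) = tensor_map UNIV ?F id \<phi> (lco f)" if f: "f \<in> ?F" for f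
  proof -
    have "tensor_map UNIV ?F id \<phi> (lco f) = tmap id \<phi> (lco f)"
      unfolding tensor_map_def id_def
      by (rule tensor_lift_cong) (simp_all add: bl lco_closed f)
    moreover have "lcoact \<Gamma> (\<phi> f) = tmap id \<phi> (lco f)"
    proof (rule span_tens_eq[OF _ lin_compose[OF lin_tensor_map[OF lin_id' lin] lin_lco] _ f])
      show "lin (\<lambda>f. lcoact \<Gamma> (\<phi> f))"
        by (rule linI) (simp_all add: \<phi>_simps linear_on_add[OF N.lcoact_linear] linear_on_scale[OF N.lcoact_linear])
      fix k a :: nat and x :: 'h assume "False \<or> k \<noteq> 0 \<or> a \<noteq> 0"
      then have ka: "k \<noteq> 0 \<or> a \<noteq> 0" by simp
      have "lcoact \<Gamma> (\<phi> (tens (b k a) x)) = (\<Sum>i\<le>k. of_nat (k choose i) *\<^sub>C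
          tlift (\<lambda>y z. ((pf i * ginv ^ k) * y) \<otimes> ract \<Gamma> (N.w (k - i) (a + i)) z) (\<Delta> x))"
        unfolding \<phi>_b[OF ka] N.lcoact_ract[OF N.w_form] N.lcoact_w[OF ka]
        by (rule N.tm_lr_left) (simp_all del: N.w.simps)
      also have "\<dots> = (\<Sum>i\<le>k. of_nat (k choose i) *\<^sub>C
          tlift (\<lambda>y z. ((pf i * ginv ^ k) * y) \<otimes> \<phi> (tens (b (k - i) (a + i)) z)) (\<Delta> x))"
      proof (intro sum.cong refl)
        fix i assume "i \<in> {..k}"
        then have "k - i \<noteq> 0 \<or> a + i \<noteq> 0" using ka by auto
        from \<phi>_b[OF this]
        show "of_nat (k choose i) *\<^sub>C tlift (\<lambda>y z. ((pf i * ginv ^ k) * y) \<otimes> ract \<Gamma> (N.w (k - i) (a + i)) z) (\<Delta> x)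
          = of_nat (k choose i) *\<^sub>C tlift (\<lambda>y z. ((pf i * ginv ^ k) * y) \<otimes> \<phi> (tens (b (k - i) (a + i)) z)) (\<Delta> x)"
          by (simp only:)
      qed
      also have "\<dots> = tmap id \<phi> (lco (tens (b k a) x))"
        unfolding lco_tens lin_simps[OF lin_tensor_map[OF lin_id' lin]] lterm_def
          tmap_tlift[OF lin_id' lin bilin_lterm]
        by (simp add: tensor_map_pure[OF lin_id' lin])
      finally show "lcoact \<Gamma> (\<phi> (tens (b k a) x)) = tmap id \<phi> (lco (tens (b k a) x))" .
    qed
    ultimately show ?thesis by simp
  qed
  have right: "rcoact \<Gamma> (\<phi> f) = tensor_map ?F UNIV \<phi> id (rco f)" if f: "f \<in> ?F" for f
  proof -
    have "tensor_map ?F UNIV \<phi> id (rco f) = tmap \<phi> id (rco f)"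
      unfolding tensor_map_def id_def
      by (rule tensor_lift_cong) (simp_all add: bl rco_closed f)
    moreover have "rcoact \<Gamma> (\<phi> f) = tmap \<phi> id (rco f)"
    proof (rule span_tens_eq[OF _ lin_compose[OF lin_tensor_map[OF lin lin_id'] lin_rco] _ f])
      show "lin (\<lambda>f. rcoact \<Gamma> (\<phi> f))"
        by (rule linI) (simp_all add: \<phi>_simps linear_on_add[OF N.rcoact_linear] linear_on_scale[OF N.rcoact_linear])
      fix k a :: nat and x :: 'h assume "False \<or> k \<noteq> 0 \<or> a \<noteq> 0"
      then have ka: "k \<noteq> 0 \<or> a \<noteq> 0" by simp
      have "rcoact \<Gamma> (\<phi> (tens (b k a) x)) = tlift (\<lambda>y z. ract \<Gamma> (N.w k a) y \<otimes> (1 * z)) (\<Delta> x)"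
        unfolding \<phi>_b[OF ka] N.rcoact_ract[OF N.w_form] N.rcoact_w
        by (rule N.tm_rr_left) (simp_all del: N.w.simps)
      also have "\<dots> = tmap \<phi> id (rco (tens (b k a) x))"
        unfolding rco_tens tmap_tlift[OF lin lin_id' bilin_rterm]
        by (simp add: tensor_map_pure[OF lin lin_id'] \<phi>_b[OF ka] del: N.w.simps)
      finally show "rcoact \<Gamma> (\<phi> (tens (b k a) x)) = tmap \<phi> id (rco (tens (b k a) x))" .
    qed
    ultimately show ?thesis by simp
  qed
  show ?thesis
    unfolding calculus_iso_def model_sel
    by (rule exI[of _ \<phi>])
      (simp add: bij linear_on_subset[OF lin] \<phi>_left \<phi>_right left right \<phi>_diff)
qed

end

section \<open>The calculi of the sets {n, 1} and {n}\<close>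

context planck_model
begin

text \<open>The basis is normalised by \<open>dg = g eta 0\<close> and \<open>dp = g eta 1\<close>,
  whereas \<open>w 0 1\<close> and \<open>w 1 0\<close> have the factor \<open>g\<close> on the
  right. Moving it to the left conjugates by \<open>ginv\<close>, which fixes \<open>w 0 1\<close>
  and costs \<open>w 1 0\<close> the correction \<open>lam w 0 1\<close>.\<close>

definition eta :: "nat \<Rightarrow> (nat \<Rightarrow>\<^sub>0 'h)" where
  "eta k = (if k = 0 then tens (b 0 1) 1
    else if k = 1 then tens (b 1 0) 1 - lam *\<^sub>C tens (b 0 1) 1 else tens (b k 0) 1)"

lemma eta_simps: "eta 0 = tens (b 0 1) 1" "eta (Suc 0) = tens (b 1 0 - lam *\<^sub>C b 0 1) 1"
  "eta (Suc (Suc k)) = tens (b (Suc (Suc k)) 0) 1"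
  by (simp_all add: eta_def tens_simps)

context
  fixes n :: nat
  assumes n: "2 \<le> n" and I: "I = {n, 1} \<or> I = {n}"
begin

lemma height_small: "height k = (if k = 0 then card I else if k < n then 1 else 0)"
proof -
  have "{m\<in>I. k < m} = (if k = 0 then I else if k < n then {n} else {})"
    using I n by auto
  then show ?thesis by (simp add: height_def)
qed

lemma card_small: "card I \<le> 2"
  using I n by auto

text \<open>The diagram is a hook: column 0 has height at most 2, the columns from 1 to
  \<open>n - 1\<close> have height 1, and the remaining ones are empty.\<close>

lemma b_vanish: "b 0 (Suc (Suc a)) = 0" "k \<noteq> 0 \<Longrightarrow> b k (Suc a) = 0" "n \<le> k \<Longrightarrow> b k a = 0"
  using card_small n by (auto intro!: b_zero simp: height_small)

lemma gact_small:
  "gact (b 0 (Suc 0)) = b 0 (Suc 0)"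
  "gact (b (Suc 0) 0) = b (Suc 0) 0 + lam *\<^sub>C b 0 (Suc 0)"
  "gact (b (Suc (Suc k)) 0) = b (Suc (Suc k)) 0"
  using gact_b[of 0 "Suc 0"] gact_b[of "Suc 0" 0] gact_b[of "Suc (Suc k)" 0]
  by (simp_all add: b_vanish lin_zero[OF lin_gact] add.commute)

lemma eta_0_singleton: "card I = 1 \<Longrightarrow> eta 0 = 0"
  using b_zero[of 0 1] by (simp add: height_small eta_def tens_simps)

lemma formulas_small: "planck_calculus_formulas (hbar / G) p g ginv model n eta"
proof -
  have diff: "dmap g = lmul g (eta 0)" "dmap p = lmul g (eta 1)"
    by (simp_all add: dmap_g dmap_p eta_simps lmul_gen gact_small lin_simps[OF lin_gact] right_tens)
  have g: "form_commutator model g (eta k) = (if k = 1 then lam *\<^sub>C lmul g (eta 0) else 0)" for k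
  proof -
    consider "k = 0" | "k = Suc 0" | j where "k = Suc (Suc j)" by (metis not0_implies_Suc)
    then show ?thesis
      by cases (simp_all add: form_commutator_def eta_simps lmul_gen right_tens gact_small
          lin_simps[OF lin_gact] lin_simps[OF lmul(1)] lin_simps[OF lin_right_tens] tens_simps
          scaleC_simps)
  qed
  have p: "form_commutator model p (eta k) = (lam * of_nat k) *\<^sub>C lmul g (eta k)
      + (if k = 0 \<or> k = n - 1 then 0 else lmul g (eta (k + 1)))" if "k < n" for k
  proof -
    \<comment> \<open>At \<open>k = n - 1\<close> raising leaves the diagram, which is the
      exceptional case in the commutator with \<open>p\<close>.\<close>
    have top: "b (Suc k) 0 = 0" if "k = n - 1" using that n by (intro b_vanish(3)) simp
    consider "k = 0" | "k = Suc 0" | j where "k = Suc (Suc j)" by (metis not0_implies_Suc)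
    then show ?thesis
      using top
      by cases (auto simp: form_commutator_def eta_simps lmul_gen right_tens gact_small pact_b b_vanish
          lin_simps[OF lin_gact] lin_simps[OF lin_pact] lin_simps[OF lmul(1)]
          lin_simps[OF lin_right_tens] tens_simps scaleC_simps algebra_simps simp del: of_nat_Suc)
  qed
  have l: "lco (eta k) = (if k = 1 then ginv \<otimes> eta 1 + (ginv * p) \<otimes> eta 0 else (ginv ^ k) \<otimes> eta k)" for k
  proof -
    consider "k = 0" | "k = Suc 0" | j where "k = Suc (Suc j)" by (metis not0_implies_Suc)
    then show ?thesis
    proof cases
      case 1
      then show ?thesis using lco_b_one[of 0 1] by (simp add: eta_simps)
    next
      case 2
      \<comment> \<open>The coaction of \<open>w 1 0\<close> contains \<open>p * ginv\<close>, the
        claimed formula \<open>ginv * p\<close>. The difference \<open>lam (1 - ginv)\<close> is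
        absorbed by the correction term in \<open>eta 1\<close>.\<close>
      have "lco (eta 1) = ginv \<otimes> tens (b 1 0) 1 + (p * ginv) \<otimes> tens (b 0 1) 1 - lam *\<^sub>C (1 \<otimes> tens (b 0 1) 1)"
        using lco_b_one[of 1 0] lco_b_one[of 0 1]
        by (simp add: eta_simps tens_simps lin_simps[OF lin_lco])
      then show ?thesis
        by (simp add: 2 eta_simps tens_simps p_ginv pure_tensor_simps scaleC_simps algebra_simps)
    next
      case (3 j)
      \<comment> \<open>Every term with \<open>i > 0\<close> falls off the hook: either it lies in a
        column \<open>k - i > 0\<close> of height one, or in column 0 at height \<open>k\<close>,
        which is at least 2.\<close>
      have "b (k - i) i = 0" if "i \<noteq> 0" "i \<le> k" for i
      proof (cases "k = i")
        case True
        then show ?thesis using 3 b_vanish(1)[of j] by auto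
      next
        case False
        with that obtain i' where "i = Suc i'" "k - i \<noteq> 0" by (cases i) auto
        then show ?thesis using b_vanish(2) by simp
      qed
      then have "lco (eta k) = (\<Sum>i\<le>k. if i = 0 then (ginv ^ k) \<otimes> tens (b k 0) 1 else 0)"
        unfolding 3 eta_simps lco_b_one unfolding 3[symmetric]
        by (intro sum.cong refl) (auto simp: tens_simps pure_tensor_simps)
      then show ?thesis using 3 by (simp add: eta_simps)
    qed
  qed
  show ?thesis
    unfolding planck_calculus_formulas_def lam_def[symmetric] model_sel
    by (intro conjI allI impI diff g p l)
qed

lemma basis_small:
  assumes K: "K = (if I = {n} then {1..<n} else {0..<n})"
  shows "right_invariant_basis model K eta"
proof -
  have c: "card I = (if I = {n} then 1 else 2)" using I n by auto
  have lk: "Poly_Mapping.lookup (tens (b k a) 1) (prod_encode (k', a'))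
      = (if k = k' \<and> a = a' \<and> a < height k then 1 else (0 :: 'h))" for k a k' a'
    by (auto simp: lookup_tens b_def lookup_single when_def inj_eq[OF inj_prod_encode])
  have pos: "k \<in> K \<Longrightarrow> k \<noteq> 0 \<Longrightarrow> 0 < height k" for k
    using K by (auto simp: height_small split: if_splits)
  have fin: "finite K" using K by simp
  have ind: "\<forall>c. (\<Sum>k\<in>K. c k *\<^sub>C eta k) = 0 \<longrightarrow> (\<forall>k\<in>K. c k = 0)"
  proof (intro allI impI ballI)
    fix c k assume sum: "(\<Sum>k\<in>K. c k *\<^sub>C eta k) = 0" and k: "k \<in> K"
    have L: "(\<Sum>k\<in>K. c k *\<^sub>C Poly_Mapping.lookup (eta k) m) = 0" for m
      using arg_cong[OF sum, of "\<lambda>f. Poly_Mapping.lookup f m"]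
      by (simp add: lin_sum[OF lin_lookup] lookup_scaleC)
    \<comment> \<open>Coordinates with \<open>k' > 0\<close> see only \<open>eta k'\<close>, so
      these coefficients vanish first. The coordinate (0, 1) is read afterwards, because
      \<open>eta 1\<close> has a component there as well as \<open>eta 0\<close>.\<close>
    have e: "Poly_Mapping.lookup (eta j) (prod_encode (k', 0)) = (if j = k' then 1 else 0)"
      if "j \<in> K" "k' \<noteq> 0" for j k'
      using that pos[of j] by (auto simp: eta_def lookup_minus lookup_scaleC lk)
    have c_pos: "c k' = 0" if "k' \<in> K" "k' \<noteq> 0" for k'
    proof -
      have "(\<Sum>j\<in>K. c j *\<^sub>C Poly_Mapping.lookup (eta j) (prod_encode (k', 0)))
          = (\<Sum>j\<in>K. if j = k' then c k' *\<^sub>C 1 else 0)"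
        by (intro sum.cong refl) (use e[OF _ that(2)] in auto)
      with L[of "prod_encode (k', 0)"] show ?thesis
        using that fin one_neq_zero by (simp add: complex_vector.scale_eq_0_iff)
    qed
    show "c k = 0"
    proof (cases "k = 0")
      case True
      then have "I \<noteq> {n}" using k K by auto
      then have h: "1 < height 0" using c by (simp add: height_small)
      have "(\<Sum>j\<in>K. c j *\<^sub>C Poly_Mapping.lookup (eta j) (prod_encode (0, 1)))
          = (\<Sum>j\<in>K. if j = 0 then c 0 *\<^sub>C 1 else 0)"
        by (intro sum.cong refl) (use c_pos h in \<open>auto simp: eta_def lk\<close>)
      with L[of "prod_encode (0, 1)"] show ?thesis
        using True k fin one_neq_zero by (simp add: complex_vector.scale_eq_0_iff)
    qed (use c_pos k in blast)
  qed
  have D: "k = 0 \<and> a = 1 \<or> a = 0 \<and> k \<in> {1..<n}" if "(k, a) \<in> diagram" for k a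
  proof (cases "k = 0")
    case True
    with that card_small show ?thesis by (simp add: diagram_def height_small)
  next
    case False
    with that show ?thesis by (simp add: diagram_def height_small split: if_splits)
  qed
  have w: "M.w k a \<in> complex_vector.span (eta ` K)" if "(k, a) \<in> diagram" for k a
  proof -
    have e: "eta j \<in> complex_vector.span (eta ` K)" if "j \<in> K" for j
      using that by (intro complex_vector.span_base) blast
    have e0: "eta 0 \<in> complex_vector.span (eta ` K)"
    proof (cases "I = {n}")
      case True
      then have "card I = 1" by simp
      then have "eta 0 = 0" by (rule eta_0_singleton)
      then show ?thesis by (simp add: complex_vector.span_zero)
    next
      case False
      then show ?thesis using K n by (intro e) simp
    qed
    have ka: "k \<noteq> 0 \<or> a \<noteq> 0" using that by (simp add: diagram_def)
    note cases = D[OF that]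
    have KK: "{1..<n} \<subseteq> K" unfolding K by auto
    show ?thesis
    proof (cases "k = 0")
      case True
      then have "a = 1" using cases by simp
      have "M.w k a = eta 0"
        unfolding M_w[OF ka] using True \<open>a = 1\<close> by (simp add: eta_def)
      then show ?thesis using e0 by (simp only:)
    next
      case False
      then have k: "a = 0" "k \<in> K" using cases KK by auto
      have "M.w k a = eta k + (if k = 1 then lam *\<^sub>C eta 0 else 0)"
        unfolding M_w[OF ka] using False k(1) by (simp add: eta_def)
      then show ?thesis
        using e[OF k(2)] e0
        by (simp only: complex_vector.span_add complex_vector.span_scale complex_vector.span_zero
            split: if_split) simp
    qed
  qed
  have inv: "eta k \<in> right_invariant_forms model" for k
  proof -
    have W: "tens (b j a) 1 \<in> right_invariant_forms model" if "j \<noteq> 0 \<or> a \<noteq> 0" for j a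
      using M.w_right_invariant[of j a] by (simp only: M_w[OF that])
    show ?thesis
      unfolding eta_def
      using W[of 0 1] W[of 1 0] W[of k 0]
      by (auto intro!: complex_vector.subspace_diff[OF M.right_invariant_subspace]
          complex_vector.subspace_scale[OF M.right_invariant_subspace])
  qed
  have "complex_vector.span (eta ` K) = right_invariant_forms model"
  proof
    show "complex_vector.span (eta ` K) \<subseteq> right_invariant_forms model"
      by (rule complex_vector.span_minimal[OF _ M.right_invariant_subspace]) (use inv in blast)
    show "right_invariant_forms model \<subseteq> complex_vector.span (eta ` K)"
      unfolding right_invariant_model
      by (rule complex_vector.span_minimal) (use w in auto)
  qed
  then show ?thesis
    unfolding right_invariant_basis_def
    using independent_family[OF fin ind] by blast
qed

end

end

text \<open>\<open>Suc k\<close> is an element exactly if the count drops between \<open>k\<close>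
  and \<open>Suc k\<close>.\<close>

lemma card_above_inject:
  assumes "finite I" "finite J" "I \<subseteq> {1..}" "J \<subseteq> {1..}"
    and eq: "\<And>k. card {n\<in>I. k < n} = card {n\<in>J. k < (n :: nat)}"
  shows "I = J"
proof -
  have step: "card {n\<in>A. k < n} = (if Suc k \<in> A then 1 else 0) + card {n\<in>A. Suc k < n}"
    if "finite A" for A :: "nat set" and k
  proof -
    have "{n\<in>A. k < n} = (if Suc k \<in> A then insert (Suc k) {n\<in>A. Suc k < n} else {n\<in>A. Suc k < n})"
      by (auto simp: Suc_lessI) (metis Suc_lessI)+
    then show ?thesis using that by simp
  qed
  have "Suc k \<in> I \<longleftrightarrow> Suc k \<in> J" for k
    using step[OF assms(1), of k] step[OF assms(2), of k] eq[of k] eq[of "Suc k"]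
    by (auto split: if_splits)
  then have "n \<in> I \<longleftrightarrow> n \<in> J" for n
    using assms(3,4) by (cases n) auto
  then show ?thesis by blast
qed

theorem proposition4p3:
  fixes hbar G :: complex
    and p g ginv :: "'h::complex_algebra_1"
    and \<Delta> :: "'h \<Rightarrow> ('h, 'h) tensor"
    and \<epsilon> :: "'h \<Rightarrow> complex"
    and S :: "'h \<Rightarrow> 'h"
  assumes "G \<noteq> 0"
    and "planck_hopf_algebra hbar G p g ginv \<Delta> \<epsilon> S"
  shows "\<exists>C :: nat set \<Rightarrow> ('h, nat \<Rightarrow>\<^sub>0 'h) calculus.
    (let \<I> = {I. finite I \<and> I \<noteq> {} \<and> I \<subseteq> {1..}} in
      (\<forall>I\<in>\<I>. bicovariant_calculus \<Delta> \<epsilon> S (C I) \<and> finite_dim_calculus (C I)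
        \<and> calculus_dim (C I) = (\<Sum>n\<in>I. n) - 1)
      \<and> (\<forall>I\<in>\<I>. \<forall>J\<in>\<I>. calculus_iso (C I) (C J) \<longrightarrow> I = J)
      \<and> (\<forall>\<Gamma> :: ('h, 'w::complex_vector) calculus.
          bicovariant_calculus \<Delta> \<epsilon> S \<Gamma> \<and> finite_dim_calculus \<Gamma>
          \<longrightarrow> (\<exists>I\<in>\<I>. calculus_iso \<Gamma> (C I))))
    \<and> (\<forall>n\<ge>2. \<exists>\<eta>. right_invariant_basis (C {n, 1}) {0..<n} \<eta>
        \<and> planck_calculus_formulas (hbar / G) p g ginv (C {n, 1}) n \<eta>)
    \<and> (\<forall>n\<ge>2. \<exists>\<eta>. \<eta> 0 = 0 \<and> right_invariant_basis (C {n}) {1..<n} \<eta>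
        \<and> planck_calculus_formulas (hbar / G) p g ginv (C {n}) n \<eta>)"
proof -
  interpret planck_hopf_algebra hbar G p g ginv \<Delta> \<epsilon> S by (fact assms(2))
  define \<I> :: "nat set set" where "\<I> = {I. finite I \<and> I \<noteq> {} \<and> I \<subseteq> {1..}}"
  have model: "planck_model hbar G p g ginv \<Delta> \<epsilon> S I" if "I \<in> \<I>" for I
    by unfold_locales (use that in \<open>simp_all add: \<I>_def\<close>)
  have calc: "planck_calculus hbar G p g ginv \<Delta> \<epsilon> S \<Gamma>" if "bicovariant_calculus \<Delta> \<epsilon> S \<Gamma>"
    for \<Gamma> :: "('h, 'v::complex_vector) calculus"
    by (intro planck_calculus.intro planck_hopf_algebra_axioms that)
  let ?w = "planck_calculus.w hbar G p g ginv"
  define C where "C = planck_model.model hbar G p g ginv \<Delta>"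
  have C: "bicovariant_calculus \<Delta> \<epsilon> S (C I)" "finite_dim_calculus (C I)"
    "calculus_dim (C I) = (\<Sum>n\<in>I. n) - 1"
    "k \<noteq> 0 \<or> a \<noteq> 0 \<Longrightarrow> ?w (C I) k a = 0 \<longleftrightarrow> card {n\<in>I. k < n} \<le> a" if "I \<in> \<I>" for I k a
    using planck_model.model_calculus[OF model[OF that]] planck_model.model_finite_dim[OF model[OF that]]
      planck_model.model_dim[OF model[OF that]] planck_model.M_w_zero[OF model[OF that], of k a]
    by (simp_all add: C_def planck_model.height_def[OF model[OF that]])
  have inj: "I = J" if I: "I \<in> \<I>" and J: "J \<in> \<I>" and iso: "calculus_iso (C I) (C J)" for I J
  proof -
    have w: "card {n\<in>I. k < n} \<le> a \<longleftrightarrow> card {n\<in>J. k < n} \<le> a" if "k \<noteq> 0 \<or> a \<noteq> 0" for k a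
      using planck_calculus_iso_zero[OF calc[OF C(1)[OF I]] calc[OF C(1)[OF J]] iso, of k a]
        C(4)[OF I that] C(4)[OF J that] by simp
    have pos: "card {n\<in>K. 0 < n} \<noteq> 0" if "K \<in> \<I>" for K
    proof -
      have "{n\<in>K. 0 < n} = K" using that by (auto simp: \<I>_def)
      then show ?thesis using that by (simp add: \<I>_def)
    qed
    \<comment> \<open>The zero patterns are known to agree away from (0, 0) only, so for
      \<open>k = 0\<close> the threshold 0 cannot be tested. There both heights are positive because
      \<open>I\<close> and \<open>J\<close> are non-empty; for \<open>k > 0\<close> the test at
      \<open>a = 0\<close> settles whether a height is zero.\<close>
    have nat_eq: "x = y" if "\<And>a. a \<noteq> 0 \<Longrightarrow> x \<le> a \<longleftrightarrow> y \<le> a" "x \<noteq> 0 \<longleftrightarrow> y \<noteq> 0" for x y :: nat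
      using that(1)[of x] that(1)[of y] that(2) by (cases "x = 0") auto
    show ?thesis
    proof (rule card_above_inject)
      fix k
      have "a \<noteq> 0 \<Longrightarrow> card {n\<in>I. k < n} \<le> a \<longleftrightarrow> card {n\<in>J. k < n} \<le> a" for a using w by simp
      moreover have "card {n\<in>I. k < n} \<noteq> 0 \<longleftrightarrow> card {n\<in>J. k < n} \<noteq> 0"
        using w[of k 0] pos[OF I] pos[OF J] by (cases "k = 0") auto
      ultimately show "card {n\<in>I. k < n} = card {n\<in>J. k < n}" by (rule nat_eq)
    qed (use I J in \<open>simp_all add: \<I>_def\<close>)
  qed
  have classify: "\<exists>I\<in>\<I>. calculus_iso \<Gamma> (C I)" if \<Gamma>: "bicovariant_calculus \<Delta> \<epsilon> S \<Gamma>" "finite_dim_calculus \<Gamma>"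
    for \<Gamma> :: "('h, 'w) calculus"
  proof -
    obtain I where I: "I \<in> \<I>" "\<forall>k a. k \<noteq> 0 \<or> a \<noteq> 0 \<longrightarrow> (?w \<Gamma> k a = 0 \<longleftrightarrow> card {n\<in>I. k < n} \<le> a)"
      using planck_calculus.w_zero_pattern[OF calc[OF \<Gamma>(1)] \<Gamma>(2)] unfolding \<I>_def by blast
    have "calculus_iso (C I) \<Gamma>"
      unfolding C_def
    proof (rule planck_model.model_iso[OF model[OF I(1)] calc[OF \<Gamma>(1)]])
      fix k a :: nat assume "k \<noteq> 0 \<or> a \<noteq> 0"
      with I(2) show "?w \<Gamma> k a = 0 \<longleftrightarrow> planck_model.height I k \<le> a"
        unfolding planck_model.height_def[OF model[OF I(1)]] by blast
    qed
    \<comment> \<open>\<open>model_iso\<close> maps out of the model; the claim asks for the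
      opposite direction.\<close>
    then have "calculus_iso \<Gamma> (C I)" by (rule calculus_iso_sym[OF C(1)[OF I(1)] \<Gamma>(1)])
    with I(1) show ?thesis by blast
  qed
  have b: "\<exists>\<eta>. right_invariant_basis (C {n, 1}) {0..<n} \<eta>
      \<and> planck_calculus_formulas (hbar / G) p g ginv (C {n, 1}) n \<eta>" if "2 \<le> n" for n
  proof -
    have "{n, 1} \<in> \<I>" using that by (simp add: \<I>_def)
    note m = model[OF this]
    show ?thesis
      unfolding C_def
      using planck_model.basis_small[OF m that] planck_model.formulas_small[OF m that] that
      by (intro exI conjI) auto
  qed
  have c: "\<exists>\<eta>. \<eta> 0 = 0 \<and> right_invariant_basis (C {n}) {1..<n} \<eta>
      \<and> planck_calculus_formulas (hbar / G) p g ginv (C {n}) n \<eta>" if "2 \<le> n" for n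
  proof -
    have "{n} \<in> \<I>" using that by (simp add: \<I>_def)
    note m = model[OF this]
    show ?thesis
      unfolding C_def
      using planck_model.basis_small[OF m that] planck_model.formulas_small[OF m that]
        planck_model.eta_0_singleton[OF m that]
      by (intro exI conjI) auto
  qed
  show ?thesis
    unfolding Let_def \<I>_def[symmetric]
    using C inj classify b c by (intro exI[of _ C]) blast
qed

end
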